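(* For a combinatorial $n+n$ symbic tree $\mathcal{T}$, let $C_{\mathcal T}$ be the set of all symmetric real $n\times n$ matrices $A$ of symmetric tropical rank $2$ whose symbic tree $T_A$ has combinatorial type $\mathcal T$. Then $C_{\mathcal T}$ is a polyhedral cone with the following descriptions: $$C_{\mathcal T}=\{A_T \mid T \text{ is a symbic tree of type } \mathcal T\}+L,$$ $$C_{\mathcal T}=\{-B_T \mid T \text{ is a symbic tree of type } \mathcal T\}+L,$$ where $L=\{X\odot X^\top\mid X\in\mathbb{R}^n\}$, $(X\odot X^\top)_{ij}=X_i+X_j$.
   Context: Tropical arithmetic is $a\oplus b=\min(a,b)$, $a\odot b=a+b$ on $\mathbb{R}$. "Polyhedral cone" allows relatively open cones, since edge lengths are required to be strictly positive. **Symmetric tropical rank.** Let $x_{ij}=x_{ji}$, $1\le i\le j\le n$, be the variables of a generic symmetric matrix. A symmetric real $n\times n$ matrix $A$ has symmetric tropical rank $2$ if for every $3\times3$ minor of the generic symmetric matrix, regarded as a polynomial in the $\binom{n+1}{2}$ variables $x_{ij}$ ($i\le j$) (in characteristic $0$, trivial valuation), the minimum over its distinct monomials $\prod x_{ij}^{m_{ij}}$ of $\sum m_{ij}A_{ij}$ is attained by at least two distinct monomials. (So this means rank at most 2.) **Symbic trees.** A split of a tree is a partition of the leaf labels obtained by removing an internal (non-leaf) edge. An $n+n$ symbic tree is a metric tree on leaves labelled $1,\dots,n,1',\dots,n'$ (unprimed and primed labels are two colors; no unlabelled vertices of degree 2; lengths of leaf edges disregarded) such that (1) each split contains both colors on both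 sides; (2) internal edges have positive lengths; (3) the metric tree is symmetric with respect to the involution swapping $i$ and $i'$ for all $i$; (4) the fixed points of the involution form a path (possibly a single point, possibly the midpoint of an edge), called the trunk. If the trunk is the midpoint of an edge, that point is regarded as a vertex of degree 2. A combinatorial symbic tree is a symbic tree without the metric data; a symbic tree is of type $\mathcal T$ if $\mathcal T$ is its underlying combinatorial tree. **The tree $T_A$.** For a symmetric $n\times n$ matrix $A$ of symmetric tropical rank $2$, let $P$ be the tropical convex hull of its columns (all tropical linear combinations) in $\mathbb{R}^n/\mathbb{R}(1,\dots,1)$; it is a tree made of line segments, with lengths measured by $d(x,y)=\max_i(x_i-y_i)-\min_i(x_i-y_i)$. There is a unique way to attach to $P$ one infinite ray in each coordinate direction $\mathbf e_1,\dots,\mathbf e_n$ making it balanced (at each vertex the primitive lattice directions of emanating edges sum into $\mathbb{R}(1,\dots,1)$). $T_A$ is the tree obtained from $P$ by attaching a leaf $i$ at the location of the $i$-th column and a leaf $j'$ where the ray $\mathbf e_j$ is attached. It is a symbic tree. **The matrices $A_T$, $B_T$.** Let $T$ be a symbic tree, and choose a vertex $O$ of $T$ fixed by the color-swapping involution (the same $O$ for all $T$ of a given type). $A_T$ is the $n\times n$ matrix whose $(i,j)$ entry is the distance in $T$ from $O$ to the vertex where the path from $O$ to leaf $i$ and the path from $O$ to leaf $j'$ diverge. $B_T$ is the $n\times n$ matrix whose $(i,j)$ entry is the total length of the internal edges along the path from leaf $i$ to leaf $j'$ in $T$. *)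

theory Defs
  imports
    "HOL-Analysis.Analysis"
    "HOL-Library.Poly_Mapping"
    "HOL-Library.Sublist"
begin

section \<open>Symmetric tropical rank\<close>

text \<open>
  Polynomials over the rationals in the variables $x_{ij}$, $i \le j$: a monomial is a finitely
  supported exponent function on index pairs.
\<close>

type_synonym 'n sym_monom = "('n \<times> 'n) \<Rightarrow>\<^sub>0 nat"
type_synonym 'n sym_poly = "'n sym_monom \<Rightarrow>\<^sub>0 rat"

definition sym_var :: "'n::linorder \<Rightarrow> 'n \<Rightarrow> 'n sym_poly" where
  "sym_var i j = Poly_Mapping.single (Poly_Mapping.single (min i j, max i j) 1) 1"

text \<open>
  Rows and columns are selected by injections; reordering them changes a minor only by a sign
  and hence does not affect its set of monomials.
\<close>

definition sym_minor :: "(3 \<Rightarrow> 'n::linorder) \<Rightarrow> (3 \<Rightarrow> 'n) \<Rightarrow> 'n sym_poly" where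
  "sym_minor r c = det (\<chi> a b. sym_var (r a) (c b))"

definition monom_weight :: "real^('n::finite)^'n \<Rightarrow> 'n sym_monom \<Rightarrow> real" where
  "monom_weight A m = (\<Sum>p\<in>Poly_Mapping.keys m. real (Poly_Mapping.lookup m p) * A $ fst p $ snd p)"

definition sym_trop_rank_2 :: "real^('n::{finite,linorder})^('n::{finite,linorder}) \<Rightarrow> bool" where
  "sym_trop_rank_2 A \<longleftrightarrow>
     (\<forall>r c. inj r \<and> inj c \<longrightarrow>
       (\<exists>m1\<in>Poly_Mapping.keys (sym_minor r c). \<exists>m2\<in>Poly_Mapping.keys (sym_minor r c). m1 \<noteq> m2 \<and>
         (\<forall>m\<in>Poly_Mapping.keys (sym_minor r c).
            monom_weight A m1 \<le> monom_weight A m \<and> monom_weight A m2 \<le> monom_weight A m)))"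

section \<open>Symbic trees\<close>

text \<open>
  Finite simple graphs with labelled leaves. The label \<open>Inl i\<close> stands for the unprimed leaf $i$
  and \<open>Inr i\<close> for the primed leaf $i'$.
\<close>

record ('v, 'n) ltree =
  verts :: "'v set"
  edges :: "'v set set"
  leaf :: "'n + 'n \<Rightarrow> 'v"

definition path_in :: "'v set set \<Rightarrow> 'v \<Rightarrow> 'v \<Rightarrow> 'v list \<Rightarrow> bool" where
  "path_in E u v p \<longleftrightarrow>
     p \<noteq> [] \<and> hd p = u \<and> last p = v \<and> distinct p \<and> successively (\<lambda>x y. {x, y} \<in> E) p"

definition is_tree :: "('v, 'n) ltree \<Rightarrow> bool" where
  "is_tree T \<longleftrightarrow>
     finite (verts T) \<and> verts T \<noteq> {} \<and>
     (\<forall>e\<in>edges T. e \<subseteq> verts T \<and> card e = 2) \<and>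
     (\<forall>u\<in>verts T. \<forall>v\<in>verts T. \<exists>!p. path_in (edges T) u v p)"

definition degree :: "('v, 'n) ltree \<Rightarrow> 'v \<Rightarrow> nat" where
  "degree T v = card {e \<in> edges T. v \<in> e}"

definition internal_verts :: "('v, 'n) ltree \<Rightarrow> 'v set" where
  "internal_verts T = verts T - range (leaf T)"

definition internal_edges :: "('v, 'n) ltree \<Rightarrow> 'v set set" where
  "internal_edges T = {e \<in> edges T. e \<inter> range (leaf T) = {}}"

definition split_side :: "('v, 'n) ltree \<Rightarrow> 'v set \<Rightarrow> 'v \<Rightarrow> ('n + 'n) set" where
  "split_side T e u = {l. \<exists>p. path_in (edges T - {e}) u (leaf T l) p}"

definition color_involution :: "('v, 'n) ltree \<Rightarrow> ('v \<Rightarrow> 'v) \<Rightarrow> bool" where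
  "color_involution T \<sigma> \<longleftrightarrow>
     (\<forall>v\<in>verts T. \<sigma> v \<in> verts T \<and> \<sigma> (\<sigma> v) = v) \<and>
     (\<forall>e\<in>edges T. \<sigma> ` e \<in> edges T) \<and>
     (\<forall>i. \<sigma> (leaf T (Inl i)) = leaf T (Inr i) \<and> \<sigma> (leaf T (Inr i)) = leaf T (Inl i))"

definition fixed_verts :: "('v, 'n) ltree \<Rightarrow> ('v \<Rightarrow> 'v) \<Rightarrow> 'v set" where
  "fixed_verts T \<sigma> = {v \<in> verts T. \<sigma> v = v}"

text \<open>
  If the trunk is the midpoint of an edge, that edge is always subdivided by the midpoint. So the
  fixed vertices are nonempty and form a path (they are the vertices of the trunk), and an
  internal vertex has degree 2 only if it is such a midpoint, i.e. if it alone is the trunk.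
\<close>

definition combinatorial_symbic_tree :: "('v, 'n) ltree \<Rightarrow> bool" where
  "combinatorial_symbic_tree T \<longleftrightarrow>
     is_tree T \<and>
     bij_betw (leaf T) UNIV {v \<in> verts T. degree T v = 1} \<and>
     (\<forall>e\<in>internal_edges T. \<forall>u\<in>e.
        (\<exists>i. Inl i \<in> split_side T e u) \<and> (\<exists>i. Inr i \<in> split_side T e u)) \<and>
     (\<exists>\<sigma>. color_involution T \<sigma> \<and>
        (\<exists>u v p. path_in (edges T) u v p \<and> set p = fixed_verts T \<sigma>) \<and>
        (\<forall>v\<in>internal_verts T.
           degree T v \<ge> 3 \<or> degree T v = 2 \<and> fixed_verts T \<sigma> = {v}))"

text \<open>
  A symbic tree of combinatorial type \<open>T\<close> is \<open>T\<close> together with a length function \<open>len\<close> as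
  follows; values of \<open>len\<close> outside the internal edges are never used.
\<close>

definition symbic_metric :: "('v, 'n) ltree \<Rightarrow> ('v set \<Rightarrow> real) \<Rightarrow> bool" where
  "symbic_metric T len \<longleftrightarrow>
     (\<forall>e\<in>internal_edges T. len e > 0) \<and>
     (\<forall>\<sigma>. color_involution T \<sigma> \<longrightarrow> (\<forall>e\<in>internal_edges T. len (\<sigma> ` e) = len e))"

section \<open>The tree of a matrix\<close>

text \<open>
  Points of $\mathbb{R}^n/\mathbb{R}(1,\dots,1)$ are given by representatives in $\mathbb{R}^n$,
  and subsets of the quotient by subsets of $\mathbb{R}^n$ that are unions of classes.
\<close>

definition tequiv :: "real^'n \<Rightarrow> real^'n \<Rightarrow> bool"  (infix "\<sim>\<^sub>1" 50) where
  "x \<sim>\<^sub>1 y \<longleftrightarrow> (\<exists>c. x = y + vec c)"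

definition saturate :: "(real^'n) set \<Rightarrow> (real^'n) set" where
  "saturate S = {x. \<exists>y\<in>S. x \<sim>\<^sub>1 y}"

definition trop_dist :: "real^'n \<Rightarrow> real^'n \<Rightarrow> real" where
  "trop_dist x y = Max (range (\<lambda>i. x $ i - y $ i)) - Min (range (\<lambda>i. x $ i - y $ i))"

definition trop_hull :: "real^'n^'n \<Rightarrow> (real^'n) set" where
  "trop_hull A = {x. \<exists>c. \<forall>i. x $ i = Min (range (\<lambda>j. c j + column j A $ i))}"

text \<open>
  Primitive lattice directions of the edges of \<open>P\<close> emanating from \<open>x\<close>. Each class in
  $\mathbb{Z}^n/\mathbb{Z}(1,\dots,1)$ is represented by its unique element with minimum 0.
\<close>

definition directions :: "(real^'n) set \<Rightarrow> real^'n \<Rightarrow> (int^'n) set" where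
  "directions P x = {u. Min (range (($) u)) = 0 \<and> Gcd (range (($) u)) = 1 \<and>
     (\<exists>\<epsilon>>0. \<forall>t\<in>{0..\<epsilon>}. x + t *\<^sub>R (\<chi> i. of_int (u $ i)) \<in> P)}"

text \<open>
  \<open>ray j\<close> is the point of the hull where the ray in direction $e_j$ is attached. The condition
  holds automatically at points in the interior of an edge where no ray is attached.
\<close>

definition balanced_rays :: "real^('n::finite)^'n \<Rightarrow> ('n \<Rightarrow> real^'n) \<Rightarrow> bool" where
  "balanced_rays A ray \<longleftrightarrow>
     (\<forall>j. ray j \<in> trop_hull A) \<and>
     (\<forall>x\<in>trop_hull A. \<exists>c.
        (\<Sum>u\<in>directions (trop_hull A) x. u) + (\<Sum>j | ray j \<sim>\<^sub>1 x. axis j 1) = vec c)"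

definition edge_segment :: "('v \<Rightarrow> real^'n) \<Rightarrow> 'v set \<Rightarrow> (real^'n) set" where
  "edge_segment \<phi> e = saturate (convex hull (\<phi> ` e))"

text \<open>
  \<open>(T, len)\<close> is (isomorphic to) the metric tree $T_A$: the map \<open>\<phi>\<close> places the internal vertices
  in the hull, the internal edges subdivide the hull into line segments of the right lengths that
  meet only in common end points, and the leaves are attached at the columns and at the ends of
  the rays.
\<close>

definition is_tree_of_matrix ::
  "real^('n::finite)^'n \<Rightarrow> ('v, 'n) ltree \<Rightarrow> ('v set \<Rightarrow> real) \<Rightarrow> bool" where
  "is_tree_of_matrix A T len \<longleftrightarrow>
     (\<exists>ray \<phi>. balanced_rays A ray \<and>
        (\<forall>u\<in>internal_verts T. \<forall>v\<in>internal_verts T. \<phi> u \<sim>\<^sub>1 \<phi> v \<longrightarrow> u = v) \<and>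
        trop_hull A = saturate (\<phi> ` internal_verts T) \<union> (\<Union>e\<in>internal_edges T. edge_segment \<phi> e) \<and>
        (\<forall>e\<in>internal_edges T. \<forall>e'\<in>internal_edges T. e \<noteq> e' \<longrightarrow>
           edge_segment \<phi> e \<inter> edge_segment \<phi> e' = saturate (\<phi> ` (e \<inter> e'))) \<and>
        (\<forall>u v. {u, v} \<in> internal_edges T \<longrightarrow> len {u, v} = trop_dist (\<phi> u) (\<phi> v)) \<and>
        (\<forall>i v. {leaf T (Inl i), v} \<in> edges T \<longrightarrow> \<phi> v \<sim>\<^sub>1 column i A) \<and>
        (\<forall>j v. {leaf T (Inr j), v} \<in> edges T \<longrightarrow> \<phi> v \<sim>\<^sub>1 ray j))"

definition matrices_of_type :: "('v, 'n::{finite,linorder}) ltree \<Rightarrow> (real^('n::{finite,linorder})^('n::{finite,linorder})) set" where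
  "matrices_of_type T =
     {A. transpose A = A \<and> sym_trop_rank_2 A \<and>
         (\<exists>len. symbic_metric T len \<and> is_tree_of_matrix A T len)}"

section \<open>The matrices of a symbic tree\<close>

definition tree_path :: "('v, 'n) ltree \<Rightarrow> 'v \<Rightarrow> 'v \<Rightarrow> 'v list" where
  "tree_path T u v = (THE p. path_in (edges T) u v p)"

definition path_edges :: "'v list \<Rightarrow> 'v set set" where
  "path_edges p = {{p ! k, p ! Suc k} | k. Suc k < length p}"

definition internal_length :: "('v, 'n) ltree \<Rightarrow> ('v set \<Rightarrow> real) \<Rightarrow> 'v \<Rightarrow> 'v \<Rightarrow> real" where
  "internal_length T len u v = (\<Sum>e\<in>path_edges (tree_path T u v) \<inter> internal_edges T. len e)"

definition divergence_vertex :: "('v, 'n) ltree \<Rightarrow> 'v \<Rightarrow> 'v \<Rightarrow> 'v \<Rightarrow> 'v" where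
  "divergence_vertex T z u v = last (longest_common_prefix (tree_path T z u) (tree_path T z v))"

text \<open>
  \<open>z\<close> and the divergence vertex are internal, so all edges between them are internal edges.
\<close>

definition A_matrix :: "('v, 'n::finite) ltree \<Rightarrow> ('v set \<Rightarrow> real) \<Rightarrow> 'v \<Rightarrow> real^'n^'n" where
  "A_matrix T len z =
     (\<chi> i j. internal_length T len z (divergence_vertex T z (leaf T (Inl i)) (leaf T (Inr j))))"

definition B_matrix :: "('v, 'n::finite) ltree \<Rightarrow> ('v set \<Rightarrow> real) \<Rightarrow> real^'n^'n" where
  "B_matrix T len = (\<chi> i j. internal_length T len (leaf T (Inl i)) (leaf T (Inr j)))"

definition trop_squares :: "(real^'n^'n) set" where
  "trop_squares = {(\<chi> i j. x $ i + x $ j) | x. True}"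

text \<open>Relatively open cones are allowed.\<close>

definition polyhedral_cone :: "'a::euclidean_space set \<Rightarrow> bool" where
  "polyhedral_cone C \<longleftrightarrow> (\<exists>K. polyhedron K \<and> convex_cone K \<and> (C = K \<or> C = rel_interior K))"

end

theory Submission
  imports Defs
begin

text \<open>
  Root the tree at the fixed vertex. The entries of \<open>A_T\<close> are then the Gromov products
  \<open>(i | j')\<close>, which form an ultrametric, and \<open>B_T\<close> is obtained from them by
  \<open>- B_T = A_{2T} - X - X\<^sup>T\<close> with \<open>X\<close> the distances of the leaves from the root.

  The point \<open>p\<close> of the tree is sent to the vector \<open>(p | i')\<close>, \<open>i = 1, ..., n\<close>. By the ultrametric
  inequality a tropical combination of columns is a truncation of one column, so the image of the
  tree is the tropical hull. Moving along an edge away from the root increases exactly the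
  coordinates \<open>i\<close> with \<open>i'\<close> beyond the edge, so lengths are right and the rays balance.

  Conversely, tropical convexity forces each edge of a hull to have a 0/1 direction, and balancing,
  applied inductively from the leaves, determines this direction from the combinatorial tree.
  Hence the columns are those of \<open>A_T\<close> up to adding constants to rows and columns, and symmetry
  makes these constants agree.
\<close>

section \<open>Rooted trees\<close>

text \<open>Two obstacles remain behind this picture. Rank 2 asks for two different monomials, not
  for two optimal permutations, and the two 3-cycles of a principal minor give one monomial. The
  ultrametric inequality alone would let such a 3-cycle be the only optimum: this happens when three
  pairs \<open>i\<close>, \<open>i'\<close> leave one vertex along three fixed branches with
  positive products inside each pair and zero products across. A trunk that is a path has no such
  vertex. The other obstacle is that points are known only modulo (1,...,1). For every internal edge
  the colour condition on splits supplies a primed leaf beyond it and another one on the side of the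
  root. So each edge moves some coordinates but not all of them, and no length is lost in the
  quotient. Polyhedrality rests on linearity: \<open>A_T\<close> is linear in the edge lengths, the
  metrics of a fixed type are the positive functions on orbits of internal edges, and relative
  interiors commute with linear images and Minkowski sums, even when the generators are linearly
  dependent.\<close>

lemma path_in_prefix: "path_in E u v (p @ q) \<Longrightarrow> p \<noteq> [] \<Longrightarrow> path_in E u (last p) p"
  by (auto simp: path_in_def successively_append_iff)

lemma path_in_suffix: "path_in E u v (p @ q) \<Longrightarrow> q \<noteq> [] \<Longrightarrow> path_in E (hd q) v q"
  by (auto simp: path_in_def successively_append_iff)

lemma path_in_rev: "path_in E u v p \<Longrightarrow> path_in E v u (rev p)"
  by (simp add: path_in_def hd_rev last_rev insert_commute)

lemma path_in_subset: "path_in E u v p \<Longrightarrow> E \<subseteq> F \<Longrightarrow> path_in F u v p"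
  unfolding path_in_def by (auto elim!: successively_mono)

lemma path_edges_simps [simp]:
  "path_edges [] = {}" "path_edges [x] = {}"
  "path_edges (x # y # p) = insert {x, y} (path_edges (y # p))"
proof -
  show "path_edges (x # y # p) = insert {x, y} (path_edges (y # p))"
    unfolding path_edges_def
  proof (intro set_eqI iffI)
    fix e assume "e \<in> {{(x # y # p) ! k, (x # y # p) ! Suc k} |k. Suc k < length (x # y # p)}"
    then obtain k where k: "e = {(x # y # p) ! k, (x # y # p) ! Suc k}" "Suc k < length (x # y # p)"
      by blast
    then show "e \<in> insert {x, y} {{(y # p) ! k, (y # p) ! Suc k} |k. Suc k < length (y # p)}"
      by (cases k) auto
  next
    fix e assume "e \<in> insert {x, y} {{(y # p) ! k, (y # p) ! Suc k} |k. Suc k < length (y # p)}"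
    then consider "e = {x, y}"
      | k where "e = {(y # p) ! k, (y # p) ! Suc k}" "Suc k < length (y # p)"
      by blast
    then show "e \<in> {{(x # y # p) ! k, (x # y # p) ! Suc k} |k. Suc k < length (x # y # p)}"
    proof cases
      case 1
      then show ?thesis by (intro CollectI exI [of _ 0]) auto
    next
      case (2 k)
      then show ?thesis by (intro CollectI exI [of _ "Suc k"]) auto
    qed
  qed
qed (auto simp: path_edges_def)

lemma path_edges_append: "path_edges (p @ x # q) = path_edges (p @ [x]) \<union> path_edges (x # q)"
proof (induction p)
  case (Cons a p)
  then show ?case by (cases p) auto
qed auto

lemma path_edges_rev: "path_edges (rev p) = path_edges p"
proof (induction p rule: induct_list012)
  case (3 x y p)
  then show ?case
    using path_edges_append [of "rev p" y "[x]"] by (simp add: insert_commute)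
qed auto

lemma path_edges_subset: "successively (\<lambda>x y. {x, y} \<in> E) p \<Longrightarrow> path_edges p \<subseteq> E"
  by (induction p rule: induct_list012) auto

section \<open>Ancestors and parents in a rooted tree\<close>

locale rooted_tree =
  fixes T :: "('v, 'n) ltree" and z :: 'v
  assumes tree: "is_tree T" and root: "z \<in> verts T"
begin

abbreviation rpath :: "'v \<Rightarrow> 'v list" where "rpath \<equiv> tree_path T z"

definition anc :: "'v \<Rightarrow> 'v set" where "anc v = set (rpath v)"

text \<open>As \<open>rpath z\<close> is \<open>[z]\<close>, the shortened list is empty at the root
  and \<open>parent z\<close> is unspecified; hence the recurring assumption
  \<open>v \<noteq> z\<close>.\<close>

definition parent :: "'v \<Rightarrow> 'v" where "parent v = last (butlast (rpath v))"

lemma finite_verts: "finite (verts T)"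
  and edge_subset: "e \<in> edges T \<Longrightarrow> e \<subseteq> verts T"
  and edge_card: "e \<in> edges T \<Longrightarrow> card e = 2"
  using tree by (auto simp: is_tree_def)

lemma tree_path_unique:
  assumes "u \<in> verts T" "v \<in> verts T" "path_in (edges T) u v p"
  shows "tree_path T u v = p"
proof -
  have "\<exists>!p. path_in (edges T) u v p"
    using assms(1,2) tree by (simp add: is_tree_def)
  then show ?thesis
    unfolding tree_path_def using assms(3) by (rule the1_equality)
qed

lemma path_in_tree_path:
  assumes "u \<in> verts T" "v \<in> verts T"
  shows "path_in (edges T) u v (tree_path T u v)"
proof -
  have "\<exists>!p. path_in (edges T) u v p"
    using assms tree by (simp add: is_tree_def)
  then show ?thesis
    unfolding tree_path_def by (rule theI')
qed

lemma path_in_verts: "path_in (edges T) u v p \<Longrightarrow> u \<in> verts T \<Longrightarrow> set p \<subseteq> verts T"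
proof (induction p arbitrary: u)
  case (Cons a p)
  show ?case
  proof (cases p)
    case (Cons b q)
    then have "path_in (edges T) b v p" "{a, b} \<in> edges T"
      using Cons.prems by (auto simp: path_in_def successively_Cons)
    then have "set p \<subseteq> verts T"
      using Cons.IH edge_subset by blast
    then show ?thesis
      using Cons.prems by (simp add: path_in_def)
  qed (use Cons.prems in \<open>auto simp: path_in_def\<close>)
qed auto

lemma rpath_in: "v \<in> verts T \<Longrightarrow> path_in (edges T) z v (rpath v)"
  by (simp add: path_in_tree_path root)

lemma rpath_root [simp]: "rpath z = [z]"
  by (rule tree_path_unique) (auto simp: root path_in_def)

lemma rpath_ne [simp]: "v \<in> verts T \<Longrightarrow> rpath v \<noteq> []"
  and hd_rpath: "v \<in> verts T \<Longrightarrow> hd (rpath v) = z"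
  and last_rpath: "v \<in> verts T \<Longrightarrow> last (rpath v) = v"
  and distinct_rpath: "v \<in> verts T \<Longrightarrow> distinct (rpath v)"
  using rpath_in [of v] by (auto simp: path_in_def)

lemma anc_root [simp]: "anc z = {z}"
  by (simp add: anc_def)

lemma anc_verts: "v \<in> verts T \<Longrightarrow> anc v \<subseteq> verts T"
  unfolding anc_def using path_in_verts rpath_in root by blast

lemma anc_self [simp]: "v \<in> verts T \<Longrightarrow> v \<in> anc v"
  and root_in_anc [simp]: "v \<in> verts T \<Longrightarrow> z \<in> anc v"
  unfolding anc_def using rpath_ne last_rpath hd_rpath last_in_set hd_in_set by metis+

lemma rpath_prefix:
  assumes "v \<in> verts T" "rpath v = p @ q" "p \<noteq> []"
  shows "rpath (last p) = p"
proof (rule tree_path_unique)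
  show "path_in (edges T) z (last p) p"
    using rpath_in [OF assms(1)] assms path_in_prefix by metis
  show "last p \<in> verts T"
    using anc_verts [OF assms(1)] assms by (auto simp: anc_def)
qed (rule root)

lemma anc_split: "v \<in> verts T \<Longrightarrow> x \<in> anc v \<Longrightarrow> \<exists>q. rpath v = rpath x @ q"
proof -
  assume v: "v \<in> verts T" and "x \<in> anc v"
  then obtain a b where ab: "rpath v = (a @ [x]) @ b"
    using split_list [of x "rpath v"] by (auto simp: anc_def)
  then have "rpath x = a @ [x]"
    using rpath_prefix [OF v ab] by simp
  with ab show ?thesis by auto
qed

lemma anc_mono: "v \<in> verts T \<Longrightarrow> x \<in> anc v \<Longrightarrow> anc x \<subseteq> anc v"
  using anc_split by (fastforce simp: anc_def)

lemma anc_chain: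
  assumes "v \<in> verts T" "x \<in> anc v" "y \<in> anc v"
  shows "x \<in> anc y \<or> y \<in> anc x"
proof -
  obtain p q where p: "rpath v = rpath x @ p" and q: "rpath v = rpath y @ q"
    using anc_split assms by meson
  have V: "x \<in> verts T" "y \<in> verts T"
    using anc_verts assms by auto
  have "prefix (rpath x) (rpath y) \<or> prefix (rpath y) (rpath x)"
    using p q by (metis prefixI prefix_same_cases)
  then show ?thesis
    using V anc_self by (metis anc_def set_mono_prefix subsetD)
qed

lemma anc_antisym:
  assumes "x \<in> verts T" "y \<in> verts T" "x \<in> anc y" "y \<in> anc x"
  shows "x = y"
proof -
  obtain p q where "rpath y = rpath x @ p" "rpath x = rpath y @ q"
    using anc_split assms by meson
  then have "rpath x = rpath y" by simp
  then show ?thesis using assms last_rpath by metis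
qed

lemma rpath_parent:
  assumes "v \<in> verts T" "v \<noteq> z"
  shows "rpath v = rpath (parent v) @ [v]" "parent v \<in> verts T" "{parent v, v} \<in> edges T"
proof -
  have eq: "rpath v = butlast (rpath v) @ [v]"
    using assms last_rpath rpath_ne append_butlast_last_id by metis
  have ne: "butlast (rpath v) \<noteq> []"
  proof
    assume "butlast (rpath v) = []"
    then have "rpath v = [v]" using eq by simp
    then show False using hd_rpath [OF assms(1)] assms(2) by simp
  qed
  then have *: "rpath (parent v) = butlast (rpath v)"
    unfolding parent_def using rpath_prefix [OF assms(1) eq] by simp
  with eq show 1: "rpath v = rpath (parent v) @ [v]" by simp
  have "parent v \<in> anc v"
    unfolding anc_def parent_def using ne by (metis in_set_butlastD last_in_set)
  then show "parent v \<in> verts T" using anc_verts assms(1) by blast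
  then have "last (rpath (parent v)) = parent v" "rpath (parent v) \<noteq> []"
    using last_rpath by auto
  then show "{parent v, v} \<in> edges T"
    using rpath_in [OF assms(1)] 1 by (auto simp: path_in_def successively_append_iff)
qed

lemma anc_parent:
  assumes "v \<in> verts T" "v \<noteq> z"
  shows "anc v = insert v (anc (parent v))" "v \<notin> anc (parent v)"
  using rpath_parent(1) [OF assms] distinct_rpath [OF assms(1)]
  by (auto simp: anc_def)

lemma parent_neq: "v \<in> verts T \<Longrightarrow> v \<noteq> z \<Longrightarrow> parent v \<noteq> v"
  using anc_parent(2) rpath_parent(2) anc_self by metis

text \<open>Uniqueness of paths orients every edge. If \<open>b\<close> lies on the path to
  \<open>a\<close>, then the tail of that path and the edge itself are both paths from
  \<open>b\<close> to \<open>a\<close>, so they agree; otherwise appending \<open>b\<close> to the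
  path to \<open>a\<close> yields the path to \<open>b\<close>.\<close>

lemma edge_parent:
  assumes "e \<in> edges T"
  shows "\<exists>v\<in>verts T - {z}. e = {parent v, v}"
proof -
  obtain a b where e: "e = {a, b}" "a \<noteq> b"
    using edge_card [OF assms] by (auto simp: card_2_iff)
  have V: "a \<in> verts T" "b \<in> verts T"
    using edge_subset [OF assms] e by auto
  show ?thesis
  proof (cases "b \<in> anc a")
    case True
    then obtain q where q: "rpath a = rpath b @ q" using anc_split V by blast
    then have "rpath a = butlast (rpath b) @ (b # q)"
      using V by (metis append_assoc append_butlast_last_id append_Cons append_Nil last_rpath rpath_ne)
    then have "path_in (edges T) b a (b # q)"
      using path_in_suffix [of "edges T" z a "butlast (rpath b)" "b # q"] rpath_in [OF V(1)] by simp
    moreover have "path_in (edges T) b a [b, a]"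
      using assms e by (auto simp: path_in_def insert_commute)
    ultimately have "q = [a]" using tree_path_unique V by (metis list.inject)
    with q have "parent a = b" by (simp add: parent_def last_rpath V)
    moreover have "a \<noteq> z" using True V e by auto
    ultimately show ?thesis using V e by (intro bexI [of _ a]) auto
  next
    case False
    then have "path_in (edges T) z b (rpath a @ [b])"
      using rpath_in [OF V(1)] assms e
      by (auto simp: path_in_def successively_append_iff anc_def)
    then have r: "rpath b = rpath a @ [b]" using tree_path_unique V root by blast
    then have "parent b = a" by (simp add: parent_def last_rpath V)
    moreover have "b \<noteq> z" using r V by (metis False root_in_anc)
    ultimately show ?thesis using V e by (intro bexI [of _ b]) auto
  qed
qed

lemma parent_edge_inj:
  assumes "u \<in> verts T" "u \<noteq> z" "v \<in> verts T" "v \<noteq> z" "{parent u, u} = {parent v, v}"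
  shows "u = v"
proof (rule ccontr)
  assume "u \<noteq> v"
  then have "parent u = v" "parent v = u" using assms by (auto simp: doubleton_eq_iff)
  then show False
    using anc_parent assms \<open>u \<noteq> v\<close> anc_self by (metis insertI1 insertI2)
qed

text \<open>Each vertex after \<open>w\<close> contributes the edge to its parent; \<open>w\<close>
  only starts the segment and contributes none.\<close>

lemma path_edges_below:
  assumes "v \<in> verts T" "rpath v = p @ w # q"
  shows "path_edges (w # q) = (\<lambda>x. {parent x, x}) ` set q"
  using assms
proof (induction q arbitrary: v rule: rev_induct)
  case (snoc x q)
  have "x = v" using last_rpath [OF snoc.prems(1)] snoc.prems(2) by simp
  have "rpath (last (p @ w # q)) = p @ w # q"
    using rpath_prefix [OF snoc.prems(1), of "p @ w # q" "[x]"] snoc.prems by simp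
  moreover have "last (p @ w # q) \<in> verts T"
    using anc_verts [OF snoc.prems(1)] snoc.prems(2) by (auto simp: anc_def)
  ultimately have IH: "path_edges (w # q) = (\<lambda>x. {parent x, x}) ` set q"
    using snoc.IH by blast
  have "parent x = last (w # q)"
    using snoc.prems \<open>x = v\<close> by (simp add: parent_def butlast_append)
  moreover have "path_edges (w # q @ [x]) = insert {last (w # q), x} (path_edges (w # q))"
    using path_edges_append [of "butlast (w # q)" "last (w # q)" "[x]"]
      append_butlast_last_id [of "w # q"]
    by (metis append.assoc append_Cons append_Nil insert_is_Un list.distinct(1) path_edges_simps(2,3)
        sup_commute)
  ultimately show ?case using IH by auto
qed auto

text \<open>Past the common prefix the two root paths are disjoint: a shared vertex has only one
  root path, which would prolong the prefix. So one tail backwards, the vertex \<open>w\<close>, and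
  the other tail form the path from \<open>u\<close> to \<open>v\<close>. All path lengths thereby
  become sums over symmetric differences of ancestor sets.\<close>

lemma divergence:
  assumes "u \<in> verts T" "v \<in> verts T"
  shows "divergence_vertex T z u v \<in> verts T"
    and "anc (divergence_vertex T z u v) = anc u \<inter> anc v"
    and "path_edges (tree_path T u v) =
      (\<lambda>x. {parent x, x}) ` ((anc u - anc v) \<union> (anc v - anc u))"
proof -
  define c where "c = longest_common_prefix (rpath u) (rpath v)"
  define w where "w = last c"
  obtain a b where a: "rpath u = c @ a" and b: "rpath v = c @ b"
    unfolding c_def using longest_common_prefix_prefix1 longest_common_prefix_prefix2
    by (metis prefixE)
  have "prefix [z] (rpath u)" "prefix [z] (rpath v)"
    using assms hd_rpath rpath_ne by (metis list.exhaust_sel prefix_Cons Nil_prefix)+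
  then have "prefix [z] c"
    unfolding c_def by (rule longest_common_prefix_max_prefix)
  then have ne: "c \<noteq> []" by auto
  have dis: "set a \<inter> set b = {}"
  proof (rule ccontr)
    assume "set a \<inter> set b \<noteq> {}"
    then obtain x where x: "x \<in> set a" "x \<in> set b" by blast
    then obtain a1 a2 b1 b2 where s: "a = a1 @ x # a2" "b = b1 @ x # b2"
      by (meson split_list)
    have "rpath x = c @ a1 @ [x]" "rpath x = c @ b1 @ [x]"
      using rpath_prefix [OF assms(1), of "c @ a1 @ [x]" a2] rpath_prefix [OF assms(2), of "c @ b1 @ [x]" b2] a b s
      by auto
    then have "a1 = b1" by simp
    then have "prefix (c @ a1 @ [x]) (rpath u)" "prefix (c @ a1 @ [x]) (rpath v)"
      using a b s by auto
    then have "prefix (c @ a1 @ [x]) c"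
      unfolding c_def by (rule longest_common_prefix_max_prefix)
    then show False by (auto dest: prefix_length_le)
  qed
  have w: "divergence_vertex T z u v = w" by (simp add: divergence_vertex_def c_def w_def)
  have "w \<in> anc u" using a ne by (auto simp: anc_def w_def)
  then show "divergence_vertex T z u v \<in> verts T" using w anc_verts assms by auto
  have cw: "rpath w = c" unfolding w_def using rpath_prefix [OF assms(1) a ne] .
  have da: "distinct (c @ a)" "distinct (c @ b)" using distinct_rpath assms a b by metis+
  then show "anc (divergence_vertex T z u v) = anc u \<inter> anc v"
    unfolding w using cw a b dis by (auto simp: anc_def)
  have cs: "c = butlast c @ [w]" using ne w_def by simp
  have au: "rpath u = butlast c @ w # a" and bv: "rpath v = butlast c @ w # b"
    using a b cs by (metis append.assoc append_Cons append_Nil)+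
  have pu: "path_in (edges T) w u (w # a)"
    using path_in_suffix [of "edges T" z u "butlast c" "w # a"] rpath_in [OF assms(1)] au by simp
  have pv: "path_in (edges T) w v (w # b)"
    using path_in_suffix [of "edges T" z v "butlast c" "w # b"] rpath_in [OF assms(2)] bv by simp
  have "path_in (edges T) u v (rev (w # a) @ b)"
    using path_in_rev [OF pu] pv dis da cs
    by (auto simp: path_in_def successively_append_iff successively_Cons hd_append)
  then have "tree_path T u v = rev (w # a) @ b"
    using tree_path_unique assms by blast
  then have "path_edges (tree_path T u v) = path_edges (rev a @ w # b)" by simp
  also have "\<dots> = path_edges (rev (w # a)) \<union> path_edges (w # b)"
    using path_edges_append [of "rev a" w b] by simp
  also have "\<dots> = (\<lambda>x. {parent x, x}) ` (set a \<union> set b)"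
    unfolding path_edges_rev using path_edges_below [OF assms(1) au] path_edges_below [OF assms(2) bv]
    by auto
  also have "set a = anc u - anc v" using a b dis da by (auto simp: anc_def)
  also have "set b = anc v - anc u" using a b dis da by (auto simp: anc_def)
  finally show "path_edges (tree_path T u v) =
      (\<lambda>x. {parent x, x}) ` ((anc u - anc v) \<union> (anc v - anc u))" .
qed

section \<open>Children, degrees and induced paths\<close>

lemma anc_child:
  assumes "v \<in> verts T" "x \<in> anc v" "x \<noteq> v"
  shows "\<exists>y\<in>anc v. y \<noteq> z \<and> parent y = x"
proof -
  have x: "x \<in> verts T" using assms anc_verts by blast
  obtain q where q: "rpath v = rpath x @ q" using anc_split assms by blast
  have "q \<noteq> []"
    using q assms last_rpath x by (metis append_Nil2)
  then obtain y r where "q = y # r" by (cases q) auto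
  then have y: "rpath v = (rpath x @ [y]) @ r" using q by simp
  then have ry: "rpath y = rpath x @ [y]" using rpath_prefix [OF assms(1) y] by simp
  then have "parent y = x" by (simp add: parent_def last_rpath x)
  moreover have "y \<in> anc v" using y by (simp add: anc_def)
  moreover have "y \<noteq> z" using ry rpath_ne [OF x] by auto
  ultimately show ?thesis by blast
qed

lemma parent_in_anc: "v \<in> verts T \<Longrightarrow> v \<noteq> z \<Longrightarrow> parent v \<in> anc v"
  using anc_parent(1) rpath_parent(2) by auto

lemma edge_at:
  assumes "e \<in> edges T" "v \<in> e"
  shows "v \<noteq> z \<and> e = {parent v, v} \<or> (\<exists>y\<in>verts T - {z}. parent y = v \<and> e = {v, y})"
  using edge_parent [OF assms(1)] assms(2) by auto

text \<open>A descendant of \<open>v\<close> of maximal depth works, since a child of it would be a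
  deeper descendant. Unless it is the root, such a vertex has degree 1.\<close>

lemma exists_childless:
  assumes "v \<in> verts T"
  shows "\<exists>w\<in>verts T. v \<in> anc w \<and> (\<forall>y\<in>verts T - {z}. parent y \<noteq> w)"
proof -
  define S where "S = {w \<in> verts T. v \<in> anc w}"
  have "finite S" "S \<noteq> {}" using finite_verts assms by (auto simp: S_def)
  then have "Max ((\<lambda>y. length (rpath y)) ` S) \<in> (\<lambda>y. length (rpath y)) ` S"
    by (intro Max_in) auto
  then obtain w where "w \<in> S" "Max ((\<lambda>y. length (rpath y)) ` S) = length (rpath w)"
    by auto
  with \<open>finite S\<close> have w: "w \<in> S" "\<And>y. y \<in> S \<Longrightarrow> length (rpath y) \<le> length (rpath w)"
    by (auto intro!: Max_ge simp flip: \<open>Max _ = _\<close>)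
  have False if "y \<in> verts T - {z}" "parent y = w" for y
  proof -
    have "rpath y = rpath w @ [y]" using rpath_parent that by auto
    moreover have "y \<in> S"
      using w that anc_parent(1) [of y] by (auto simp: S_def)
    ultimately show False using w(2) [of y] by simp
  qed
  then show ?thesis using w by (auto simp: S_def)
qed

lemma degree_childless:
  assumes "v \<in> verts T" "v \<noteq> z" "\<forall>y\<in>verts T - {z}. parent y \<noteq> v"
  shows "degree T v = 1"
proof -
  have "{e \<in> edges T. v \<in> e} = {{parent v, v}}"
    using edge_at assms rpath_parent(3) by blast
  then show ?thesis by (simp add: degree_def)
qed

lemma finite_edges: "finite (edges T)"
  using finite_subset [of "edges T" "Pow (verts T)"] edge_subset finite_verts by auto

lemma degree_inner:
  assumes "x \<in> verts T" "x \<noteq> z" "parent x \<noteq> z"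
  shows "degree T (parent x) \<ge> 2"
proof -
  let ?y = "parent x"
  have y: "?y \<in> verts T" using rpath_parent assms by auto
  have "{{parent ?y, ?y}, {?y, x}} \<subseteq> {e \<in> edges T. ?y \<in> e}"
    using rpath_parent [OF assms(1,2)] rpath_parent [OF y assms(3)] by auto
  moreover have "{parent ?y, ?y} \<noteq> {?y, x}"
    using parent_edge_inj [OF y assms(3) assms(1,2)] parent_neq assms by auto
  ultimately show ?thesis
    unfolding degree_def using card_mono [of "{e \<in> edges T. ?y \<in> e}" "{{parent ?y, ?y}, {?y, x}}"] finite_edges
    by auto
qed

text \<open>Paths in a tree are induced subgraphs: a chord and the stretch of the path between its
  ends would be two paths with the same ends.\<close>

lemma path_adjacent:
  assumes p: "path_in (edges T) u v p" "u \<in> verts T"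
    and km: "k < m" "m < length p" "{p ! k, p ! m} \<in> edges T"
  shows "m = Suc k"
proof -
  let ?q = "drop k (take (Suc m) p)"
  have 1: "path_in (edges T) u (p ! m) (take (Suc m) p)"
    using path_in_prefix [of "edges T" u v "take (Suc m) p" "drop (Suc m) p"] p km
    by (cases "p = []") (simp_all add: last_conv_nth)
  have "path_in (edges T) (hd ?q) (p ! m) ?q"
    using path_in_suffix [of "edges T" u "p ! m" "take k (take (Suc m) p)" ?q] 1 km
    by (simp del: drop_take take_take)
  moreover have "hd ?q = p ! k" using km by (simp add: hd_drop_conv_nth)
  ultimately have "path_in (edges T) (p ! k) (p ! m) ?q" by simp
  moreover have "path_in (edges T) (p ! k) (p ! m) [p ! k, p ! m]"
    using km p(1) by (auto simp: path_in_def nth_eq_iff_index_eq)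
  moreover have "p ! k \<in> verts T" "p ! m \<in> verts T" using edge_subset [OF km(3)] by auto
  ultimately have "?q = [p ! k, p ! m]" using tree_path_unique by metis
  then have "length ?q = 2" by (metis One_nat_def Suc_1 length_Cons list.size(3))
  then show ?thesis using km by simp
qed

text \<open>By \<open>path_adjacent\<close> neighbours on a path sit at consecutive positions, and
  there are only two of those. This is the form in which the shape of the trunk will be
  used.\<close>

lemma path_three_neighbours:
  assumes p: "path_in (edges T) u v p" "u \<in> verts T"
    and w: "w \<in> set p" "a \<in> set p" "b \<in> set p" "c \<in> set p"
    and e: "{w, a} \<in> edges T" "{w, b} \<in> edges T" "{w, c} \<in> edges T"
  shows "a = b \<or> a = c \<or> b = c"
proof -
  obtain k where k: "k < length p" "p ! k = w" using w by (meson in_set_conv_nth)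
  have "\<exists>m<length p. p ! m = y \<and> (m = Suc k \<or> k = Suc m)" if y: "y \<in> set p" "{w, y} \<in> edges T" for y
  proof -
    obtain m where m: "m < length p" "p ! m = y" using y by (meson in_set_conv_nth)
    have "w \<noteq> y" using edge_card [OF y(2)] by auto
    then have "k \<noteq> m" using k m by auto
    then consider "k < m" | "m < k" by linarith
    then show ?thesis
    proof cases
      case 1
      then show ?thesis using path_adjacent [OF p, of k m] k m y by auto
    next
      case 2
      then show ?thesis using path_adjacent [OF p, of m k] k m y
        by (intro exI [of _ m]) (simp add: insert_commute)
    qed
  qed
  from this [OF w(2) e(1)] this [OF w(3) e(2)] this [OF w(4) e(3)] show ?thesis by force
qed

end

section \<open>Symbic trees\<close>

locale symbic_tree = rooted_tree T z for T :: "('v, 'n) ltree" and z :: 'v +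
  fixes \<sigma> :: "'v \<Rightarrow> 'v"
  assumes combinatorial: "combinatorial_symbic_tree T"
    and involution: "color_involution T \<sigma>"
    and fixed_root: "\<sigma> z = z"
begin

abbreviation uleaf :: "'n \<Rightarrow> 'v" where "uleaf i \<equiv> leaf T (Inl i)"
abbreviation pleaf :: "'n \<Rightarrow> 'v" where "pleaf i \<equiv> leaf T (Inr i)"

definition nodes :: "'v set" where "nodes = internal_verts T - {z}"

lemma leaf_verts [simp]: "leaf T l \<in> verts T"
  and degree_leaf: "degree T (leaf T l) = 1"
  and inj_leaf: "inj (leaf T)"
  and leaf_range: "v \<in> verts T \<Longrightarrow> degree T v = 1 \<Longrightarrow> v \<in> range (leaf T)"
proof -
  have "bij_betw (leaf T) UNIV {v \<in> verts T. degree T v = 1}"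
    using combinatorial by (simp add: combinatorial_symbic_tree_def)
  then have *: "inj (leaf T)" "range (leaf T) = {v \<in> verts T. degree T v = 1}"
    by (simp_all add: bij_betw_def)
  then show "inj (leaf T)" "v \<in> verts T \<Longrightarrow> degree T v = 1 \<Longrightarrow> v \<in> range (leaf T)"
    by simp_all
  show "leaf T l \<in> verts T" "degree T (leaf T l) = 1"
    using *(2) by (simp_all add: set_eq_iff) blast+
qed

lemma involution_leaf [simp]: "\<sigma> (uleaf i) = pleaf i" "\<sigma> (pleaf i) = uleaf i"
  and involution_vert: "v \<in> verts T \<Longrightarrow> \<sigma> v \<in> verts T"
  and involution_idem: "v \<in> verts T \<Longrightarrow> \<sigma> (\<sigma> v) = v"
  using involution by (auto simp: color_involution_def)

text \<open>The involution exchanges the colours, so it moves every leaf, while it fixes the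
  root.\<close>

lemma leaf_neq_root [simp]: "leaf T l \<noteq> z"
proof
  assume *: "leaf T l = z"
  show False
  proof (cases l)
    case (Inl i)
    then show False using involution_leaf(1) [of i] * fixed_root inj_leaf by (auto dest: injD)
  next
    case (Inr i)
    then show False using involution_leaf(2) [of i] * fixed_root inj_leaf by (auto dest: injD)
  qed
qed

lemma root_internal: "z \<in> internal_verts T"
  using root leaf_neq_root by (metis DiffI imageE internal_verts_def)

lemma internal_verts_subset: "internal_verts T \<subseteq> verts T"
  by (auto simp: internal_verts_def)

lemma parent_internal:
  assumes "x \<in> verts T" "x \<noteq> z"
  shows "parent x \<in> internal_verts T"
proof (cases "parent x = z")
  case True
  then show ?thesis by (simp add: root_internal)
next
  case False
  then have "degree T (parent x) \<ge> 2" using degree_inner assms by blast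
  then have "parent x \<notin> range (leaf T)" using degree_leaf by fastforce
  then show ?thesis using rpath_parent assms by (auto simp: internal_verts_def)
qed

lemma anc_internal:
  assumes "v \<in> verts T" "x \<in> anc v" "x \<noteq> v"
  shows "x \<in> internal_verts T"
  using anc_child [OF assms] parent_internal anc_verts assms(1) by blast

lemma nodesD: "x \<in> nodes \<Longrightarrow> x \<in> verts T" "x \<in> nodes \<Longrightarrow> x \<noteq> z" "x \<in> nodes \<Longrightarrow> x \<in> internal_verts T"
  by (auto simp: nodes_def internal_verts_def)

lemma finite_nodes [simp]: "finite nodes"
  using finite_verts by (auto simp: nodes_def internal_verts_def)

lemma leaf_not_node [simp]: "leaf T l \<notin> nodes"
  by (auto simp: nodes_def internal_verts_def)

lemma internal_edges_eq: "internal_edges T = (\<lambda>x. {parent x, x}) ` nodes"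
proof (intro set_eqI iffI)
  fix e assume e: "e \<in> internal_edges T"
  then obtain v where v: "v \<in> verts T - {z}" "e = {parent v, v}"
    using edge_parent unfolding internal_edges_def by blast
  then have "v \<in> nodes" using e by (auto simp: internal_edges_def nodes_def internal_verts_def)
  then show "e \<in> (\<lambda>x. {parent x, x}) ` nodes" using v by auto
next
  fix e assume "e \<in> (\<lambda>x. {parent x, x}) ` nodes"
  then obtain x where x: "x \<in> nodes" "e = {parent x, x}" by auto
  then have "parent x \<in> internal_verts T" using parent_internal nodesD by blast
  then show "e \<in> internal_edges T"
    using x rpath_parent(3) [of x] nodesD [OF x(1)] by (auto simp: internal_edges_def internal_verts_def)
qed

lemma inj_parent_edge: "inj_on (\<lambda>x. {parent x, x}) (verts T - {z})"
  by (rule inj_onI) (use parent_edge_inj in blast)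

lemma internal_length_eq:
  assumes "u \<in> verts T" "v \<in> verts T"
  shows "internal_length T len u v =
    (\<Sum>x\<in>((anc u - anc v) \<union> (anc v - anc u)) \<inter> nodes. len {parent x, x})"
proof -
  let ?f = "\<lambda>x. {parent x, x}" and ?D = "(anc u - anc v) \<union> (anc v - anc u)"
  have D: "?D \<subseteq> verts T - {z}"
    using assms anc_verts by auto
  have "?f ` ?D \<inter> ?f ` nodes = ?f ` (?D \<inter> nodes)"
    using inj_on_image_Int [OF inj_parent_edge D, of nodes] nodesD by auto
  then have "internal_length T len u v = sum len (?f ` (?D \<inter> nodes))"
    unfolding internal_length_def divergence(3) [OF assms] internal_edges_eq by simp
  also have "\<dots> = (\<Sum>x\<in>?D \<inter> nodes. len (?f x))"
    by (subst sum.reindex) (use D in \<open>auto intro: inj_on_subset [OF inj_parent_edge]\<close>)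
  finally show ?thesis .
qed

text \<open>
  Below, an internal edge is represented by its endpoint farther from the root: \<open>w x\<close> is the
  length of the edge from \<open>parent x\<close> to \<open>x\<close>, and \<open>gp w u v\<close> is the Gromov product of \<open>u\<close> and
  \<open>v\<close> at the root.
\<close>

definition gp :: "('v \<Rightarrow> real) \<Rightarrow> 'v \<Rightarrow> 'v \<Rightarrow> real" where
  "gp w u v = (\<Sum>x\<in>anc u \<inter> anc v \<inter> nodes. w x)"

text \<open>A path that avoids the edge is also a path of the whole tree, hence the unique one, and
  \<open>divergence(3)\<close> decides by ancestor sets whether that one crosses the edge.\<close>

lemma split_below:
  assumes x: "x \<in> nodes" and l: "l \<in> split_side T {parent x, x} u"
  shows "u = parent x \<Longrightarrow> x \<notin> anc (leaf T l)" and "u = x \<Longrightarrow> x \<in> anc (leaf T l)"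
proof -
  let ?e = "{parent x, x}"
  have X: "x \<in> verts T" "x \<noteq> z" "parent x \<in> verts T" using x nodesD rpath_parent by auto
  obtain p where p: "path_in (edges T - {?e}) u (leaf T l) p"
    using l by (auto simp: split_side_def)
  have *: "?e \<notin> path_edges (tree_path T u (leaf T l))" if "u \<in> verts T"
  proof -
    have "path_in (edges T) u (leaf T l) p" using path_in_subset [OF p] by simp
    then have "tree_path T u (leaf T l) = p" using tree_path_unique [OF that] by simp
    moreover have "path_edges p \<subseteq> edges T - {?e}"
      using p by (intro path_edges_subset) (simp add: path_in_def)
    ultimately show ?thesis by auto
  qed
  show "x \<notin> anc (leaf T l)" if "u = parent x"
  proof
    assume "x \<in> anc (leaf T l)"
    then have "x \<in> anc (leaf T l) - anc u" using that anc_parent X by auto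
    then show False using * that X by (auto simp: divergence(3))
  qed
  show "x \<in> anc (leaf T l)" if "u = x"
  proof (rule ccontr)
    assume "x \<notin> anc (leaf T l)"
    then have "x \<in> anc u - anc (leaf T l)" using that X by auto
    then show False using * that X by (auto simp: divergence(3))
  qed
qed

lemma split_colors:
  "\<forall>e\<in>internal_edges T. \<forall>u\<in>e.
     (\<exists>i. Inl i \<in> split_side T e u) \<and> (\<exists>i. Inr i \<in> split_side T e u)"
  and trunk_path: "\<exists>\<tau>. color_involution T \<tau> \<and>
     (\<exists>u v p. path_in (edges T) u v p \<and> set p = fixed_verts T \<tau>)"
proof -
  show "\<forall>e\<in>internal_edges T. \<forall>u\<in>e.
     (\<exists>i. Inl i \<in> split_side T e u) \<and> (\<exists>i. Inr i \<in> split_side T e u)"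
    using combinatorial unfolding combinatorial_symbic_tree_def by (elim conjE)
  have "\<exists>\<tau>. color_involution T \<tau> \<and>
     (\<exists>u v p. path_in (edges T) u v p \<and> set p = fixed_verts T \<tau>) \<and>
     (\<forall>v\<in>internal_verts T. degree T v \<ge> 3 \<or> degree T v = 2 \<and> fixed_verts T \<tau> = {v})"
    using combinatorial unfolding combinatorial_symbic_tree_def by (elim conjE)
  then show "\<exists>\<tau>. color_involution T \<tau> \<and>
     (\<exists>u v p. path_in (edges T) u v p \<and> set p = fixed_verts T \<tau>)"
    by (elim exE conjE) (intro exI conjI)
qed

text \<open>The split condition in rooted form: the first two claims concern the side beyond the
  edge, the last two the side of the root.\<close>

lemma colors:
  assumes x: "x \<in> nodes"
  shows "\<exists>i. x \<in> anc (uleaf i)" "\<exists>i. x \<in> anc (pleaf i)" "\<exists>i. x \<notin> anc (uleaf i)" "\<exists>i. x \<notin> anc (pleaf i)"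
proof -
  have "{parent x, x} \<in> internal_edges T" using x internal_edges_eq by auto
  then have "\<forall>u\<in>{parent x, x}. (\<exists>i. Inl i \<in> split_side T {parent x, x} u) \<and> (\<exists>i. Inr i \<in> split_side T {parent x, x} u)"
    using split_colors by (rule bspec [rotated])
  then obtain i j i' j' where "Inl i \<in> split_side T {parent x, x} x" "Inr j \<in> split_side T {parent x, x} x"
    "Inl i' \<in> split_side T {parent x, x} (parent x)" "Inr j' \<in> split_side T {parent x, x} (parent x)"
    by auto
  then show "\<exists>i. x \<in> anc (uleaf i)" "\<exists>i. x \<in> anc (pleaf i)" "\<exists>i. x \<notin> anc (uleaf i)" "\<exists>i. x \<notin> anc (pleaf i)"
    using split_below [OF x] by (metis (no_types))+
qed

section \<open>The colour involution\<close>

lemma map_involution_path: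
  assumes \<tau>: "color_involution T \<tau>" and uv: "u \<in> verts T" "v \<in> verts T"
  shows "map \<tau> (tree_path T u v) = tree_path T (\<tau> u) (\<tau> v)"
proof -
  have inj: "inj_on \<tau> (verts T)" using \<tau> by (metis color_involution_def inj_on_inverseI)
  have p: "path_in (edges T) u v (tree_path T u v)" using path_in_tree_path uv by blast
  then have s: "set (tree_path T u v) \<subseteq> verts T" using path_in_verts uv by metis
  have "\<tau> ` {a, b} \<in> edges T" if "{a, b} \<in> edges T" for a b
    using \<tau> that by (auto simp: color_involution_def)
  then have "{\<tau> a, \<tau> b} \<in> edges T" if "{a, b} \<in> edges T" for a b
    using that by auto
  then have "path_in (edges T) (\<tau> u) (\<tau> v) (map \<tau> (tree_path T u v))"
    using p inj_on_subset [OF inj s]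
    by (auto simp: path_in_def successively_map distinct_map hd_map last_map elim!: successively_mono)
  moreover have "\<tau> u \<in> verts T" "\<tau> v \<in> verts T" using \<tau> uv by (auto simp: color_involution_def)
  ultimately show ?thesis using tree_path_unique by metis
qed

text \<open>Every vertex lies on a path between two leaves, and involutions agree on leaves.\<close>

lemma involution_unique:
  assumes \<tau>: "color_involution T \<tau>" and v: "v \<in> verts T"
  shows "\<tau> v = \<sigma> v"
proof -
  \<comment> \<open>With a leaf as root, a childless vertex is a leaf in every case: either it is
    the root or it has degree 1. So \<open>v\<close> lies on a path with leaves at both
    ends.\<close>
  define r where "r = uleaf (undefined :: 'n)"
  interpret R: rooted_tree T r
    by unfold_locales (auto simp: r_def tree)
  have leaf: "\<tau> (leaf T l) = \<sigma> (leaf T l)" for l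
    using \<tau> by (cases l) (auto simp: color_involution_def)
  obtain w where w: "w \<in> verts T" "v \<in> R.anc w" "\<forall>y\<in>verts T - {r}. R.parent y \<noteq> w"
    using R.exists_childless v by blast
  have "w \<in> range (leaf T)"
    using R.degree_childless [of w] w leaf_range by (cases "w = r") (auto simp: r_def)
  then have "\<tau> w = \<sigma> w" "\<tau> r = \<sigma> r" using leaf r_def by auto
  then have "map \<tau> (tree_path T r w) = map \<sigma> (tree_path T r w)"
    using map_involution_path [OF \<tau> R.root w(1)] map_involution_path [OF involution R.root w(1)] by simp
  then show ?thesis using w(2) by (auto simp: R.anc_def)
qed

lemma rpath_involution: "v \<in> verts T \<Longrightarrow> rpath (\<sigma> v) = map \<sigma> (rpath v)"
  using map_involution_path [OF involution root] fixed_root by simp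

lemma anc_involution: "v \<in> verts T \<Longrightarrow> anc (\<sigma> v) = \<sigma> ` anc v"
  by (simp add: anc_def rpath_involution)

lemma involution_inj: "inj_on \<sigma> (verts T)"
  by (metis involution_idem inj_on_inverseI)

lemma involution_root_iff: "v \<in> verts T \<Longrightarrow> \<sigma> v = z \<longleftrightarrow> v = z"
  using involution_idem fixed_root by metis

lemma parent_involution:
  assumes "v \<in> verts T" "v \<noteq> z"
  shows "parent (\<sigma> v) = \<sigma> (parent v)"
proof -
  have "rpath (\<sigma> v) = map \<sigma> (rpath (parent v)) @ [\<sigma> v]"
    using rpath_involution assms rpath_parent(1) by auto
  then show ?thesis
    using rpath_parent(2) [OF assms] by (simp add: parent_def last_map last_rpath)
qed

lemma involution_leaf_range: "\<sigma> (leaf T l) \<in> range (leaf T)"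
  by (cases l) auto

lemma involution_nodes: "\<sigma> ` nodes = nodes"
proof -
  have *: "\<sigma> x \<in> nodes" if x: "x \<in> nodes" for x
  proof -
    have "\<sigma> x \<notin> range (leaf T)"
    proof
      assume "\<sigma> x \<in> range (leaf T)"
      then obtain l where "\<sigma> x = leaf T l" by auto
      then have "x = \<sigma> (leaf T l)" using involution_idem nodesD x by metis
      then show False using involution_leaf_range x by (auto simp: nodes_def internal_verts_def)
    qed
    then show ?thesis
      using x involution_root_iff involution_vert by (auto simp: nodes_def internal_verts_def)
  qed
  show ?thesis
  proof
    show "\<sigma> ` nodes \<subseteq> nodes" using * by blast
    show "nodes \<subseteq> \<sigma> ` nodes"
    proof
      fix x assume "x \<in> nodes"
      then have "\<sigma> x \<in> nodes" "x = \<sigma> (\<sigma> x)" using * involution_idem nodesD(1) by auto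
      then show "x \<in> \<sigma> ` nodes" by blast
    qed
  qed
qed

lemma gp_involution:
  assumes "u \<in> verts T" "v \<in> verts T" "\<And>x. x \<in> nodes \<Longrightarrow> w (\<sigma> x) = w x"
  shows "gp w (\<sigma> u) (\<sigma> v) = gp w u v"
proof -
  have V: "anc u \<subseteq> verts T" "anc v \<subseteq> verts T" "nodes \<subseteq> verts T"
    using anc_verts assms nodesD by auto
  have "anc (\<sigma> u) \<inter> anc (\<sigma> v) \<inter> nodes = \<sigma> ` (anc u \<inter> anc v \<inter> nodes)"
    using inj_on_image_Int [OF involution_inj V(1,2)]
      inj_on_image_Int [OF involution_inj _ V(3), of "anc u \<inter> anc v"] V(1)
    by (simp add: involution_nodes anc_involution assms(1,2) le_infI1)
  moreover have "inj_on \<sigma> (anc u \<inter> anc v \<inter> nodes)"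
    using V by (auto intro: inj_on_subset [OF involution_inj])
  ultimately show ?thesis
    unfolding gp_def using assms(3) by (simp add: sum.reindex)
qed

section \<open>The trunk\<close>

lemma fixed_common_anc:
  assumes "x \<in> anc (uleaf i) \<inter> anc (pleaf i)"
  shows "\<sigma> x = x"
proof -
  define d where "d = divergence_vertex T z (uleaf i) (pleaf i)"
  have d: "d \<in> verts T" "anc d = anc (uleaf i) \<inter> anc (pleaf i)"
    unfolding d_def by (rule divergence; simp)+
  obtain p q where pq: "rpath (uleaf i) = rpath d @ p" "rpath (pleaf i) = rpath d @ q"
    using anc_split d by (metis IntD1 IntD2 anc_self leaf_verts)
  \<comment> \<open>The path to \<open>i'\<close> is the image of the path to \<open>i\<close>. Both
    begin with the path to \<open>d\<close>, which is therefore mapped to itself position by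
    position.\<close>
  have "rpath (pleaf i) = map \<sigma> (rpath (uleaf i))"
    using rpath_involution [of "uleaf i"] by simp
  then have "rpath d @ q = map \<sigma> (rpath d) @ map \<sigma> p" using pq by simp
  then have "map \<sigma> (rpath d) = rpath d" by simp
  moreover have "x \<in> set (rpath d)" using assms d by (simp add: anc_def)
  ultimately show ?thesis by (metis in_set_conv_nth nth_map length_map)
qed

text \<open>The definition provides a trunk for some involution \<open>\<tau>\<close>; by
  \<open>involution_unique\<close> its fixed vertices are those of \<open>\<sigma>\<close>, and a
  vertex of a path has at most two neighbours on it.\<close>

lemma fixed_three_neighbours:
  assumes "w \<in> verts T" "a \<in> verts T" "b \<in> verts T" "c \<in> verts T"
    "\<sigma> w = w" "\<sigma> a = a" "\<sigma> b = b" "\<sigma> c = c"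
    "{w, a} \<in> edges T" "{w, b} \<in> edges T" "{w, c} \<in> edges T"
  shows "a = b \<or> a = c \<or> b = c"
proof -
  obtain \<tau> u v p where \<tau>: "color_involution T \<tau>" and p: "path_in (edges T) u v p" "set p = fixed_verts T \<tau>"
    using trunk_path by auto
  have F: "fixed_verts T \<tau> = {x \<in> verts T. \<sigma> x = x}"
    using involution_unique [OF \<tau>] by (auto simp: fixed_verts_def)
  have "u \<in> verts T" using p F by (metis (no_types, lifting) hd_in_set mem_Collect_eq path_in_def)
  then show ?thesis using path_three_neighbours [OF p(1)] assms p(2) F by blast
qed

lemma gp_pos_common:
  assumes "gp w u v > 0"
  shows "\<exists>x\<in>nodes. x \<in> anc u \<inter> anc v"
proof (rule ccontr)
  assume "\<not> ?thesis"
  then have "anc u \<inter> anc v \<inter> nodes = {}" by blast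
  then show False using assms by (simp add: gp_def)
qed

lemma gp_pos:
  assumes "\<And>x. x \<in> nodes \<Longrightarrow> w x > 0" "x \<in> nodes" "x \<in> anc u \<inter> anc v"
  shows "gp w u v > 0"
  unfolding gp_def using assms by (intro sum_pos2 [of _ x]) (auto intro: less_imp_le)

text \<open>Otherwise three edges of the trunk would meet where the paths to \<open>i\<close> and \<open>j'\<close> diverge.\<close>

lemma trunk_branch:
  assumes w: "\<And>x. x \<in> nodes \<Longrightarrow> w x > 0"
    and lt: "gp w (uleaf i) (pleaf j) < gp w (uleaf i) (pleaf i)"
      "gp w (uleaf i) (pleaf j) < gp w (uleaf j) (pleaf j)"
  shows "gp w (uleaf i) (pleaf j) \<le> 0"
proof (rule ccontr)
  assume "\<not> ?thesis"
  then have "gp w (uleaf i) (pleaf j) > 0" by simp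
  then obtain x0 where x0: "x0 \<in> nodes" "x0 \<in> anc (uleaf i) \<inter> anc (pleaf j)"
    using gp_pos_common by blast
  define d where "d = divergence_vertex T z (uleaf i) (pleaf j)"
  have d: "d \<in> verts T" "anc d = anc (uleaf i) \<inter> anc (pleaf j)"
    unfolding d_def by (simp_all add: divergence)
  have dz: "d \<noteq> z" using x0 d(2) nodesD(2) anc_root by (metis singletonD)
  have dd: "d \<in> anc (uleaf i)" "d \<in> anc (pleaf j)" using d anc_self by blast+
  have mono: "A \<subseteq> B \<Longrightarrow> B \<subseteq> nodes \<Longrightarrow> sum w A \<le> sum w B" for A B
    using w finite_subset [OF _ finite_nodes] by (intro sum_mono2) (auto intro: less_imp_le)
  \<comment> \<open>Used with \<open>uleaf i\<close> and \<open>k = i\<close>, then with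
    \<open>pleaf j\<close> and \<open>k = j\<close>. The larger product of \<open>k\<close> and
    \<open>k'\<close> gives these two leaves a common ancestor past \<open>d\<close>; common
    ancestors of \<open>k\<close> and \<open>k'\<close> are fixed, and so is the child of
    \<open>d\<close> on the way there.\<close>
  have child: "\<exists>y. y \<noteq> z \<and> parent y = d \<and> \<sigma> y = y \<and> \<sigma> d = d \<and> y \<in> verts T \<and> y \<in> anc (leaf T l)"
    if l: "leaf T l = uleaf i \<or> leaf T l = pleaf j" and k: "l = Inl k \<or> l = Inr k"
      and lt: "gp w (uleaf i) (pleaf j) < gp w (uleaf k) (pleaf k)" for l k
  proof -
    have "\<not> anc (uleaf k) \<inter> anc (pleaf k) \<inter> nodes \<subseteq> anc d \<inter> nodes"
      using lt mono unfolding gp_def d(2) by (metis inf_le2 linorder_not_le)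
    then obtain x where x: "x \<in> nodes" "x \<in> anc (uleaf k) \<inter> anc (pleaf k)" "x \<notin> anc d" by auto
    then have xl: "x \<in> anc (leaf T l)" using k by auto
    moreover have dl: "d \<in> anc (leaf T l)" using l dd by auto
    ultimately have dx: "d \<in> anc x" using anc_chain [of "leaf T l"] x by auto
    have X: "x \<in> verts T" using nodesD x by blast
    have "d \<noteq> x" using x(3) d anc_self by blast
    then obtain y where y: "y \<in> anc x" "y \<noteq> z" "parent y = d"
      using anc_child [OF X dx] by blast
    have *: "anc x \<subseteq> anc (uleaf k) \<inter> anc (pleaf k)" using anc_mono x(2) leaf_verts by blast
    then have "\<sigma> y = y" "\<sigma> d = d" using fixed_common_anc y dx by blast+
    moreover have "y \<in> verts T" using y anc_verts X by blast
    moreover have "y \<in> anc (leaf T l)" using y anc_mono xl by (meson leaf_verts subsetD)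
    ultimately show ?thesis using y by blast
  qed
  obtain a where a: "a \<noteq> z" "parent a = d" "\<sigma> a = a" "\<sigma> d = d" "a \<in> verts T" "a \<in> anc (uleaf i)"
    using child [of "Inl i" i] lt by auto
  obtain b where b: "b \<noteq> z" "parent b = d" "\<sigma> b = b" "b \<in> verts T" "b \<in> anc (pleaf j)"
    using child [of "Inr j" j] lt by auto
  have nd: "a \<notin> anc d" "b \<notin> anc d" using a b anc_parent(2) by metis+
  then have "a \<noteq> b" using a b d by blast
  \<comment> \<open>The third fixed neighbour is the parent of \<open>d\<close>; it exists because
    the assumed positive product keeps \<open>d\<close> away from the root.\<close>
  moreover have "parent d \<in> anc d" using parent_in_anc d dz by blast
  then have "parent d \<noteq> a" "parent d \<noteq> b" using nd by auto
  moreover have "\<sigma> (parent d) = parent d" using parent_involution [OF d(1) dz] a by simp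
  moreover have "{d, a} \<in> edges T" "{d, b} \<in> edges T" "{d, parent d} \<in> edges T" "parent d \<in> verts T"
    using rpath_parent [of a] rpath_parent [of b] rpath_parent [of d] a b d dz
    by (simp_all add: insert_commute)
  ultimately show False using fixed_three_neighbours [of d a b "parent d"] a b d by blast
qed

text \<open>The root has no parent, so here three branches are needed. Each positive product of a
  leaf with its partner gives a fixed child of the root, and a child shared by two of the pairs
  would make a mixed product positive.\<close>

lemma trunk_root:
  assumes w: "\<And>x. x \<in> nodes \<Longrightarrow> w x > 0"
    and p: "gp w (uleaf i) (pleaf i) > 0" "gp w (uleaf j) (pleaf j) > 0" "gp w (uleaf k) (pleaf k) > 0"
    and 0: "gp w (uleaf i) (pleaf j) = 0" "gp w (uleaf i) (pleaf k) = 0" "gp w (uleaf j) (pleaf k) = 0"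
  shows False
proof -
  have child: "\<exists>y\<in>nodes. parent y = z \<and> y \<in> anc (uleaf i) \<inter> anc (pleaf i)"
    if p: "gp w (uleaf i) (pleaf i) > 0" for i
  proof -
    obtain x where x: "x \<in> nodes" "x \<in> anc (uleaf i) \<inter> anc (pleaf i)"
      using gp_pos_common p by blast
    then have X: "x \<in> verts T" "x \<noteq> z" using nodesD by auto
    then obtain y where y: "y \<in> anc x" "y \<noteq> z" "parent y = z"
      using anc_child [of x z] by auto
    have "y \<in> internal_verts T"
      using anc_internal [OF X(1) y(1)] nodesD x by (cases "y = x") auto
    moreover have "anc x \<subseteq> anc (uleaf i) \<inter> anc (pleaf i)" using anc_mono x(2) leaf_verts by blast
    ultimately show ?thesis using y by (auto simp: nodes_def)
  qed
  obtain a where a: "a \<in> nodes" "parent a = z" "a \<in> anc (uleaf i) \<inter> anc (pleaf i)"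
    using child p by blast
  obtain b where b: "b \<in> nodes" "parent b = z" "b \<in> anc (uleaf j) \<inter> anc (pleaf j)"
    using child p by blast
  obtain c where c: "c \<in> nodes" "parent c = z" "c \<in> anc (uleaf k) \<inter> anc (pleaf k)"
    using child p by blast
  have "a \<noteq> b" "a \<noteq> c" "b \<noteq> c"
    using gp_pos [of w a "uleaf i" "pleaf j", OF w a(1)] gp_pos [of w a "uleaf i" "pleaf k", OF w a(1)]
      gp_pos [of w b "uleaf j" "pleaf k", OF w b(1)] a(3) b(3) c(3) 0 by auto
  moreover have "{z, a} \<in> edges T" "{z, b} \<in> edges T" "{z, c} \<in> edges T"
    using rpath_parent(3) nodesD a b c by metis+
  moreover have "\<sigma> a = a" "\<sigma> b = b" "\<sigma> c = c"
    using fixed_common_anc a b c by blast+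
  moreover have "a \<in> verts T" "b \<in> verts T" "c \<in> verts T" using nodesD a b c by auto
  ultimately show False using fixed_three_neighbours [of z a b c] root fixed_root by blast
qed

end

section \<open>Symmetric tropical rank\<close>

text \<open>
  The hypotheses say that the minimum in each of the nine 2x2 minors is attained twice. They imply
  that the diagonal is not the only optimal permutation.
\<close>

lemma tropical_det_3:
  fixes a11 a12 a13 a21 a22 a23 a31 a32 a33 :: real
  assumes
   "a11 \<ge> a12 \<or> a11 \<ge> a22 \<or> a11 \<ge> a21" "a12 \<ge> a11 \<or> a12 \<ge> a21 \<or> a12 \<ge> a22"
   "a21 \<ge> a11 \<or> a21 \<ge> a12 \<or> a21 \<ge> a22" "a22 \<ge> a11 \<or> a22 \<ge> a12 \<or> a22 \<ge> a21"
   "a11 \<ge> a13 \<or> a11 \<ge> a23 \<or> a11 \<ge> a21" "a13 \<ge> a11 \<or> a13 \<ge> a21 \<or> a13 \<ge> a23"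
   "a21 \<ge> a11 \<or> a21 \<ge> a13 \<or> a21 \<ge> a23" "a23 \<ge> a11 \<or> a23 \<ge> a13 \<or> a23 \<ge> a21"
   "a12 \<ge> a13 \<or> a12 \<ge> a23 \<or> a12 \<ge> a22" "a13 \<ge> a12 \<or> a13 \<ge> a22 \<or> a13 \<ge> a23"
   "a22 \<ge> a12 \<or> a22 \<ge> a13 \<or> a22 \<ge> a23" "a23 \<ge> a12 \<or> a23 \<ge> a13 \<or> a23 \<ge> a22"
   "a11 \<ge> a12 \<or> a11 \<ge> a32 \<or> a11 \<ge> a31" "a12 \<ge> a11 \<or> a12 \<ge> a31 \<or> a12 \<ge> a32"
   "a31 \<ge> a11 \<or> a31 \<ge> a12 \<or> a31 \<ge> a32" "a32 \<ge> a11 \<or> a32 \<ge> a12 \<or> a32 \<ge> a31"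
   "a11 \<ge> a13 \<or> a11 \<ge> a33 \<or> a11 \<ge> a31" "a13 \<ge> a11 \<or> a13 \<ge> a31 \<or> a13 \<ge> a33"
   "a31 \<ge> a11 \<or> a31 \<ge> a13 \<or> a31 \<ge> a33" "a33 \<ge> a11 \<or> a33 \<ge> a13 \<or> a33 \<ge> a31"
   "a12 \<ge> a13 \<or> a12 \<ge> a33 \<or> a12 \<ge> a32" "a13 \<ge> a12 \<or> a13 \<ge> a32 \<or> a13 \<ge> a33"
   "a32 \<ge> a12 \<or> a32 \<ge> a13 \<or> a32 \<ge> a33" "a33 \<ge> a12 \<or> a33 \<ge> a13 \<or> a33 \<ge> a32"
   "a21 \<ge> a22 \<or> a21 \<ge> a32 \<or> a21 \<ge> a31" "a22 \<ge> a21 \<or> a22 \<ge> a31 \<or> a22 \<ge> a32"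
   "a31 \<ge> a21 \<or> a31 \<ge> a22 \<or> a31 \<ge> a32" "a32 \<ge> a21 \<or> a32 \<ge> a22 \<or> a32 \<ge> a31"
   "a21 \<ge> a23 \<or> a21 \<ge> a33 \<or> a21 \<ge> a31" "a23 \<ge> a21 \<or> a23 \<ge> a31 \<or> a23 \<ge> a33"
   "a31 \<ge> a21 \<or> a31 \<ge> a23 \<or> a31 \<ge> a33" "a33 \<ge> a21 \<or> a33 \<ge> a23 \<or> a33 \<ge> a31"
   "a22 \<ge> a23 \<or> a22 \<ge> a33 \<or> a22 \<ge> a32" "a23 \<ge> a22 \<or> a23 \<ge> a32 \<or> a23 \<ge> a33"
   "a32 \<ge> a22 \<or> a32 \<ge> a23 \<or> a32 \<ge> a33" "a33 \<ge> a22 \<or> a33 \<ge> a23 \<or> a33 \<ge> a32"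
  shows "a11 + a22 + a33 \<ge> a12 + a21 + a33 \<or> a11 + a22 + a33 \<ge> a13 + a22 + a31 \<or>
    a11 + a22 + a33 \<ge> a11 + a23 + a32 \<or> a11 + a22 + a33 \<ge> a12 + a23 + a31 \<or>
    a11 + a22 + a33 \<ge> a13 + a21 + a32"
  using assms by (smt (z3))

text \<open>
  In a principal minor the two 3-cycles give the same monomial, so an optimal 3-cycle needs a
  competitor other than its inverse; here the trunk being a path enters.
\<close>

lemma tropical_det_symmetric_3:
  fixes a b c p q s :: real
  assumes "a \<ge> 0" "b \<ge> 0" "c \<ge> 0" "p \<ge> 0" "q \<ge> 0" "s \<ge> 0"
   "a \<ge> p \<or> a \<ge> b" "b \<ge> p \<or> b \<ge> a"
   "a \<ge> q \<or> a \<ge> c" "c \<ge> q \<or> c \<ge> a"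
   "b \<ge> s \<or> b \<ge> c" "c \<ge> s \<or> c \<ge> b"
   "p \<ge> q \<or> p \<ge> s \<or> p \<ge> c" "q \<ge> p \<or> q \<ge> s \<or> q \<ge> b" "s \<ge> p \<or> s \<ge> q \<or> s \<ge> a"
   "a \<ge> p \<or> a \<ge> q \<or> a \<ge> s" "b \<ge> p \<or> b \<ge> q \<or> b \<ge> s" "c \<ge> p \<or> c \<ge> q \<or> c \<ge> s"
   "p \<ge> q \<or> p \<ge> s \<or> p \<ge> a" "p \<ge> q \<or> p \<ge> s \<or> p \<ge> b"
   "q \<ge> p \<or> q \<ge> s \<or> q \<ge> a" "q \<ge> p \<or> q \<ge> s \<or> q \<ge> c"
   "s \<ge> p \<or> s \<ge> q \<or> s \<ge> b" "s \<ge> p \<or> s \<ge> q \<or> s \<ge> c"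
   "p < a \<Longrightarrow> p < b \<Longrightarrow> p \<le> 0" "q < a \<Longrightarrow> q < c \<Longrightarrow> q \<le> 0" "s < b \<Longrightarrow> s < c \<Longrightarrow> s \<le> 0"
   "\<not> (a > 0 \<and> b > 0 \<and> c > 0 \<and> p = 0 \<and> q = 0 \<and> s = 0)"
  shows "a + b + c \<le> p + q + s \<or> a + 2 * s \<le> p + q + s \<or> b + 2 * q \<le> p + q + s \<or> c + 2 * p \<le> p + q + s"
  using assms by (smt (z3))

section \<open>Monomials of a 3x3 minor of the generic symmetric matrix\<close>

definition sym_mon :: "'n::linorder \<Rightarrow> 'n \<Rightarrow> 'n sym_monom" where
  "sym_mon i j = Poly_Mapping.single (min i j, max i j) 1"

lemma sym_mon_eq_iff: "sym_mon i j = sym_mon k l \<longleftrightarrow> i = k \<and> j = l \<or> i = l \<and> j = k"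
proof -
  have "sym_mon i j = sym_mon k l \<longleftrightarrow> (min i j, max i j) = (min k l, max k l)"
    unfolding sym_mon_def by (metis lookup_single_eq lookup_single_not_eq zero_neq_one)
  then show ?thesis by (auto simp: min_def max_def split: if_splits)
qed

lemma lookup_sym_mon: "Poly_Mapping.lookup (sym_mon k l) (min i j, max i j) = (if sym_mon i j = sym_mon k l then 1 else 0)"
proof (cases "(min i j, max i j) = (min k l, max k l)")
  case True
  then show ?thesis by (simp add: sym_mon_def)
next
  case False
  then have "sym_mon i j \<noteq> sym_mon k l"
    unfolding sym_mon_def by (metis lookup_single_eq lookup_single_not_eq zero_neq_one)
  then show ?thesis using False by (auto simp add: sym_mon_def lookup_single when_def)
qed

text \<open>Compare the exponents of the variable of \<open>sym_mon i j\<close>: it is positive on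
  the left, so some factor on the right must supply it.\<close>

lemma sym_mon_sum3_eq:
  assumes "sym_mon i j + u + v = sym_mon a b + sym_mon c d + sym_mon e f"
  shows "sym_mon i j = sym_mon a b \<or> sym_mon i j = sym_mon c d \<or> sym_mon i j = sym_mon e f"
proof (rule ccontr)
  assume "\<not> ?thesis"
  then have "Poly_Mapping.lookup (sym_mon a b + sym_mon c d + sym_mon e f) (min i j, max i j) = 0"
    by (simp add: lookup_add lookup_sym_mon)
  moreover have "Poly_Mapping.lookup (sym_mon i j + u + v) (min i j, max i j) > 0"
    by (simp add: lookup_add lookup_sym_mon)
  ultimately show False using assms by simp
qed

text \<open>The determinant term that pairs the rows \<open>r s t\<close> with the columns
  \<open>x y z\<close>, without its sign.\<close>

definition mon3 :: "'n::linorder \<Rightarrow> 'n \<Rightarrow> 'n \<Rightarrow> 'n \<Rightarrow> 'n \<Rightarrow> 'n \<Rightarrow> 'n sym_monom" where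
  "mon3 r s t x y z = sym_mon r x + sym_mon s y + sym_mon t z"

lemma mon3_eqD:
  assumes "mon3 r s t x y z = mon3 r s t x' y' z'"
  shows "sym_mon r x = sym_mon r x' \<or> sym_mon r x = sym_mon s y' \<or> sym_mon r x = sym_mon t z'"
    and "sym_mon s y = sym_mon r x' \<or> sym_mon s y = sym_mon s y' \<or> sym_mon s y = sym_mon t z'"
    and "sym_mon t z = sym_mon r x' \<or> sym_mon t z = sym_mon s y' \<or> sym_mon t z = sym_mon t z'"
  using assms sym_mon_sum3_eq [of r x "sym_mon s y" "sym_mon t z" r x' s y' t z']
    sym_mon_sum3_eq [of s y "sym_mon r x" "sym_mon t z" r x' s y' t z']
    sym_mon_sum3_eq [of t z "sym_mon r x" "sym_mon s y" r x' s y' t z']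
  by (simp_all add: mon3_def ac_simps)

text \<open>Permutations that differ by a transposition share a factor. After cancelling it, one
  factor of a 2x2 diagonal would have to be an off-diagonal one, which identifies two rows or two
  columns. Consequently even and odd terms of a minor never cancel.\<close>

lemma mon3_transpose_neq:
  assumes "distinct [r, s, t]" "distinct [x, y, z]"
  shows "mon3 r s t x y z \<noteq> mon3 r s t y x z" "mon3 r s t x y z \<noteq> mon3 r s t z y x"
    "mon3 r s t x y z \<noteq> mon3 r s t x z y"
proof -
  have eq2: "sym_mon i j = sym_mon a b \<or> sym_mon i j = sym_mon c d"
    if "sym_mon i j + sym_mon k l = sym_mon a b + sym_mon c d" for i j k l a b c d :: 'a
  proof (rule ccontr)
    assume "\<not> ?thesis"
    then have "Poly_Mapping.lookup (sym_mon a b + sym_mon c d) (min i j, max i j) = 0"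
      by (simp add: lookup_add lookup_sym_mon)
    moreover have "Poly_Mapping.lookup (sym_mon i j + sym_mon k l) (min i j, max i j) > 0"
      by (simp add: lookup_add lookup_sym_mon)
    ultimately show False using that by simp
  qed
  show "mon3 r s t x y z \<noteq> mon3 r s t y x z"
  proof
    assume "mon3 r s t x y z = mon3 r s t y x z"
    then have "sym_mon r x + sym_mon s y = sym_mon r y + sym_mon s x" by (simp add: mon3_def)
    from eq2 [OF this] show False using assms by (auto simp: sym_mon_eq_iff)
  qed
  show "mon3 r s t x y z \<noteq> mon3 r s t z y x"
  proof
    assume "mon3 r s t x y z = mon3 r s t z y x"
    then have "sym_mon s y + (sym_mon r x + sym_mon t z) = sym_mon s y + (sym_mon r z + sym_mon t x)"
      by (simp only: mon3_def ac_simps)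
    then have "sym_mon r x + sym_mon t z = sym_mon r z + sym_mon t x"
      by (simp only: add_left_cancel)
    from eq2 [OF this] show False using assms by (auto simp: sym_mon_eq_iff)
  qed
  show "mon3 r s t x y z \<noteq> mon3 r s t x z y"
  proof
    assume "mon3 r s t x y z = mon3 r s t x z y"
    then have "sym_mon s y + sym_mon t z = sym_mon s z + sym_mon t y"
      by (simp add: mon3_def add.assoc)
    from eq2 [OF this] show False using assms by (auto simp: sym_mon_eq_iff)
  qed
qed

text \<open>Permutations of equal sign can share their monomial only if rows and columns are the
  same three indices and the permutations are the two 3-cycles.\<close>

lemma mon3_rotate_eq:
  assumes "distinct [r, s, t]" "distinct [x, y, z]"
  shows "mon3 r s t x y z = mon3 r s t y z x \<Longrightarrow> r = z \<and> s = x \<and> t = y"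
    and "mon3 r s t x y z = mon3 r s t z x y \<Longrightarrow> r = y \<and> s = z \<and> t = x"
proof -
  assume "mon3 r s t x y z = mon3 r s t y z x"
  from mon3_eqD [OF this] show "r = z \<and> s = x \<and> t = y"
    using assms unfolding sym_mon_eq_iff by auto
next
  assume "mon3 r s t x y z = mon3 r s t z x y"
  from mon3_eqD [OF this] show "r = y \<and> s = z \<and> t = x"
    using assms unfolding sym_mon_eq_iff by auto
qed

text \<open>Monomials of equal sign may coincide; their coefficients then add up to 2 or 3 in
  absolute value, which is nonzero over the rationals.\<close>

lemma keys_alternating:
  fixes m1 m2 m3 n1 n2 n3 :: "'b"
  assumes "{m1, m2, m3} \<inter> {n1, n2, n3} = {}"
  shows "Poly_Mapping.keys (Poly_Mapping.single m1 (1::rat) + Poly_Mapping.single m2 1 + Poly_Mapping.single m3 1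
     - Poly_Mapping.single n1 1 - Poly_Mapping.single n2 1 - Poly_Mapping.single n3 1) = {m1, m2, m3, n1, n2, n3}"
  using assms by (auto simp: in_keys_iff lookup_add lookup_minus lookup_single when_def split: if_splits)

lemma keys_sym_minor:
  assumes "inj r" "inj c"
  shows "Poly_Mapping.keys (sym_minor r c) =
    {mon3 (r 1) (r 2) (r 3) (c 1) (c 2) (c 3), mon3 (r 1) (r 2) (r 3) (c 2) (c 3) (c 1),
     mon3 (r 1) (r 2) (r 3) (c 3) (c 1) (c 2), mon3 (r 1) (r 2) (r 3) (c 1) (c 3) (c 2),
     mon3 (r 1) (r 2) (r 3) (c 2) (c 1) (c 3), mon3 (r 1) (r 2) (r 3) (c 3) (c 2) (c 1)}"
proof -
  have d: "distinct [r 1, r 2, r 3]" "distinct [c 1, c 2, c 3]"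
    using assms by (auto dest: injD)
  then have d': "distinct [c 2, c 3, c 1]" "distinct [c 3, c 1, c 2]" by auto
  let ?s = "\<lambda>m. Poly_Mapping.single m (1::rat)" and ?m = "mon3 (r 1) (r 2) (r 3)"
  have "sym_minor r c = ?s (?m (c 1) (c 2) (c 3)) + ?s (?m (c 2) (c 3) (c 1)) + ?s (?m (c 3) (c 1) (c 2))
     - ?s (?m (c 1) (c 3) (c 2)) - ?s (?m (c 2) (c 1) (c 3)) - ?s (?m (c 3) (c 2) (c 1))"
    by (simp add: sym_minor_def det_3 sym_var_def mon3_def sym_mon_def mult_single)
  then show ?thesis
    using keys_alternating [of "?m (c 1) (c 2) (c 3)" "?m (c 2) (c 3) (c 1)" "?m (c 3) (c 1) (c 2)"
       "?m (c 1) (c 3) (c 2)" "?m (c 2) (c 1) (c 3)" "?m (c 3) (c 2) (c 1)"]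
       mon3_transpose_neq [OF d] mon3_transpose_neq [OF d(1) d'(1)] mon3_transpose_neq [OF d(1) d'(2)]
    by auto
qed

lemma monom_weight_UNIV: "monom_weight A m = (\<Sum>p\<in>UNIV. real (Poly_Mapping.lookup m p) * A $ fst p $ snd p)"
  unfolding monom_weight_def by (rule sum.mono_neutral_left) (auto simp: in_keys_iff)

lemma monom_weight_add: "monom_weight A (m + m') = monom_weight A m + monom_weight A m'"
  by (simp add: monom_weight_UNIV lookup_add algebra_simps sum.distrib)

lemma monom_weight_sym_mon:
  assumes "transpose A = A"
  shows "monom_weight A (sym_mon i j) = A $ i $ j"
proof -
  have "A $ j $ i = A $ i $ j" using assms by (metis transpose_def vec_lambda_beta)
  then show ?thesis
    by (auto simp: monom_weight_def sym_mon_def min_def max_def)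
qed

text \<open>The summands \<open>x $ i + x $ j\<close> shift all terms of a minor by one constant, so
  only \<open>M\<close> matters. \<open>Q\<close> will be the ultrametric inequality between the
  colours; \<open>T1\<close> and \<open>T2\<close> are \<open>trunk_branch\<close> and
  \<open>trunk_root\<close>.\<close>

lemma sym_trop_rank_2I:
  fixes A :: "real^('n::{finite,linorder})^('n::{finite,linorder})" and M :: "'n \<Rightarrow> 'n \<Rightarrow> real"
  assumes A: "\<And>i j. A $ i $ j = M i j + x $ i + x $ j"
    and sym: "\<And>i j. M i j = M j i" and nonneg: "\<And>i j. M i j \<ge> 0"
    and Q: "\<And>k l p q. M k p \<ge> M k q \<or> M k p \<ge> M l q \<or> M k p \<ge> M l p"
    and T1: "\<And>i j. M i j < M i i \<Longrightarrow> M i j < M j j \<Longrightarrow> M i j \<le> 0"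
    and T2: "\<And>i j k. \<not> (M i i > 0 \<and> M j j > 0 \<and> M k k > 0 \<and> M i j = 0 \<and> M i k = 0 \<and> M j k = 0)"
  shows "sym_trop_rank_2 A"
proof -
  have AT: "transpose A = A" using A sym by (simp add: vec_eq_iff transpose_def)
  show ?thesis unfolding sym_trop_rank_2_def
  proof (intro allI impI)
    fix r c :: "3 \<Rightarrow> 'n" assume "inj r \<and> inj c"
    then have rc: "inj r" "inj c" by auto
    define R where "R = mon3 (r 1) (r 2) (r 3)"
    define w where "w a b d = M (r 1) a + M (r 2) b + M (r 3) d" for a b d
    define S where "S = {(c 1, c 2, c 3), (c 2, c 3, c 1), (c 3, c 1, c 2), (c 1, c 3, c 2), (c 2, c 1, c 3), (c 3, c 2, c 1)}"
    define K where "K = x $ r 1 + x $ r 2 + x $ r 3 + x $ c 1 + x $ c 2 + x $ c 3"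
    have keys: "Poly_Mapping.keys (sym_minor r c) = (\<lambda>(a, b, d). R a b d) ` S"
      unfolding keys_sym_minor [OF rc] R_def S_def by simp
    have dr: "distinct [r 1, r 2, r 3]" and dc: "distinct [c 1, c 2, c 3]"
      using rc by (auto dest: injD)
    have weight: "monom_weight A (R a b d) = w a b d + K" if "(a, b, d) \<in> S" for a b d
      using that unfolding R_def w_def K_def S_def
      by (auto simp: mon3_def monom_weight_add monom_weight_sym_mon [OF AT] A)
    have S_perm: "(b, a, d) \<in> S" "(d, b, a) \<in> S" "(a, d, b) \<in> S" "(b, d, a) \<in> S" "(d, a, b) \<in> S" "distinct [a, b, d]"
      if "(a, b, d) \<in> S" for a b d
      using that dc unfolding S_def by auto
    define f where "f = (\<lambda>(a, b, d). w a b d)"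
    have "finite S" "S \<noteq> {}" by (auto simp: S_def)
    then have "Min (f ` S) \<in> f ` S" by (intro Min_in) auto
    then obtain m where m: "m \<in> S" "f m = Min (f ` S)" by auto
    then have min: "f m \<le> f m'" if "m' \<in> S" for m' using that \<open>finite S\<close> by simp
    obtain a b d where abd: "m = (a, b, d)" by (cases m) auto
    note P = S_perm [OF m(1) [unfolded abd]]
    have ex: "\<exists>a' b' d'. (a', b', d') \<in> S \<and> R a' b' d' \<noteq> R a b d \<and> w a' b' d' \<le> w a b d"
    proof -
      \<comment> \<open>With the columns listed in the order of an optimal permutation, the optimal
        term is the diagonal one of \<open>tropical_det_3\<close>.\<close>
      have "w a b d \<ge> w b a d \<or> w a b d \<ge> w d b a \<or> w a b d \<ge> w a d b \<or> w a b d \<ge> w b d a \<or> w a b d \<ge> w d a b"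
        unfolding w_def by (rule tropical_det_3; use Q in blast)
      then consider "R b a d \<noteq> R a b d \<and> w b a d \<le> w a b d" | "R d b a \<noteq> R a b d \<and> w d b a \<le> w a b d"
        | "R a d b \<noteq> R a b d \<and> w a d b \<le> w a b d" | "R b d a \<noteq> R a b d \<and> w b d a \<le> w a b d"
        | "R d a b \<noteq> R a b d \<and> w d a b \<le> w a b d" | "R b d a = R a b d" | "R d a b = R a b d"
        using mon3_transpose_neq [OF dr P(6)] unfolding R_def by metis
      then have "(\<exists>a' b' d'. (a', b', d') \<in> S \<and> R a' b' d' \<noteq> R a b d \<and> w a' b' d' \<le> w a b d) \<or>
         R b d a = R a b d \<or> R d a b = R a b d"
        using P by cases metis+
      moreover have ?thesis if "R b d a = R a b d \<or> R d a b = R a b d"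
      proof -
        \<comment> \<open>A competitor with the same monomial means that the minor is principal and
          that the optimal permutation is one of its 3-cycles; the two alternatives are the two
          cycles.\<close>
        have cases: "r 1 = d \<and> r 2 = a \<and> r 3 = b \<or> r 1 = b \<and> r 2 = d \<and> r 3 = a"
          using that mon3_rotate_eq [OF dr P(6)] unfolding R_def by metis
        \<comment> \<open>The left-hand sides are the weights of the identity and of the three
          transpositions, so any of them competes with the 3-cycle through a different
          monomial.\<close>
        have core: "M a a + M b b + M d d \<le> M a b + M a d + M b d \<or> M a a + 2 * M b d \<le> M a b + M a d + M b d
            \<or> M b b + 2 * M a d \<le> M a b + M a d + M b d \<or> M d d + 2 * M a b \<le> M a b + M a d + M b d"
        proof (rule tropical_det_symmetric_3)
          show "M a b < M a a \<Longrightarrow> M a b < M b b \<Longrightarrow> M a b \<le> 0" "M a d < M a a \<Longrightarrow> M a d < M d d \<Longrightarrow> M a d \<le> 0"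
            "M b d < M b b \<Longrightarrow> M b d < M d d \<Longrightarrow> M b d \<le> 0" by (rule T1; assumption)+
        qed (use nonneg T2 [of a b d] Q sym in metis)+
        have neq: "R d a b \<noteq> R a b d" if "r 1 = d \<and> r 2 = a \<and> r 3 = b"
          using mon3_rotate_eq(2) [OF dr P(6)] that P(6) unfolding R_def by auto
        have neq': "R b d a \<noteq> R a b d" if "r 1 = b \<and> r 2 = d \<and> r 3 = a"
          using mon3_rotate_eq(1) [OF dr P(6)] that P(6) unfolding R_def by auto
        note tr = mon3_transpose_neq [OF dr P(6), folded R_def]
        from cases show ?thesis
        proof
          assume r: "r 1 = d \<and> r 2 = a \<and> r 3 = b"
          have ws: "w a b d = M a b + M a d + M b d" "w d a b = M a a + M b b + M d d"
            "w d b a = M d d + 2 * M a b" "w b a d = M a a + 2 * M b d" "w a d b = M b b + 2 * M a d"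
            using r sym by (simp_all add: w_def)
          from core show ?thesis
            using ws neq [OF r] tr P by (smt (verit))
        next
          assume r: "r 1 = b \<and> r 2 = d \<and> r 3 = a"
          have ws: "w a b d = M a b + M a d + M b d" "w b d a = M a a + M b b + M d d"
            "w d b a = M a a + 2 * M b d" "w b a d = M b b + 2 * M a d" "w a d b = M d d + 2 * M a b"
            using r sym by (simp_all add: w_def)
          from core show ?thesis
            using ws neq' [OF r] tr P by (smt (verit))
        qed
      qed
      ultimately show ?thesis by blast
    qed
    then obtain a' b' d' where a': "(a', b', d') \<in> S" "R a' b' d' \<noteq> R a b d" "w a' b' d' \<le> w a b d" by blast
    show "\<exists>m1\<in>Poly_Mapping.keys (sym_minor r c). \<exists>m2\<in>Poly_Mapping.keys (sym_minor r c). m1 \<noteq> m2 \<and>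
         (\<forall>m\<in>Poly_Mapping.keys (sym_minor r c).
            monom_weight A m1 \<le> monom_weight A m \<and> monom_weight A m2 \<le> monom_weight A m)"
    proof (intro bexI conjI ballI)
      show "R a b d \<noteq> R a' b' d'" using a' by simp
      show "R a b d \<in> Poly_Mapping.keys (sym_minor r c)" "R a' b' d' \<in> Poly_Mapping.keys (sym_minor r c)"
        unfolding keys using m(1) a'(1) abd by (force intro: rev_image_eqI)+
      fix k assume "k \<in> Poly_Mapping.keys (sym_minor r c)"
      then obtain u v t where k: "(u, v, t) \<in> S" "k = R u v t" unfolding keys by auto
      have "w a b d \<le> w u v t" using min [OF k(1)] by (simp add: f_def abd)
      then show "monom_weight A (R a b d) \<le> monom_weight A k" "monom_weight A (R a' b' d') \<le> monom_weight A k"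
        using a' k weight m(1) abd by auto
    qed
  qed
qed

section \<open>Trees embedded in the tropical torus\<close>

lemma tequiv_iff: "x \<sim>\<^sub>1 y \<longleftrightarrow> (\<exists>c. \<forall>i. x $ i = y $ i + c)"
  by (simp add: tequiv_def vec_eq_iff)

lemma tequiv_refl [simp]: "x \<sim>\<^sub>1 x"
  unfolding tequiv_iff by (rule exI [of _ 0]) simp

lemma tequiv_sym: "x \<sim>\<^sub>1 y \<Longrightarrow> y \<sim>\<^sub>1 x"
  unfolding tequiv_iff by (metis add.commute diff_add_cancel diff_conv_add_uminus)

lemma tequiv_trans [trans]: "x \<sim>\<^sub>1 y \<Longrightarrow> y \<sim>\<^sub>1 w \<Longrightarrow> x \<sim>\<^sub>1 w"
  unfolding tequiv_iff by (metis add.assoc)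

lemma tequiv_add: "x \<sim>\<^sub>1 y \<Longrightarrow> u \<sim>\<^sub>1 v \<Longrightarrow> x + u \<sim>\<^sub>1 y + v"
  unfolding tequiv_def by (metis (no_types, lifting) add.assoc add.left_commute vec_add)

lemma tequiv_scaleR: "x \<sim>\<^sub>1 y \<Longrightarrow> t *\<^sub>R x \<sim>\<^sub>1 t *\<^sub>R y"
  unfolding tequiv_iff by (auto simp: algebra_simps)

lemma tequiv_coords: "x \<sim>\<^sub>1 y \<Longrightarrow> x $ i - x $ j = y $ i - y $ j"
  unfolding tequiv_iff by auto

lemma tequivI: "(\<And>i j. x $ i - x $ j = y $ i - y $ j) \<Longrightarrow> x \<sim>\<^sub>1 y"
  unfolding tequiv_iff by (rule exI [of _ "x $ undefined - y $ undefined"]) (smt (verit))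

lemma tequiv_coords_iff: "x \<sim>\<^sub>1 y \<longleftrightarrow> (\<forall>i j. x $ i - x $ j = y $ i - y $ j)"
  using tequivI tequiv_coords by blast

lemma saturate_iff: "x \<in> saturate S \<longleftrightarrow> (\<exists>y\<in>S. x \<sim>\<^sub>1 y)"
  by (simp add: saturate_def)

text \<open>The saturation is the Minkowski sum of a compact set and the line spanned by
  (1,...,1).\<close>

lemma closed_saturate:
  fixes S :: "(real^'n::finite) set"
  assumes "compact S" shows "closed (saturate S)"
proof -
  have "closed (span {vec 1 :: real^'n})" by simp
  then have "closed (\<Union>x\<in>S. \<Union>y\<in>span {vec 1}. {x + y})"
    using compact_closed_sums assms by blast
  moreover have "saturate S = (\<Union>x\<in>S. \<Union>y\<in>span {vec 1}. {x + y})"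
    by (auto simp: saturate_def tequiv_def span_singleton vec_eq_iff) blast+
  ultimately show ?thesis by simp
qed

lemma edge_segment_iff:
  "x \<in> edge_segment \<phi> {a, b} \<longleftrightarrow> (\<exists>s. 0 \<le> s \<and> s \<le> 1 \<and> x \<sim>\<^sub>1 \<phi> a + s *\<^sub>R (\<phi> b - \<phi> a))"
proof -
  have "convex hull (\<phi> ` {a, b}) = closed_segment (\<phi> a) (\<phi> b)"
    by (simp add: segment_convex_hull)
  moreover have "(1 - s) *\<^sub>R \<phi> a + s *\<^sub>R \<phi> b = \<phi> a + s *\<^sub>R (\<phi> b - \<phi> a)" for s
    by (simp add: algebra_simps)
  ultimately show ?thesis
    unfolding edge_segment_def saturate_iff closed_segment_def by auto
qed

lemma closed_edge_segment:
  assumes "finite e"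
  shows "closed (edge_segment \<phi> e)"
  unfolding edge_segment_def
  by (rule closed_saturate) (use assms in \<open>simp add: finite_imp_compact_convex_hull\<close>)

text \<open>Among the points at parameters \<epsilon>/(n+1), infinitely many fall into one of the
  finitely many sets by pigeonhole; since they converge to \<open>x\<close> and the set is closed,
  it contains \<open>x\<close> too.\<close>

lemma ray_in_finite_union:
  fixes x u :: "'a::real_normed_vector"
  assumes "finite F" "\<And>C. C \<in> F \<Longrightarrow> closed C" "\<epsilon> > 0"
    and "\<And>t. 0 \<le> t \<Longrightarrow> t \<le> \<epsilon> \<Longrightarrow> x + t *\<^sub>R u \<in> \<Union>F"
  shows "\<exists>C\<in>F. x \<in> C \<and> (\<exists>t>0. t \<le> \<epsilon> \<and> x + t *\<^sub>R u \<in> C)"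
proof -
  define s where "s n = \<epsilon> * inverse (real (Suc n))" for n
  have s: "0 < s n" "s n \<le> \<epsilon>" for n
    using \<open>\<epsilon> > 0\<close> by (auto simp: s_def field_simps)
  have "\<forall>n. \<exists>C. C \<in> F \<and> x + s n *\<^sub>R u \<in> C"
    using assms(4) s by (metis UnionE less_imp_le)
  then obtain f where f: "\<And>n. f n \<in> F \<and> x + s n *\<^sub>R u \<in> f n" by metis
  then have "finite (range f)" by (intro finite_subset [OF _ assms(1)]) auto
  then obtain n0 where "infinite {n. f n = f n0}"
    using pigeonhole_infinite [of UNIV f] by auto
  then obtain r :: "nat \<Rightarrow> nat" where r: "strict_mono r" "\<And>n. f (r n) = f n0"
    using infinite_enumerate by blast
  have "s \<longlonglongrightarrow> 0"
    unfolding s_def by (intro tendsto_mult_right_zero LIMSEQ_inverse_real_of_nat)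
  then have "(\<lambda>n. x + s (r n) *\<^sub>R u) \<longlonglongrightarrow> x + 0 *\<^sub>R u"
    using LIMSEQ_subseq_LIMSEQ [OF _ r(1), of s] by (intro tendsto_intros) (auto simp: o_def)
  moreover have "x + s (r n) *\<^sub>R u \<in> f n0" for n using f r by metis
  ultimately have "x \<in> f n0"
    using closed_sequentially [of "f n0" "\<lambda>n. x + s (r n) *\<^sub>R u" x] assms(2) f by auto
  then show ?thesis using f s by blast
qed

section \<open>0/1 vectors as primitive lattice directions\<close>

definition chi :: "'n set \<Rightarrow> real^'n" where "chi S = (\<chi> i. if i \<in> S then 1 else 0)"
definition ichi :: "'n set \<Rightarrow> int^'n" where "ichi S = (\<chi> i. if i \<in> S then 1 else 0)"

lemma chi_nth [simp]: "chi S $ i = (if i \<in> S then 1 else 0)" by (simp add: chi_def)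
lemma ichi_nth [simp]: "ichi S $ i = (if i \<in> S then 1 else 0)" by (simp add: ichi_def)

lemma of_int_ichi: "(\<chi> i. of_int (ichi S $ i)) = chi S"
  by (simp add: vec_eq_iff)

lemma ichi_inject: "ichi S = ichi S' \<longleftrightarrow> S = S'"
  by (auto simp: vec_eq_iff split: if_splits)

lemma ichi_primitive:
  assumes "S \<noteq> {}" "S \<noteq> UNIV"
  shows "Min (range (($) (ichi S))) = 0" "Gcd (range (($) (ichi S))) = 1"
proof -
  have r: "range (($) (ichi S)) = {0, 1}" using assms by (auto simp: image_iff)
  then show "Min (range (($) (ichi S))) = 0" "Gcd (range (($) (ichi S))) = 1" by simp_all
qed

text \<open>Modulo constants \<open>u\<close> is a positive multiple of an indicator vector. Minimum
  0 forces the value 0 off \<open>S\<close>, and gcd 1 then forces the value 1 on \<open>S\<close>.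
  A constant \<open>u\<close> would be zero, with gcd 0.\<close>

lemma direction_of_chi:
  fixes u :: "int^'n::finite"
  assumes u: "Min (range (($) u)) = 0" "Gcd (range (($) u)) = 1"
    and k: "\<And>i j. real_of_int (u $ i) - of_int (u $ j) = k * (chi S $ i - chi S $ j)" "k > 0"
  shows "u = ichi S"
proof -
  have ge: "u $ i \<ge> 0" for i
    unfolding u(1) [symmetric] by (intro Min_le) auto
  have "Min (range (($) u)) \<in> range (($) u)" by (intro Min_in) auto
  then obtain i0 where i0: "u $ i0 = 0" using u(1) by auto
  have "i0 \<notin> S"
  proof
    assume "i0 \<in> S"
    have "u $ i = 0" for i
    proof -
      have "real_of_int (u $ i) = k * (chi S $ i - 1)" using k(1) [of i i0] i0 \<open>i0 \<in> S\<close> by simp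
      then have "real_of_int (u $ i) \<le> 0" using k(2) by (auto split: if_splits)
      then show ?thesis using ge [of i] by simp
    qed
    then have "range (($) u) = {0}" by auto
    then show False using u(2) by simp
  qed
  then have val: "real_of_int (u $ i) = (if i \<in> S then k else 0)" for i
    using k(1) [of i i0] i0 by simp
  show ?thesis
  proof (cases "S = {}")
    case True
    then have "range (($) u) = {0}" using val by (auto simp: of_int_eq_0_iff)
    then show ?thesis using u(2) by simp
  next
    case False
    then obtain j where j: "j \<in> S" by auto
    then have kj: "k = of_int (u $ j)" using val by simp
    have ui: "u $ i = (if i \<in> S then u $ j else 0)" for i
      using val [of i] kj by (cases "i \<in> S") simp_all
    have "u $ j dvd u $ i" for i using ui [of i] by (cases "i \<in> S") simp_all
    then have "u $ j dvd Gcd (range (($) u))" by (intro Gcd_greatest) auto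
    then have uj: "u $ j = 1" using ge [of j] u(2) by simp
    have "u $ i = ichi S $ i" for i using ui [of i] uj by simp
    then show ?thesis by (simp add: vec_eq_iff)
  qed
qed

text \<open>The geometric clauses of \<open>is_tree_of_matrix\<close> without balancing, lengths and
  labels. They are used for the canonical placement as well as for an arbitrary one.\<close>

locale embedding =
  fixes P :: "(real^'n::finite) set" and V :: "'v set" and I :: "'v set set" and \<phi> :: "'v \<Rightarrow> real^'n"
  assumes finite_V: "finite V" and finite_I: "finite I"
    and I_pairs: "e \<in> I \<Longrightarrow> \<exists>a b. e = {a, b} \<and> a \<noteq> b \<and> a \<in> V \<and> b \<in> V"
    and P_eq: "P = saturate (\<phi> ` V) \<union> (\<Union>e\<in>I. edge_segment \<phi> e)"
    and inj: "u \<in> V \<Longrightarrow> v \<in> V \<Longrightarrow> \<phi> u \<sim>\<^sub>1 \<phi> v \<Longrightarrow> u = v"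
    and meet: "e \<in> I \<Longrightarrow> e' \<in> I \<Longrightarrow> e \<noteq> e' \<Longrightarrow>
      edge_segment \<phi> e \<inter> edge_segment \<phi> e' = saturate (\<phi> ` (e \<inter> e'))"
begin

lemma vertex_in_segment: "a \<in> e \<Longrightarrow> e \<in> I \<Longrightarrow> \<phi> a \<in> edge_segment \<phi> e"
  unfolding edge_segment_def saturate_iff using hull_subset by (metis imageI subsetD tequiv_refl)

lemma vertex_on_segment:
  assumes "v \<in> e'" "e' \<in> I" "e \<in> I" "\<phi> v \<in> edge_segment \<phi> e"
  shows "v \<in> e"
proof (cases "e = e'")
  case False
  then have "\<phi> v \<in> saturate (\<phi> ` (e \<inter> e'))"
    using meet vertex_in_segment assms by blast
  then obtain w where "w \<in> e \<inter> e'" "\<phi> v \<sim>\<^sub>1 \<phi> w" by (auto simp: saturate_iff)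
  moreover have "v \<in> V" "w \<in> V" using I_pairs assms \<open>w \<in> e \<inter> e'\<close> by blast+
  ultimately show ?thesis using inj by auto
qed (use assms in auto)

text \<open>Vertices and edges are finitely many closed cells, so the ray starts inside one of them.
  A vertex is a single class, which a direction that is not constant leaves at once.\<close>

lemma ray_in_cell:
  assumes "\<epsilon> > 0" "\<And>t. 0 \<le> t \<Longrightarrow> t \<le> \<epsilon> \<Longrightarrow> x + t *\<^sub>R u \<in> P" "\<not> u \<sim>\<^sub>1 0"
  shows "\<exists>e\<in>I. x \<in> edge_segment \<phi> e \<and> (\<exists>t>0. t \<le> \<epsilon> \<and> x + t *\<^sub>R u \<in> edge_segment \<phi> e)"
proof -
  define F where "F = (\<lambda>v. saturate {\<phi> v}) ` V \<union> edge_segment \<phi> ` I"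
  have "\<Union>F = P" unfolding P_eq F_def by (auto simp: saturate_iff)
  moreover have "finite F" using finite_V finite_I by (simp add: F_def)
  moreover have "closed C" if "C \<in> F" for C
    using that closed_saturate closed_edge_segment I_pairs unfolding F_def
    by (metis (no_types, lifting) Un_iff compact_sing finite.emptyI finite.insertI imageE)
  ultimately obtain C t where C: "C \<in> F" "x \<in> C" "t > 0" "t \<le> \<epsilon>" "x + t *\<^sub>R u \<in> C"
    using ray_in_finite_union [of F \<epsilon> x u] assms by metis
  show ?thesis
  proof (cases "\<exists>v. C = saturate {\<phi> v}")
    case True
    then obtain v where "x \<sim>\<^sub>1 \<phi> v" "x + t *\<^sub>R u \<sim>\<^sub>1 \<phi> v" using C by (auto simp: saturate_iff)
    then have "x + t *\<^sub>R u \<sim>\<^sub>1 x" using tequiv_sym tequiv_trans by blast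
    then have "t * (u $ i - u $ j) = 0" for i j
      using tequiv_coords [of "x + t *\<^sub>R u" x i j] by (simp add: algebra_simps)
    then have "u \<sim>\<^sub>1 0" using C(3) by (simp add: tequiv_coords_iff)
    then show ?thesis using assms(3) by blast
  next
    case False
    then show ?thesis using C unfolding F_def by blast
  qed
qed

text \<open>
  Near the midpoint of an edge the hull is a segment in direction \<open>w\<close>, and by tropical convexity it
  contains all truncations \<open>min s w\<close> as directions. Hence \<open>w\<close> takes only two values.
\<close>

lemma edge_direction:
  assumes conv: "\<And>x y a. x \<in> P \<Longrightarrow> y \<in> P \<Longrightarrow> (\<chi> i. min (x $ i + a) (y $ i)) \<in> P"
    and e: "{a, b} \<in> I"
  shows "\<exists>S. S \<noteq> {} \<and> S \<noteq> UNIV \<and> trop_dist (\<phi> a) (\<phi> b) > 0 \<and>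
    \<phi> b \<sim>\<^sub>1 \<phi> a + trop_dist (\<phi> a) (\<phi> b) *\<^sub>R chi S"
proof -
  define w where "w = \<phi> b - \<phi> a"
  have ab: "a \<in> V" "b \<in> V" "a \<noteq> b" using I_pairs [OF e] by (auto simp: doubleton_eq_iff)
  then have nab: "\<not> \<phi> a \<sim>\<^sub>1 \<phi> b" using inj by blast
  have nw: "\<not> w \<sim>\<^sub>1 0"
  proof
    assume "w \<sim>\<^sub>1 0"
    then have "\<phi> a \<sim>\<^sub>1 \<phi> b" unfolding tequiv_coords_iff w_def by (auto simp: algebra_simps)
    then show False using nab by blast
  qed
  define x where "x = \<phi> a + (1/2) *\<^sub>R w"
  have seg: "y \<in> edge_segment \<phi> {a, b} \<longleftrightarrow> (\<exists>s. 0 \<le> s \<and> s \<le> 1 \<and> y \<sim>\<^sub>1 \<phi> a + s *\<^sub>R w)" for y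
    by (simp add: edge_segment_iff w_def)
  have xt: "x + t *\<^sub>R w \<in> P" if "0 \<le> t" "t \<le> 1/2" for t
  proof -
    have "x + t *\<^sub>R w = \<phi> a + (1/2 + t) *\<^sub>R w" by (simp add: x_def algebra_simps)
    then have "x + t *\<^sub>R w \<in> edge_segment \<phi> {a, b}"
      unfolding seg using that by (intro exI [of _ "1/2 + t"]) auto
    then show ?thesis using e P_eq by blast
  qed
  have two: False if lt: "w $ i1 < w $ i2" "w $ i2 < w $ i3" for i1 i2 i3
  proof -
    define m where "m = (\<chi> i. min (w $ i2) (w $ i))"
    have nm: "\<not> m \<sim>\<^sub>1 0" using tequiv_coords [of m 0 i1 i2] lt by (auto simp: m_def)
    have "x + t *\<^sub>R m \<in> P" if t: "0 \<le> t" "t \<le> 1/2" for t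
    proof -
      have "x \<in> P" using xt [of 0] by simp
      \<comment> \<open>As \<open>t \<ge> 0\<close>, the shift \<open>t * w $ i2\<close> turns the
        minimum into \<open>x $ i + t * min (w $ i2) (w $ i)\<close>.\<close>
      then have "(\<chi> i. min (x $ i + t * w $ i2) ((x + t *\<^sub>R w) $ i)) \<in> P" using conv xt [OF t] by blast
      moreover have "(\<chi> i. min (x $ i + t * w $ i2) ((x + t *\<^sub>R w) $ i)) = x + t *\<^sub>R m"
        using t by (auto simp: vec_eq_iff m_def min_add_distrib_right min_mult_distrib_left)
      ultimately show ?thesis by simp
    qed
    then obtain e' t where e': "e' \<in> I" "x \<in> edge_segment \<phi> e'" "t > 0" "x + t *\<^sub>R m \<in> edge_segment \<phi> e'"
      using ray_in_cell [of "1/2" x m] nm by auto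
    \<comment> \<open>Different edges share only end points, and \<open>x\<close> is the midpoint of
      an edge whose ends are different classes.\<close>
    have "e' = {a, b}"
    proof (rule ccontr)
      assume "e' \<noteq> {a, b}"
      moreover have "x \<in> edge_segment \<phi> {a, b}" unfolding seg x_def by (intro exI [of _ "1/2"]) auto
      ultimately have "x \<in> saturate (\<phi> ` (e' \<inter> {a, b}))" using meet [OF e'(1) e] e'(2) by blast
      then have "x \<sim>\<^sub>1 \<phi> a \<or> x \<sim>\<^sub>1 \<phi> b" by (auto simp: saturate_iff)
      then have "w $ i - w $ j = 0" for i j
      proof
        assume "x \<sim>\<^sub>1 \<phi> a"
        from tequiv_coords [OF this, of i j] show ?thesis by (simp add: x_def)
      next
        assume "x \<sim>\<^sub>1 \<phi> b"
        from tequiv_coords [OF this, of i j] show ?thesis by (simp add: x_def w_def field_simps)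
      qed
      then show False using nw by (simp add: tequiv_coords_iff)
    qed
    then obtain s where "x + t *\<^sub>R m \<sim>\<^sub>1 \<phi> a + s *\<^sub>R w" using e' seg by blast
    then have "t * (m $ i - m $ j) = (s - 1/2) * (w $ i - w $ j)" for i j
      unfolding tequiv_coords_iff x_def by (simp add: algebra_simps)
    \<comment> \<open>The truncation \<open>m\<close> agrees at \<open>i2\<close> and
      \<open>i3\<close>, where \<open>w\<close> differs, so \<open>s = 1/2\<close>; then
      \<open>m\<close> would also agree at \<open>i1\<close> and \<open>i2\<close>, where it differs
      as \<open>w\<close> does.\<close>
    from this [of i2 i3] this [of i1 i2] show False
      using lt e'(3) by (auto simp: m_def)
  qed
  define lo hi where "lo = Min (range (($) w))" and "hi = Max (range (($) w))"
  have "lo \<in> range (($) w)" "hi \<in> range (($) w)" unfolding lo_def hi_def by (intro Min_in Max_in; simp)+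
  then obtain il ih where il: "w $ il = lo" "w $ ih = hi" by auto
  have bd: "lo \<le> w $ i" "w $ i \<le> hi" for i unfolding lo_def hi_def by (auto intro: Min_le Max_ge)
  have val: "w $ i = lo \<or> w $ i = hi" for i using two [of il i ih] bd [of i] il by force
  define S where "S = {i. w $ i = hi}"
  have lohi: "lo < hi"
  proof (rule ccontr)
    assume "\<not> lo < hi"
    then have "w $ i = lo" for i using bd [of i] by simp
    then show False using nw by (auto simp: tequiv_coords_iff)
  qed
  have td: "trop_dist (\<phi> a) (\<phi> b) = hi - lo"
  proof -
    have bd': "\<phi> a $ i - \<phi> b $ i \<le> - lo" "- hi \<le> \<phi> a $ i - \<phi> b $ i" for i
      using bd [of i] unfolding w_def vector_minus_component by linarith+
    have at: "- lo = \<phi> a $ il - \<phi> b $ il" "- hi = \<phi> a $ ih - \<phi> b $ ih"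
      using il unfolding w_def vector_minus_component by linarith+
    have "Max (range (\<lambda>i. \<phi> a $ i - \<phi> b $ i)) = - lo"
    proof (rule Max_eqI)
      show "- lo \<in> range (\<lambda>i. \<phi> a $ i - \<phi> b $ i)" unfolding at(1) by (rule rangeI)
    qed (use bd' in auto)
    moreover have "Min (range (\<lambda>i. \<phi> a $ i - \<phi> b $ i)) = - hi"
    proof (rule Min_eqI)
      show "- hi \<in> range (\<lambda>i. \<phi> a $ i - \<phi> b $ i)" unfolding at(2) by (rule rangeI)
    qed (use bd' in auto)
    ultimately show ?thesis by (simp add: trop_dist_def)
  qed
  have "\<phi> b $ i = \<phi> a $ i + (hi - lo) * chi S $ i + lo" for i
    using val [of i] by (auto simp: S_def w_def)
  then have "\<phi> b \<sim>\<^sub>1 \<phi> a + (hi - lo) *\<^sub>R chi S" unfolding tequiv_iff by auto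
  moreover have "ih \<in> S" "il \<notin> S" using il lohi by (auto simp: S_def)
  ultimately show ?thesis using td lohi by (intro exI [of _ S]) auto
qed

end

text \<open>\<open>S a b\<close> is the set of coordinates that grow, modulo constants, on the way
  from \<open>a\<close> to \<open>b\<close>. Both orientations of an edge carry such a set.\<close>

locale directed_embedding = embedding P V I \<phi>
  for P :: "(real^'n::finite) set" and V :: "'v set" and I \<phi> +
  fixes S :: "'v \<Rightarrow> 'v \<Rightarrow> 'n set" and len :: "'v set \<Rightarrow> real"
  assumes dir: "{a, b} \<in> I \<Longrightarrow> \<phi> b \<sim>\<^sub>1 \<phi> a + len {a, b} *\<^sub>R chi (S a b)"
    and len_pos: "e \<in> I \<Longrightarrow> len e > 0"
    and proper: "{a, b} \<in> I \<Longrightarrow> S a b \<noteq> {} \<and> S a b \<noteq> UNIV"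
begin

text \<open>Going forth and back is no move modulo (1,...,1), so the two indicator vectors add up to
  a constant vector. The constant is 1 because \<open>S a b\<close> is neither empty nor
  everything.\<close>

lemma S_swap:
  assumes "{a, b} \<in> I" shows "S b a = - S a b"
proof -
  have "{b, a} \<in> I" using assms by (simp add: insert_commute)
  then have d: "\<phi> a \<sim>\<^sub>1 \<phi> b + len {a, b} *\<^sub>R chi (S b a)" using dir [of b a] by (simp add: insert_commute)
  have p: "len {a, b} > 0" using len_pos assms by blast
  have eq: "chi (S a b) $ i + chi (S b a) $ i = chi (S a b) $ j + chi (S b a) $ j" for i j
  proof -
    have "len {a, b} * (chi (S a b) $ i + chi (S b a) $ i) = len {a, b} * (chi (S a b) $ j + chi (S b a) $ j)"
      using tequiv_coords [OF d, of i j] tequiv_coords [OF dir [OF assms], of i j]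
      by (simp only: vector_add_component vector_scaleR_component real_scaleR_def distrib_left)
    then show ?thesis using p by simp
  qed
  obtain i j where ij: "i \<in> S a b" "j \<notin> S a b" using proper [OF assms] by auto
  then have "i \<notin> S b a" using eq [of i j] by (auto split: if_splits)
  then have one: "chi (S a b) $ k + chi (S b a) $ k = 1" for k
    using eq [of k i] ij by simp
  show ?thesis
  proof (rule set_eqI)
    fix k show "k \<in> S b a \<longleftrightarrow> k \<in> - S a b"
      using one [of k] by (cases "k \<in> S a b"; cases "k \<in> S b a") simp_all
  qed
qed

lemma segment_iff:
  assumes "{a, b} \<in> I"
  shows "x \<in> edge_segment \<phi> {a, b} \<longleftrightarrow> (\<exists>s. 0 \<le> s \<and> s \<le> len {a, b} \<and> x \<sim>\<^sub>1 \<phi> a + s *\<^sub>R chi (S a b))"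
proof -
  let ?l = "len {a, b}"
  have l: "?l > 0" using len_pos assms by blast
  have eq: "\<phi> a + s *\<^sub>R (\<phi> b - \<phi> a) \<sim>\<^sub>1 \<phi> a + (s * ?l) *\<^sub>R chi (S a b)" for s
  proof -
    have "\<phi> b - \<phi> a \<sim>\<^sub>1 ?l *\<^sub>R chi (S a b)"
      using dir [OF assms] unfolding tequiv_def by (metis (no_types, opaque_lifting) add.assoc add_diff_cancel_left')
    then show ?thesis using tequiv_add [OF tequiv_refl tequiv_scaleR [where t = s]] by (metis scaleR_scaleR)
  qed
  show ?thesis unfolding edge_segment_iff
  proof
    assume "\<exists>s. 0 \<le> s \<and> s \<le> 1 \<and> x \<sim>\<^sub>1 \<phi> a + s *\<^sub>R (\<phi> b - \<phi> a)"
    then obtain s where s: "0 \<le> s" "s \<le> 1" "x \<sim>\<^sub>1 \<phi> a + s *\<^sub>R (\<phi> b - \<phi> a)" by blast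
    then have "x \<sim>\<^sub>1 \<phi> a + (s * ?l) *\<^sub>R chi (S a b)" using eq tequiv_trans by blast
    then show "\<exists>s. 0 \<le> s \<and> s \<le> ?l \<and> x \<sim>\<^sub>1 \<phi> a + s *\<^sub>R chi (S a b)"
      using s l by (intro exI [of _ "s * ?l"]) auto
  next
    assume "\<exists>s. 0 \<le> s \<and> s \<le> ?l \<and> x \<sim>\<^sub>1 \<phi> a + s *\<^sub>R chi (S a b)"
    then obtain s where s: "0 \<le> s" "s \<le> ?l" "x \<sim>\<^sub>1 \<phi> a + s *\<^sub>R chi (S a b)" by blast
    moreover have "s / ?l * ?l = s" using l by simp
    ultimately have "x \<sim>\<^sub>1 \<phi> a + (s / ?l) *\<^sub>R (\<phi> b - \<phi> a)"
      using eq [of "s / ?l"] tequiv_trans tequiv_sym by metis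
    then show "\<exists>s. 0 \<le> s \<and> s \<le> 1 \<and> x \<sim>\<^sub>1 \<phi> a + s *\<^sub>R (\<phi> b - \<phi> a)"
      using s l by (intro exI [of _ "s / ?l"]) auto
  qed
qed

text \<open>A point inside an edge is met in both orientations and so gets two directions. The
  strict bound \<open>s < len {a, b}\<close> removes the far end, where the edge cannot be
  continued.\<close>

lemma directions_eq:
  "directions P x = {ichi (S a b) | a b. {a, b} \<in> I \<and> (\<exists>s. 0 \<le> s \<and> s < len {a, b} \<and> x \<sim>\<^sub>1 \<phi> a + s *\<^sub>R chi (S a b))}"
  (is "_ = ?R")
proof (intro set_eqI iffI)
  fix u assume "u \<in> ?R"
  then obtain a b s where u: "u = ichi (S a b)" "{a, b} \<in> I" "0 \<le> s" "s < len {a, b}" "x \<sim>\<^sub>1 \<phi> a + s *\<^sub>R chi (S a b)"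
    by blast
  have "x + t *\<^sub>R chi (S a b) \<in> P" if "t \<in> {0..len {a, b} - s}" for t
  proof -
    have "x + t *\<^sub>R chi (S a b) \<sim>\<^sub>1 (\<phi> a + s *\<^sub>R chi (S a b)) + t *\<^sub>R chi (S a b)"
      using tequiv_add u(5) tequiv_refl by blast
    then have "x + t *\<^sub>R chi (S a b) \<sim>\<^sub>1 \<phi> a + (s + t) *\<^sub>R chi (S a b)" by (simp add: algebra_simps)
    then have "x + t *\<^sub>R chi (S a b) \<in> edge_segment \<phi> {a, b}"
      unfolding segment_iff [OF u(2)] using that u by (intro exI [of _ "s + t"]) auto
    then show ?thesis using u(2) P_eq by blast
  qed
  then have "\<exists>\<epsilon>>0. \<forall>t\<in>{0..\<epsilon>}. x + t *\<^sub>R (\<chi> i. of_int (ichi (S a b) $ i)) \<in> P"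
    unfolding of_int_ichi using u(4) by (intro exI [of _ "len {a, b} - s"]) simp
  then show "u \<in> directions P x"
    unfolding directions_def u(1) mem_Collect_eq using ichi_primitive proper [OF u(2)] by blast
next
  fix u assume "u \<in> directions P x"
  then obtain \<epsilon> where u: "Min (range (($) u)) = 0" "Gcd (range (($) u)) = 1" "\<epsilon> > 0"
      "\<And>t. t \<in> {0..\<epsilon>} \<Longrightarrow> x + t *\<^sub>R (\<chi> i. of_int (u $ i)) \<in> P"
    unfolding directions_def by blast
  define v :: "real^'n" where "v = (\<chi> i. of_int (u $ i))"
  have "\<not> v \<sim>\<^sub>1 0"
  proof
    assume "v \<sim>\<^sub>1 0"
    then have "u $ i = u $ j" for i j by (simp add: tequiv_coords_iff v_def)
    then have "range (($) u) = {u $ undefined}" by auto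
    then show False using u(1,2) by simp
  qed
  then obtain e t where e: "e \<in> I" "x \<in> edge_segment \<phi> e" "t > 0" "x + t *\<^sub>R v \<in> edge_segment \<phi> e"
    using ray_in_cell [of \<epsilon> x v] u by (auto simp: v_def)
  obtain a b where ab: "e = {a, b}" using I_pairs e by blast
  have abI: "{a, b} \<in> I" "{b, a} \<in> I" using e ab by (auto simp: insert_commute)
  obtain s where s: "0 \<le> s" "s \<le> len {a, b}" "x \<sim>\<^sub>1 \<phi> a + s *\<^sub>R chi (S a b)"
    using e segment_iff [OF abI(1)] ab by blast
  obtain s' where s': "0 \<le> s'" "s' \<le> len {a, b}" "x + t *\<^sub>R v \<sim>\<^sub>1 \<phi> a + s' *\<^sub>R chi (S a b)"
    using e segment_iff [OF abI(1)] ab by blast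
  have vd: "t * (v $ i - v $ j) = (s' - s) * (chi (S a b) $ i - chi (S a b) $ j)" for i j
    using tequiv_coords [OF s(3), of i j] tequiv_coords [OF s'(3), of i j]
    by (simp add: algebra_simps)
  have vd': "v $ i - v $ j = (s' - s) / t * (chi (S a b) $ i - chi (S a b) $ j)" for i j
    using vd [of i j] e(3) by (simp add: field_simps)
  have "s' \<noteq> s" using vd' \<open>\<not> v \<sim>\<^sub>1 0\<close> by (auto simp: tequiv_coords_iff)
  then consider "s < s'" | "s' < s" by linarith
  then show "u \<in> ?R"
  proof cases
    case 1
    have "u = ichi (S a b)"
      by (rule direction_of_chi [OF u(1,2), of "(s' - s) / t"]) (use vd' 1 e(3) in \<open>auto simp: v_def\<close>)
    then show ?thesis using abI s s' 1 by (intro CollectI exI [of _ a] exI [of _ b]) auto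
  next
    case 2
    \<comment> \<open>The ray runs back towards \<open>a\<close>, so the edge is read from
      \<open>b\<close>, where \<open>x\<close> sits at distance
      \<open>len {b, a} - s\<close>.\<close>
    have sw: "chi (S b a) $ i - chi (S b a) $ j = - (chi (S a b) $ i - chi (S a b) $ j)" for i j
      using S_swap [OF abI(1)] by auto
    have "u = ichi (S b a)"
    proof (rule direction_of_chi [OF u(1,2), of "(s - s') / t"])
      show "real_of_int (u $ i) - of_int (u $ j) = (s - s') / t * (chi (S b a) $ i - chi (S b a) $ j)" for i j
        using vd' [of i j] unfolding sw by (simp add: v_def minus_divide_left flip: mult_minus_left)
    qed (use 2 e in auto)
    moreover have "x \<sim>\<^sub>1 \<phi> b + (len {b, a} - s) *\<^sub>R chi (S b a)"
    proof (rule tequivI)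
      fix i j
      let ?c = "chi (S a b) $ i - chi (S a b) $ j" and ?c' = "chi (S b a) $ i - chi (S b a) $ j"
      note split = vector_add_component vector_scaleR_component real_scaleR_def right_diff_distrib
      have l: "len {b, a} = len {a, b}" by (simp add: insert_commute)
      have "x $ i - x $ j = \<phi> a $ i - \<phi> a $ j + s * ?c"
        using tequiv_coords [OF s(3), of i j] unfolding split by linarith
      moreover have "\<phi> b $ i - \<phi> b $ j = \<phi> a $ i - \<phi> a $ j + len {a, b} * ?c"
        using tequiv_coords [OF dir [OF abI(1)], of i j] unfolding split by linarith
      moreover have "(len {a, b} - s) * ?c' = s * ?c - len {a, b} * ?c"
        unfolding sw by (simp only: mult_minus_right left_diff_distrib)
      moreover have "(\<phi> b + (len {a, b} - s) *\<^sub>R chi (S b a)) $ i - (\<phi> b + (len {a, b} - s) *\<^sub>R chi (S b a)) $ j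
          = \<phi> b $ i - \<phi> b $ j + (len {a, b} - s) * ?c'"
        unfolding split by linarith
      ultimately show "x $ i - x $ j = (\<phi> b + (len {b, a} - s) *\<^sub>R chi (S b a)) $ i - (\<phi> b + (len {b, a} - s) *\<^sub>R chi (S b a)) $ j"
        unfolding l by linarith
    qed
    ultimately show ?thesis using abI(2) s s' 2
      by (intro CollectI exI [of _ b] exI [of _ a]) (auto simp: insert_commute intro!: exI [of _ "len {b, a} - s"])
  qed
qed

lemma directions_vertex:
  assumes v: "v \<in> V" and cov: "\<exists>b. {v, b} \<in> I"
  shows "directions P (\<phi> v) = (\<lambda>b. ichi (S v b)) ` {b. {v, b} \<in> I}"
proof (intro set_eqI iffI)
  fix u assume "u \<in> directions P (\<phi> v)"
  then obtain a b s where u: "u = ichi (S a b)" "{a, b} \<in> I" "0 \<le> s" "s < len {a, b}"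
      "\<phi> v \<sim>\<^sub>1 \<phi> a + s *\<^sub>R chi (S a b)"
    unfolding directions_eq by blast
  then have "\<phi> v \<in> edge_segment \<phi> {a, b}" using segment_iff [OF u(2)] by force
  then have "v = a \<or> v = b" using vertex_on_segment cov u(2) by blast
  moreover have "v \<noteq> b"
  proof
    assume "v = b"
    then have eq: "(len {a, b} - s) * (chi (S a b) $ i - chi (S a b) $ j) = 0" for i j
      using tequiv_coords [OF u(5), of i j] tequiv_coords [OF dir [OF u(2)], of i j]
      by (simp add: algebra_simps)
    obtain i j where "i \<in> S a b" "j \<notin> S a b" using proper [OF u(2)] by auto
    then show False using eq [of i j] u(4) by simp
  qed
  ultimately show "u \<in> (\<lambda>b. ichi (S v b)) ` {b. {v, b} \<in> I}" using u by blast
next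
  fix u assume "u \<in> (\<lambda>b. ichi (S v b)) ` {b. {v, b} \<in> I}"
  then obtain b where b: "{v, b} \<in> I" "u = ichi (S v b)" by auto
  show "u \<in> directions P (\<phi> v)"
    unfolding directions_eq using b len_pos
    by (intro CollectI exI [of _ v] exI [of _ b] conjI exI [of _ 0]) simp_all
qed

text \<open>Two edges leaving \<open>v\<close> in the same direction would overlap in a segment,
  although they may only meet in \<open>v\<close>.\<close>

lemma inj_S:
  "inj_on (\<lambda>b. ichi (S v b)) {b. {v, b} \<in> I}"
proof (rule inj_onI)
  fix b c assume "b \<in> {b. {v, b} \<in> I}" "c \<in> {b. {v, b} \<in> I}" and "ichi (S v b) = ichi (S v c)"
  then have bc: "{v, b} \<in> I" "{v, c} \<in> I" "S v b = S v c" by (auto simp: ichi_inject)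
  show "b = c"
  proof (rule ccontr)
    assume "b \<noteq> c"
    then have ne: "{v, b} \<noteq> {v, c}" by (auto simp: doubleton_eq_iff)
    define s where "s = min (len {v, b}) (len {v, c})"
    have s: "s > 0" using len_pos bc by (auto simp: s_def)
    define x where "x = \<phi> v + s *\<^sub>R chi (S v b)"
    have "x \<in> edge_segment \<phi> {v, b}" "x \<in> edge_segment \<phi> {v, c}"
      unfolding segment_iff [OF bc(1)] segment_iff [OF bc(2)] x_def using s bc(3)
      by (auto simp: s_def intro!: exI [of _ s])
    then have "x \<in> saturate (\<phi> ` ({v, b} \<inter> {v, c}))" using meet bc ne by blast
    moreover have "{v, b} \<inter> {v, c} = {v}" using I_pairs [OF bc(1)] I_pairs [OF bc(2)] \<open>b \<noteq> c\<close> by auto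
    ultimately have "x \<in> saturate (\<phi> ` {v})" by metis
    then have "x \<sim>\<^sub>1 \<phi> v" by (simp add: saturate_iff)
    then have eq: "s * (chi (S v b) $ i - chi (S v b) $ j) = 0" for i j
      using tequiv_coords [of x "\<phi> v" i j]
      unfolding x_def vector_add_component vector_scaleR_component real_scaleR_def right_diff_distrib
      by linarith
    obtain i j where "i \<in> S v b" "j \<notin> S v b" using proper [OF bc(1)] by auto
    then show False using eq [of i j] s by simp
  qed
qed

lemma sum_directions_vertex:
  assumes "v \<in> V" "\<exists>b. {v, b} \<in> I"
  shows "(\<Sum>u\<in>directions P (\<phi> v). u) = (\<Sum>b | {v, b} \<in> I. ichi (S v b))"
  unfolding directions_vertex [OF assms] by (subst sum.reindex [OF inj_S]) simp

text \<open>Inside an edge the two directions are complementary indicator vectors, so balancing is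
  automatic away from the vertices.\<close>

lemma sum_directions_inner:
  assumes x: "x \<in> P" "\<And>v. v \<in> V \<Longrightarrow> \<not> x \<sim>\<^sub>1 \<phi> v"
  shows "(\<Sum>u\<in>directions P x. u) = vec 1"
proof -
  obtain e where e: "e \<in> I" "x \<in> edge_segment \<phi> e"
    using x unfolding P_eq by (auto simp: saturate_iff)
  obtain a b where ab: "e = {a, b}" "a \<in> V" "b \<in> V" using I_pairs e by blast
  have abI: "{a, b} \<in> I" "{b, a} \<in> I" using e ab by (auto simp: insert_commute)
  have "directions P x = {ichi (S a b), ichi (S b a)}"
  proof (intro set_eqI iffI)
    fix u assume "u \<in> directions P x"
    then obtain c d s where u: "u = ichi (S c d)" "{c, d} \<in> I" "0 \<le> s" "s < len {c, d}"
      "x \<sim>\<^sub>1 \<phi> c + s *\<^sub>R chi (S c d)"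
      unfolding directions_eq by blast
    then have xs: "x \<in> edge_segment \<phi> {c, d}" using segment_iff [OF u(2)] by force
    have "{c, d} = {a, b}"
    proof (rule ccontr)
      assume "{c, d} \<noteq> {a, b}"
      then have "x \<in> saturate (\<phi> ` ({c, d} \<inter> {a, b}))" using meet [OF u(2) abI(1)] xs e ab by blast
      then show False using x(2) ab by (auto simp: saturate_iff)
    qed
    then show "u \<in> {ichi (S a b), ichi (S b a)}" using u by (auto simp: doubleton_eq_iff)
  next
    have *: "ichi (S a b) \<in> directions P x" if ab: "{a, b} \<in> I" "b \<in> V" "x \<in> edge_segment \<phi> {a, b}" for a b
    proof -
      obtain s where s: "0 \<le> s" "s \<le> len {a, b}" "x \<sim>\<^sub>1 \<phi> a + s *\<^sub>R chi (S a b)"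
        using segment_iff ab by blast
      have "s \<noteq> len {a, b}" using s(3) dir [OF ab(1)] x(2) [OF ab(2)] tequiv_sym tequiv_trans by metis
      then show ?thesis unfolding directions_eq using s ab
        by (intro CollectI exI [of _ a] exI [of _ b]) auto
    qed
    fix u assume "u \<in> {ichi (S a b), ichi (S b a)}"
    then show "u \<in> directions P x" using * abI ab e by (auto simp: insert_commute)
  qed
  moreover have "ichi (S a b) \<noteq> ichi (S b a)" "ichi (S a b) + ichi (S b a) = vec 1"
    using S_swap [OF abI(1)] by (auto simp: ichi_inject vec_eq_iff)
  ultimately show ?thesis by simp
qed

end

section \<open>The tree of a matrix with prescribed Gromov products\<close>

text \<open>Here \<open>N j\<close> stands for the product of \<open>j\<close> with
  \<open>i'\<close> and \<open>L j\<close> for that of \<open>j\<close> with \<open>k\<close>; both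
  hypotheses are ultrametric inequalities. Column \<open>k\<close> has the least coefficient,
  normalised to 0. Since \<open>L\<close> does not involve \<open>i'\<close>, the combination is
  column \<open>k\<close> cut off at one height for all coordinates.\<close>

lemma tropical_combination_ultrametric:
  fixes N :: "'i::finite \<Rightarrow> real" and L :: "'i \<Rightarrow> real"
  assumes N: "\<And>j. N j \<ge> min (L j) (N k)" and L: "\<And>j. L j \<ge> min (N j) (N k)"
    and e: "\<And>j. e j \<ge> 0" "e k = 0"
  shows "Min (range (\<lambda>j. e j + N j)) = min (N k) (Min (range (\<lambda>j. e j + L j)))"
proof (rule antisym)
  have "Min (range (\<lambda>j. e j + L j)) \<in> range (\<lambda>j. e j + L j)" by (intro Min_in) auto
  then obtain j where j: "Min (range (\<lambda>j. e j + L j)) = e j + L j" by (rule rangeE)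
  have "Min (range (\<lambda>j. e j + N j)) \<le> e i + N i" for i by (intro Min_le) auto
  from this [of k] this [of j] show "Min (range (\<lambda>j. e j + N j)) \<le> min (N k) (Min (range (\<lambda>j. e j + L j)))"
    using j L [of j] e(1) [of j] e(2) by (smt (verit))
next
  have "min (N k) (Min (range (\<lambda>j. e j + L j))) \<le> e i + N i" for i
  proof -
    have "Min (range (\<lambda>j. e j + L j)) \<le> e i + L i" by (intro Min_le) auto
    then show ?thesis using N [of i] e(1) [of i] by linarith
  qed
  then show "min (N k) (Min (range (\<lambda>j. e j + L j))) \<le> Min (range (\<lambda>j. e j + N j))"
    by (intro Min.boundedI) auto
qed

lemma Min_range_add:
  fixes f :: "'i::finite \<Rightarrow> real"
  shows "Min (range (\<lambda>j. k + f j)) = k + Min (range f)"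
  using Min_add_commute [of UNIV f k] by (simp add: add.commute)

lemma trop_hull_min:
  fixes A :: "real^('n::finite)^'n"
  assumes "x \<in> trop_hull A" "y \<in> trop_hull A"
  shows "(\<chi> i. min (x $ i + a) (y $ i)) \<in> trop_hull A"
proof -
  obtain c d where c: "\<And>i. x $ i = Min (range (\<lambda>j. c j + column j A $ i))"
    and d: "\<And>i. y $ i = Min (range (\<lambda>j. d j + column j A $ i))"
    using assms unfolding trop_hull_def by blast
  have "min (x $ i + a) (y $ i) = Min (range (\<lambda>j. min (c j + a) (d j) + column j A $ i))" for i
  proof (rule antisym)
    show "min (x $ i + a) (y $ i) \<le> Min (range (\<lambda>j. min (c j + a) (d j) + column j A $ i))"
    proof (intro Min.boundedI; clarsimp)
      fix j
      have "x $ i \<le> c j + column j A $ i" "y $ i \<le> d j + column j A $ i"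
        unfolding c d by (intro Min_le; simp)+
      then show "min (x $ i + a) (y $ i) \<le> min (c j + a) (d j) + column j A $ i"
        by (auto simp: min_def)
    qed
  next
    have "Min (range (\<lambda>j. c j + column j A $ i)) \<in> range (\<lambda>j. c j + column j A $ i)"
      "Min (range (\<lambda>j. d j + column j A $ i)) \<in> range (\<lambda>j. d j + column j A $ i)"
      by (intro Min_in; simp)+
    then obtain j j' where "x $ i = c j + column j A $ i" "y $ i = d j' + column j' A $ i"
      unfolding c d by (elim rangeE)
    moreover have "Min (range (\<lambda>j. min (c j + a) (d j) + column j A $ i)) \<le> min (c l + a) (d l) + column l A $ i" for l
      by (intro Min_le) simp_all
    from this [of j] this [of j'] have "Min (range (\<lambda>j. min (c j + a) (d j) + column j A $ i)) \<le> c j + a + column j A $ i"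
      "Min (range (\<lambda>j. min (c j + a) (d j) + column j A $ i)) \<le> d j' + column j' A $ i"
      using min.cobounded1 [of "c j + a" "d j"] min.cobounded2 [of "c j' + a" "d j'"] by linarith+
    ultimately show "Min (range (\<lambda>j. min (c j + a) (d j) + column j A $ i)) \<le> min (x $ i + a) (y $ i)"
      by (simp add: algebra_simps)
  qed
  then show ?thesis unfolding trop_hull_def
    by (intro CollectI exI [of _ "\<lambda>j. min (c j + a) (d j)"]) simp
qed

section \<open>Heights and Gromov products of a metric tree\<close>

locale metric_symbic_tree = symbic_tree T z \<sigma>
  for T :: "('v, 'n::{finite,linorder}) ltree" and z :: 'v and \<sigma> :: "'v \<Rightarrow> 'v" +
  fixes len :: "'v set \<Rightarrow> real"
  assumes metric: "symbic_metric T len"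
begin

definition w :: "'v \<Rightarrow> real" where "w x = len {parent x, x}"

abbreviation pr :: "'v \<Rightarrow> 'v \<Rightarrow> real" where "pr \<equiv> gp w"

definition ht :: "'v \<Rightarrow> real" where "ht v = pr v v"

definition M :: "'n \<Rightarrow> 'n \<Rightarrow> real" where "M i j = pr (uleaf i) (pleaf j)"

lemma node_edge: "x \<in> nodes \<Longrightarrow> {parent x, x} \<in> internal_edges T"
  using internal_edges_eq by auto

lemma w_pos: "x \<in> nodes \<Longrightarrow> w x > 0"
  using metric node_edge by (auto simp: symbic_metric_def w_def)

lemma w_involution: "x \<in> nodes \<Longrightarrow> w (\<sigma> x) = w x"
proof -
  assume x: "x \<in> nodes"
  have "len (\<sigma> ` {parent x, x}) = len {parent x, x}"
    using metric involution node_edge [OF x] unfolding symbic_metric_def by blast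
  then show ?thesis using parent_involution [of x] nodesD x by (simp add: w_def)
qed

lemma w_nonneg: "x \<in> nodes \<Longrightarrow> w x \<ge> 0"
  using w_pos by (simp add: less_imp_le)

lemma sum_w_mono: "A \<subseteq> B \<Longrightarrow> B \<subseteq> nodes \<Longrightarrow> sum w A \<le> sum w B"
  using w_nonneg finite_subset [OF _ finite_nodes] by (intro sum_mono2) auto

lemma pr_nonneg: "pr u v \<ge> 0"
  unfolding gp_def using w_nonneg by (intro sum_nonneg) auto

lemma pr_commute: "pr u v = pr v u"
  by (simp add: gp_def Int_commute)

lemma pr_le_ht: "pr u v \<le> ht u" "pr u v \<le> ht v"
  unfolding ht_def gp_def by (intro sum_w_mono; auto)+

lemma ht_nonneg: "ht v \<ge> 0"
  by (simp add: ht_def pr_nonneg)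

text \<open>The ancestors of \<open>x\<close> form a chain, of which both sets are initial segments.
  This is the source of the ultrametric inequality.\<close>

lemma anc_nested:
  assumes "x \<in> verts T" "u \<in> verts T" "v \<in> verts T"
  shows "anc u \<inter> anc x \<subseteq> anc x \<inter> anc v \<or> anc x \<inter> anc v \<subseteq> anc u \<inter> anc x"
proof (rule ccontr)
  assume "\<not> ?thesis"
  then obtain a b where a: "a \<in> anc u" "a \<in> anc x" "a \<notin> anc v" and b: "b \<in> anc v" "b \<in> anc x" "b \<notin> anc u"
    by blast
  have "a \<in> anc b \<or> b \<in> anc a" using anc_chain assms a b by blast
  then show False using anc_mono a b assms by blast
qed

lemma pr_ultra:
  assumes "u \<in> verts T" "v \<in> verts T" "x \<in> verts T"
  shows "min (pr u x) (pr x v) \<le> pr u v"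
proof -
  consider "anc u \<inter> anc x \<subseteq> anc x \<inter> anc v" | "anc x \<inter> anc v \<subseteq> anc u \<inter> anc x"
    using anc_nested [OF assms(3,1,2)] by blast
  then show ?thesis
  proof cases
    case 1
    then have "pr u x \<le> pr u v" unfolding gp_def by (intro sum_w_mono) auto
    then show ?thesis by simp
  next
    case 2
    then have "pr x v \<le> pr u v" unfolding gp_def by (intro sum_w_mono) auto
    then show ?thesis by simp
  qed
qed

lemma leaf_parent_verts [simp]: "parent (leaf T l) \<in> internal_verts T"
  by (simp add: parent_internal)

lemma internal_vert [simp]: "v \<in> internal_verts T \<Longrightarrow> v \<in> verts T"
  using internal_verts_subset by blast

lemma pr_parent_leaf: "pr (parent (leaf T l)) v = pr (leaf T l) v"
proof -
  have "anc (parent (leaf T l)) \<inter> anc v \<inter> nodes = anc (leaf T l) \<inter> anc v \<inter> nodes"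
    using anc_parent(1) [of "leaf T l"] by auto
  then show ?thesis by (simp add: gp_def)
qed

lemma ht_parent_leaf: "ht (parent (leaf T l)) = ht (leaf T l)"
  using pr_parent_leaf [of l "parent (leaf T l)"] pr_parent_leaf [of l "leaf T l"]
    pr_commute [of "leaf T l" "parent (leaf T l)"]
  by (simp add: ht_def)

lemma root_pr [simp]: "pr z v = 0" "ht z = 0"
proof -
  have "{z} \<inter> nodes = {}" "{z} \<inter> A \<inter> nodes = {}" for A by (auto simp: nodes_def)
  then show "pr z v = 0" "ht z = 0" by (simp_all add: gp_def ht_def)
qed

lemma ht_parent:
  assumes "v \<in> nodes"
  shows "ht v = ht (parent v) + w v"
proof -
  have "anc v \<inter> nodes = insert v (anc (parent v) \<inter> nodes)" "v \<notin> anc (parent v)"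
    using anc_parent nodesD assms by auto
  then show ?thesis by (simp add: ht_def gp_def)
qed

lemma pr_below: "u \<in> verts T \<Longrightarrow> v \<in> anc u \<Longrightarrow> pr v u = ht v"
  using anc_mono [of u v] by (simp add: ht_def gp_def inf.absorb1)

lemma pr_not_below:
  assumes "v \<in> nodes" "v \<notin> anc u"
  shows "pr v u = pr (parent v) u"
proof -
  have "anc v \<inter> anc u = anc (parent v) \<inter> anc u"
    using anc_parent nodesD assms by auto
  then show ?thesis by (simp add: gp_def)
qed

text \<open>All edge lengths are positive, so sharing the full height of \<open>v\<close> means
  sharing the whole path to \<open>v\<close>.\<close>

lemma ht_strict:
  assumes "v \<in> internal_verts T" "pr v u = ht v" "u \<in> verts T"
  shows "v \<in> anc u"
proof (rule ccontr)
  assume "v \<notin> anc u"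
  then have "v \<in> nodes" using assms by (auto simp: nodes_def)
  then have "pr v u = pr (parent v) u" using pr_not_below \<open>v \<notin> anc u\<close> by blast
  also have "\<dots> \<le> ht (parent v)" by (rule pr_le_ht)
  also have "\<dots> < ht v" using ht_parent w_pos \<open>v \<in> nodes\<close> by simp
  finally show False using assms by simp
qed

text \<open>The first edge on the way to \<open>v\<close> has leaves of both colours on the side of
  the root, and these share no edge with \<open>v\<close>. The resulting zero coordinate of the
  image of \<open>v\<close> later pins down the additive constant of its class.\<close>

lemma root_apart:
  assumes "v \<in> internal_verts T"
  shows "\<exists>i. pr v (pleaf i) = 0" "\<exists>i. pr v (uleaf i) = 0"
proof -
  have "(\<exists>i. pr v (pleaf i) = 0) \<and> (\<exists>i. pr v (uleaf i) = 0)"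
  proof (cases "v = z")
    case False
    then obtain y where y: "y \<in> anc v" "y \<noteq> z" "parent y = z" using anc_child [of v z] assms by auto
    have yn: "y \<in> nodes"
      using anc_internal [of v y] y assms by (cases "y = v") (auto simp: nodes_def)
    have *: "pr v l = 0" if l: "y \<notin> anc l" "l \<in> verts T" for l
    proof -
      have "anc v \<inter> anc l \<inter> nodes = {}"
      proof (rule ccontr)
        assume "\<not> ?thesis"
        then obtain x where x: "x \<in> anc v" "x \<in> anc l" "x \<in> nodes" by blast
        then consider "x \<in> anc y" | "y \<in> anc x" 
          using anc_chain [OF internal_vert [OF assms], of x y] y by blast
        then show False
        proof cases
          case 1
          then have "x = y" using anc_parent(1) [of y] y nodesD x yn by auto
          then show False using x l by simp
        next
          case 2
          then show False using anc_mono x l by blast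
        qed
      qed
      then show ?thesis by (simp add: gp_def)
    qed
    obtain i j where "y \<notin> anc (pleaf i)" "y \<notin> anc (uleaf j)" using colors yn by blast
    then show ?thesis using * leaf_verts by blast
  qed simp
  then show "\<exists>i. pr v (pleaf i) = 0" "\<exists>i. pr v (uleaf i) = 0" by auto
qed

lemma leaf_below:
  assumes "v \<in> internal_verts T"
  shows "\<exists>i. v \<in> anc (pleaf i)" "\<exists>i. v \<in> anc (uleaf i)"
  using colors [of v] assms by (cases "v = z"; auto simp: nodes_def)+

lemma M_sym: "M i j = M j i"
proof -
  have "pr (uleaf i) (pleaf j) = pr (pleaf i) (uleaf j)"
    using gp_involution [of "uleaf i" "pleaf j" w] w_involution by simp
  then show ?thesis by (simp add: M_def pr_commute)
qed

lemma ht_leaf: "ht (pleaf i) = ht (uleaf i)"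
  using gp_involution [of "uleaf i" "uleaf i" w] w_involution by (simp add: ht_def)

lemma A_matrix_eq: "A_matrix T len z = (\<chi> i j. M i j)"
proof -
  have "internal_length T len z (divergence_vertex T z (uleaf i) (pleaf j)) = M i j" for i j
  proof -
    have "((anc z - (anc (uleaf i) \<inter> anc (pleaf j))) \<union> ((anc (uleaf i) \<inter> anc (pleaf j)) - anc z)) \<inter> nodes
        = anc (uleaf i) \<inter> anc (pleaf j) \<inter> nodes"
      by (auto simp: nodes_def)
    then show ?thesis
      by (simp add: internal_length_eq root divergence M_def gp_def w_def)
  qed
  then show ?thesis by (simp add: A_matrix_def)
qed

lemma B_matrix_eq: "B_matrix T len = (\<chi> i j. ht (uleaf i) + ht (uleaf j) - 2 * M i j)"
proof -
  have "internal_length T len (uleaf i) (pleaf j) = ht (uleaf i) + ht (uleaf j) - 2 * M i j" for i j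
  proof -
    let ?a = "anc (uleaf i) \<inter> nodes" and ?b = "anc (pleaf j) \<inter> nodes"
    have s: "anc (uleaf i) \<inter> anc (pleaf j) \<inter> nodes = ?a \<inter> ?b" by auto
    have "((anc (uleaf i) - anc (pleaf j)) \<union> (anc (pleaf j) - anc (uleaf i))) \<inter> nodes = (?a - ?b) \<union> (?b - ?a)"
      by auto
    then have "internal_length T len (uleaf i) (pleaf j) = sum w (?a - ?b) + sum w (?b - ?a)"
      by (subst sum.union_disjoint [symmetric]) (auto simp: internal_length_eq w_def)
    also have "\<dots> = (sum w ?a - sum w (?a \<inter> ?b)) + (sum w ?b - sum w (?a \<inter> ?b))"
      using sum.Int_Diff [of ?a w ?b] sum.Int_Diff [of ?b w ?a] by (simp add: Int_commute)
    also have "\<dots> = ht (uleaf i) + ht (pleaf j) - 2 * M i j"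
      unfolding M_def ht_def gp_def s by simp
    finally show ?thesis by (simp add: ht_leaf)
  qed
  then show ?thesis by (simp add: B_matrix_def)
qed

lemma rank_2:
  assumes "\<And>i j. A $ i $ j = M i j + x $ i + x $ j"
  shows "sym_trop_rank_2 A"
proof (rule sym_trop_rank_2I [of A M x])
  show "M k p \<ge> M k q \<or> M k p \<ge> M l q \<or> M k p \<ge> M l p" for k l p q
    \<comment> \<open>From \<open>k\<close> to \<open>p'\<close> by way of \<open>q'\<close> and
      \<open>l\<close>: the product of \<open>q'\<close> and \<open>p'\<close>, which is no entry of
      \<open>M\<close>, is bounded below in turn by two entries.\<close>
    using pr_ultra [of "uleaf k" "pleaf p" "pleaf q"] pr_ultra [of "pleaf q" "pleaf p" "uleaf l"]
      pr_commute [of "pleaf q" "uleaf l"]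
    by (auto simp: M_def min_le_iff_disj)
  show "M i j < M i i \<Longrightarrow> M i j < M j j \<Longrightarrow> M i j \<le> 0" for i j
    unfolding M_def by (rule trunk_branch [OF w_pos])
  show "\<not> (M i i > 0 \<and> M j j > 0 \<and> M k k > 0 \<and> M i j = 0 \<and> M i k = 0 \<and> M j k = 0)" for i j k
    unfolding M_def using trunk_root [of w i j k] w_pos by blast
qed (use assms M_sym pr_nonneg in \<open>auto simp: M_def\<close>)

text \<open>\<open>pt v t\<close> is the image of the point at height \<open>t\<close> on the path from the root to \<open>v\<close>.\<close>

definition pt :: "'v \<Rightarrow> real \<Rightarrow> real^('n::{finite,linorder})" where "pt v t = (\<chi> i. min (pr v (pleaf i)) t)"

definition pos :: "'v \<Rightarrow> real^('n::{finite,linorder})" where "pos v = pt v (ht v)"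

definition below :: "'v \<Rightarrow> 'n set" where "below v = {i. v \<in> anc (pleaf i)}"

section \<open>The image of the tree in the tropical torus\<close>

lemma pt_nth: "pt v t $ i = min (pr v (pleaf i)) t"
  by (simp add: pt_def)

lemma pos_nth: "pos v $ i = pr v (pleaf i)"
  using pr_le_ht(1) by (simp add: pos_def pt_nth min_def)

lemma pos_parent_leaf: "pos (parent (leaf T l)) $ i = pr (leaf T l) (pleaf i)"
  by (simp add: pos_nth pr_parent_leaf)

text \<open>Up to height \<open>pr u v\<close> the paths to \<open>u\<close> and \<open>v\<close>
  agree, and the truncated vectors only see that part.\<close>

lemma pt_cong:
  assumes "u \<in> verts T" "v \<in> verts T" "t \<le> pr u v"
  shows "pt u t = pt v t"
proof -
  have "min (pr u (pleaf i)) t = min (pr v (pleaf i)) t" for i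
    using pr_ultra [of u "pleaf i" v] pr_ultra [of v "pleaf i" u] assms
    by (auto simp: min_def pr_commute split: if_splits)
  then show ?thesis by (simp add: pt_def)
qed

text \<open>Let \<open>m\<close> be the height at which the paths to \<open>v1\<close> and
  \<open>v2\<close> separate. Primed leaves beyond \<open>v1\<close> and \<open>v2\<close> show the
  full truncated heights, and leaves apart from them show 0, which forces the constant
  \<open>c\<close> to vanish unless both points lie past the fork. There the two extreme coordinates
  give \<open>t1 - m = c = m - t2\<close>, a contradiction in sign.\<close>

lemma pt_tequivD:
  assumes v: "v1 \<in> internal_verts T" "v2 \<in> internal_verts T"
    and t: "0 \<le> t1" "t1 \<le> ht v1" "0 \<le> t2" "t2 \<le> ht v2" and eq: "pt v1 t1 \<sim>\<^sub>1 pt v2 t2"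
  shows "t1 = t2 \<and> t1 \<le> pr v1 v2"
proof -
  obtain c where c: "\<And>i. min (pr v1 (pleaf i)) t1 = min (pr v2 (pleaf i)) t2 + c"
    using eq by (auto simp: tequiv_iff pt_nth)
  define m where "m = pr v1 v2"
  obtain i1 where i1: "v1 \<in> anc (pleaf i1)" using leaf_below v by blast
  obtain i2 where i2: "v2 \<in> anc (pleaf i2)" using leaf_below v by blast
  have h: "pr v1 (pleaf i1) = ht v1" "pr v2 (pleaf i2) = ht v2" using pr_below i1 i2 by auto
  obtain j1 where j1: "pr v1 (pleaf j1) = 0" using root_apart v by blast
  obtain j2 where j2: "pr v2 (pleaf j2) = 0" using root_apart v by blast
  have mle: "m \<le> ht v1" "m \<le> ht v2" using pr_le_ht by (auto simp: m_def)
  have u1: "pr v2 (pleaf i1) = m" if "m < ht v1"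
    using pr_ultra [of v2 "pleaf i1" v1] pr_ultra [of v2 v1 "pleaf i1"] h mle that v
    by (simp add: m_def pr_commute min_def split: if_splits)
  have u2: "pr v1 (pleaf i2) = m" if "m < ht v2"
    using pr_ultra [of v1 "pleaf i2" v2] pr_ultra [of v1 v2 "pleaf i2"] h mle that v
    by (simp add: m_def pr_commute min_def split: if_splits)
  have same: "min (pr v1 (pleaf i)) s = min (pr v2 (pleaf i)) s" if "s \<le> m" for i s
    using pt_cong [of v1 v2 s] that v by (auto simp: m_def vec_eq_iff pt_nth)
  have n: "pr u x \<ge> 0" for u x by (rule pr_nonneg)
  consider "t1 \<le> m" "t2 \<le> m" | "t1 \<le> m" "m < t2" | "m < t1" "t2 \<le> m" | "m < t1" "m < t2" by linarith
  then show ?thesis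
  proof cases
    case 1
    have "c = 0" using c [of j2] same [OF 1(1), of j2] j2 t by (simp add: min_def split: if_splits)
    moreover have "t1 = t2 + c" using c [of i2] same [OF 1(1), of i2] h 1 mle t by (simp add: min_def split: if_splits)
    ultimately show ?thesis using 1 by (simp add: m_def)
  next
    case 2
    have "t1 = t2 + c" using c [of i2] h u2 2 t by (simp add: min_def split: if_splits)
    moreover have "c = 0" using c [of j2] same [OF 2(1), of j2] j2 t by (simp add: min_def split: if_splits)
    ultimately show ?thesis using 2 by simp
  next
    case 3
    have "t1 = t2 + c" using c [of i1] h u1 3 t by (simp add: min_def split: if_splits)
    moreover have "c = 0" using c [of j1] same [OF 3(2), of j1] j1 t by (simp add: min_def split: if_splits)
    ultimately show ?thesis using 3 by simp
  next
    case 4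
    have "t1 = m + c" using c [of i1] h u1 4 t by (simp add: min_def split: if_splits)
    moreover have "m = t2 + c" using c [of i2] h u2 4 t by (simp add: min_def split: if_splits)
    ultimately show ?thesis using 4 by simp
  qed
qed

lemma pt_edge:
  assumes v: "v \<in> nodes" and t: "0 \<le> s" "s \<le> w v"
  shows "pt v (ht (parent v) + s) = pos (parent v) + s *\<^sub>R chi (below v)"
proof -
  have "min (pr v (pleaf i)) (ht (parent v) + s) = pr (parent v) (pleaf i) + s * chi (below v) $ i" for i
  proof (cases "i \<in> below v")
    case True
    then have "v \<in> anc (pleaf i)" by (simp add: below_def)
    moreover have "parent v \<in> anc (pleaf i)"
      using calculation anc_mono parent_in_anc nodesD v by (meson leaf_verts subsetD)
    ultimately show ?thesis using pr_below [of "pleaf i"] True t ht_parent [OF v] by simp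
  next
    case False
    then have "pr v (pleaf i) = pr (parent v) (pleaf i)" using pr_not_below v by (simp add: below_def)
    moreover have "pr (parent v) (pleaf i) \<le> ht (parent v)" by (rule pr_le_ht)
    ultimately show ?thesis using False t by simp
  qed
  then show ?thesis by (simp add: vec_eq_iff pt_nth pos_nth)
qed

lemma pos_edge: "v \<in> nodes \<Longrightarrow> pos v = pos (parent v) + w v *\<^sub>R chi (below v)"
  using pt_edge [of v "w v"] w_nonneg ht_parent by (simp add: pos_def)

text \<open>Move towards the root until the edge containing height \<open>t\<close> is reached; as
  long as \<open>t\<close> is less than the height of the parent, replacing \<open>v\<close> by
  \<open>parent v\<close> does not change the point.\<close>

lemma pt_on_edge:
  assumes "v \<in> internal_verts T" "0 \<le> t" "t \<le> ht v"
  shows "pt v t = pos z \<or> (\<exists>u\<in>nodes. \<exists>s. 0 \<le> s \<and> s \<le> w u \<and> pt v t = pos (parent u) + s *\<^sub>R chi (below u))"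
  using assms
proof (induction "length (rpath v)" arbitrary: v rule: less_induct)
  case less
  show ?case
  proof (cases "v = z")
    case True
    then have "t = 0" using less.prems by simp
    then show ?thesis using True by (simp add: pos_def)
  next
    case False
    then have v: "v \<in> nodes" using less.prems by (auto simp: nodes_def)
    show ?thesis
    proof (cases "t \<ge> ht (parent v)")
      case True
      then have "pt v t = pos (parent v) + (t - ht (parent v)) *\<^sub>R chi (below v)"
        using pt_edge [OF v, of "t - ht (parent v)"] less.prems ht_parent [OF v] by simp
      then show ?thesis using v True less.prems ht_parent [OF v]
        by (intro disjI2 bexI [of _ v] exI [of _ "t - ht (parent v)"]) auto
    next
      case False
      have V: "v \<in> verts T" "v \<noteq> z" using nodesD v by auto
      have p: "pr (parent v) v = ht (parent v)" using pr_below [OF V(1)] parent_in_anc [OF V] by simp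
      then have "pt v t = pt (parent v) t"
        using pt_cong [of "parent v" v t] V False rpath_parent(2) by simp
      moreover have "length (rpath (parent v)) < length (rpath v)" using rpath_parent(1) [OF V] by simp
      ultimately show ?thesis using less.hyps [of "parent v"] False less.prems parent_internal V by simp
    qed
  qed
qed

lemma trop_hull_eq:
  assumes A: "\<And>i j. A $ i $ j = M i j + X $ i + X $ j"
  shows "trop_hull A = saturate {X + pt v t | v t. v \<in> internal_verts T \<and> 0 \<le> t \<and> t \<le> ht v}"
proof -
  define L where "L k j = pr (uleaf j) (uleaf k)" for k j
  have col: "column j A $ i = X $ i + X $ j + pr (uleaf j) (pleaf i)" for i j
    using A [of i j] M_sym [of i j] by (simp add: column_def M_def)
  have ultra: "Min (range (\<lambda>j. e j + pr (uleaf j) (pleaf i))) =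
      min (pr (uleaf k) (pleaf i)) (Min (range (\<lambda>j. e j + L k j)))"
    if "\<And>j. e j \<ge> 0" "e k = 0" for e :: "'n \<Rightarrow> real" and k i
  proof (rule tropical_combination_ultrametric)
    show "min (L k j) (pr (uleaf k) (pleaf i)) \<le> pr (uleaf j) (pleaf i)" for j
      using pr_ultra [of "uleaf j" "pleaf i" "uleaf k"] by (simp add: L_def)
    show "min (pr (uleaf j) (pleaf i)) (pr (uleaf k) (pleaf i)) \<le> L k j" for j
      using pr_ultra [of "uleaf j" "uleaf k" "pleaf i"] pr_commute [of "pleaf i" "uleaf k"] by (simp add: L_def)
  qed (use that in auto)
  show ?thesis
  proof (intro set_eqI iffI)
    fix x assume "x \<in> trop_hull A"
    then obtain c where c: "\<And>i. x $ i = Min (range (\<lambda>j. c j + column j A $ i))"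
      unfolding trop_hull_def by blast
    \<comment> \<open>Column \<open>j\<close> carries its own constant \<open>X $ j\<close>, so the
      effective coefficient is \<open>c j + X $ j\<close>; the column where it is least becomes the
      \<open>k\<close> with normalised coefficient 0.\<close>
    have "Min (range (\<lambda>j. c j + X $ j)) \<in> range (\<lambda>j. c j + X $ j)" by (intro Min_in) auto
    then obtain k where k: "Min (range (\<lambda>j. c j + X $ j)) = c k + X $ k" by (rule rangeE)
    have kle: "c k + X $ k \<le> c j + X $ j" for j unfolding k [symmetric] by (intro Min_le) auto
    define e where "e j = c j + X $ j - (c k + X $ k)" for j
    define h where "h = Min (range (\<lambda>j. e j + L k j))"
    have e: "\<And>j. e j \<ge> 0" "e k = 0" using kle by (auto simp: e_def)
    have "h \<in> range (\<lambda>j. e j + L k j)" unfolding h_def by (intro Min_in) auto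
    then have h0: "h \<ge> 0" using e pr_nonneg by (auto simp: L_def)
    have "h \<le> e k + L k k" unfolding h_def by (intro Min_le) auto
    then have hk: "h \<le> ht (parent (uleaf k))" using e
      by (simp add: L_def ht_parent_leaf) (simp add: ht_def)
    have "x $ i = X $ i + pt (parent (uleaf k)) h $ i + (c k + X $ k)" for i
    proof -
      have "x $ i = Min (range (\<lambda>j. (X $ i + (c k + X $ k)) + (e j + pr (uleaf j) (pleaf i))))"
        unfolding c col e_def by (simp add: algebra_simps)
      also have "\<dots> = (X $ i + (c k + X $ k)) + Min (range (\<lambda>j. e j + pr (uleaf j) (pleaf i)))"
        by (rule Min_range_add)
      also have "Min (range (\<lambda>j. e j + pr (uleaf j) (pleaf i))) = min (pr (uleaf k) (pleaf i)) h"
        unfolding h_def by (rule ultra) (fact e)+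
      finally show ?thesis by (simp add: pt_nth pr_parent_leaf)
    qed
    then have "x \<sim>\<^sub>1 X + pt (parent (uleaf k)) h" unfolding tequiv_iff by auto
    then show "x \<in> saturate {X + pt v t | v t. v \<in> internal_verts T \<and> 0 \<le> t \<and> t \<le> ht v}"
      unfolding saturate_iff using h0 hk leaf_parent_verts by blast
  next
    fix x assume "x \<in> saturate {X + pt v t | v t. v \<in> internal_verts T \<and> 0 \<le> t \<and> t \<le> ht v}"
    then obtain v t where vt: "v \<in> internal_verts T" "0 \<le> t" "t \<le> ht v" "x \<sim>\<^sub>1 X + pt v t"
      unfolding saturate_iff by blast
    obtain k where "v \<in> anc (uleaf k)" using leaf_below vt by blast
    then have tk: "t \<le> pr v (uleaf k)" using pr_below vt by simp
    then have "pt v t = pt (uleaf k) t" using pt_cong vt by simp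
    then obtain d where d: "\<And>i. x $ i = X $ i + min (pr (uleaf k) (pleaf i)) t + d"
      using vt(4) by (auto simp: tequiv_iff pt_nth)
    \<comment> \<open>The least nonnegative coefficients with \<open>e j + L k j \<ge> t\<close>;
      the one of \<open>k\<close> is 0 because \<open>t \<le> L k k\<close>.\<close>
    define e where "e j = max 0 (t - L k j)" for j
    have tkk: "t \<le> L k k" using tk pr_le_ht(2) [of v "uleaf k"] by (simp add: L_def ht_def)
    then have e: "\<And>j. e j \<ge> 0" "e k = 0" by (auto simp: e_def)
    \<comment> \<open>A leaf on another side of the root has \<open>L k j0 = 0\<close>, so the bound
      \<open>t\<close> is attained and the cut is at height exactly \<open>t\<close>.\<close>
    obtain j0 where "pr (parent (uleaf k)) (uleaf j0) = 0"
      using root_apart(2) leaf_parent_verts by blast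
    then have j0: "L k j0 = 0"
      using pr_commute [of "uleaf k" "uleaf j0"] by (simp add: L_def pr_parent_leaf)
    have "Min (range (\<lambda>j. e j + L k j)) = t"
    proof (rule Min_eqI)
      show "t \<in> range (\<lambda>j. e j + L k j)" using j0 vt by (intro range_eqI [of _ _ j0]) (simp add: e_def)
    qed (auto simp: e_def)
    then have m: "Min (range (\<lambda>j. e j + pr (uleaf j) (pleaf i))) = min (pr (uleaf k) (pleaf i)) t" for i
      using ultra [of e k i] e by simp
    have "x $ i = Min (range (\<lambda>j. (e j + d - X $ j) + column j A $ i))" for i
    proof -
      have "Min (range (\<lambda>j. (e j + d - X $ j) + column j A $ i)) =
          Min (range (\<lambda>j. (X $ i + d) + (e j + pr (uleaf j) (pleaf i))))"
        unfolding col by (simp add: algebra_simps)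
      also have "\<dots> = (X $ i + d) + Min (range (\<lambda>j. e j + pr (uleaf j) (pleaf i)))"
        by (rule Min_range_add)
      finally show ?thesis using d m by simp
    qed
    then show "x \<in> trop_hull A"
      unfolding trop_hull_def by (intro CollectI exI [of _ "\<lambda>j. e j + d - X $ j"] allI)
  qed
qed

end

lemma trop_dist_chi:
  fixes x :: "real^('n::finite)"
  assumes "y \<sim>\<^sub>1 x + l *\<^sub>R chi S" "l > 0" "S \<noteq> {}" "S \<noteq> UNIV"
  shows "trop_dist x y = l"
proof -
  obtain c where "\<And>i. y $ i = x $ i + l * chi S $ i + c"
    using assms(1) by (auto simp: tequiv_iff)
  then have d: "x $ i - y $ i = - c - (if i \<in> S then l else 0)" for i by simp
  obtain i j where ij: "i \<in> S" "j \<notin> S" using assms by auto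
  have "Max (range (\<lambda>i. x $ i - y $ i)) = - c"
  proof (rule Max_eqI)
    show "- c \<in> range (\<lambda>i. x $ i - y $ i)" unfolding d using ij by (intro range_eqI [of _ _ j]) simp
  qed (use assms(2) in \<open>auto simp: d\<close>)
  moreover have "Min (range (\<lambda>i. x $ i - y $ i)) = - c - l"
  proof (rule Min_eqI)
    show "- c - l \<in> range (\<lambda>i. x $ i - y $ i)" unfolding d using ij by (intro range_eqI [of _ _ i]) simp
  qed (use assms(2) in \<open>auto simp: d\<close>)
  ultimately show ?thesis by (simp add: trop_dist_def)
qed

lemma (in directed_embedding) directions_cong: "x \<sim>\<^sub>1 y \<Longrightarrow> directions P x = directions P y"
proof -
  assume "x \<sim>\<^sub>1 y"
  then have "x \<sim>\<^sub>1 u \<longleftrightarrow> y \<sim>\<^sub>1 u" for u using tequiv_sym tequiv_trans by blast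
  then show ?thesis unfolding directions_eq by simp
qed

section \<open>Balancing of the embedded tree\<close>

context metric_symbic_tree begin

lemma leaf_edge:
  assumes "{leaf T l, v} \<in> edges T"
  shows "v = parent (leaf T l)"
proof -
  have "\<not> (\<exists>y\<in>verts T - {z}. parent y = leaf T l)"
    using parent_internal by (auto simp: internal_verts_def)
  then have "{leaf T l, v} = {parent (leaf T l), leaf T l}"
    using edge_at [OF assms, of "leaf T l"] by auto
  then show ?thesis
    using edge_card [OF assms] by (auto simp: doubleton_eq_iff)
qed

lemma edge_to_parent: "{leaf T l, parent (leaf T l)} \<in> edges T"
  using rpath_parent(3) [of "leaf T l"] by (simp add: insert_commute)

lemma child_below: "v \<in> nodes \<Longrightarrow> i \<in> below v \<Longrightarrow> i \<in> below (parent v)"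
  unfolding below_def using anc_mono parent_in_anc nodesD leaf_verts by blast

lemma child_unique:
  assumes "l \<in> verts T" "a \<in> anc l" "b \<in> anc l" "a \<noteq> z" "b \<noteq> z" "parent a = parent b"
  shows "a = b"
proof -
  have V: "a \<in> verts T" "b \<in> verts T" using anc_verts assms by auto
  have "a \<in> anc b \<or> b \<in> anc a" using anc_chain assms by blast
  then show ?thesis
    using anc_parent [OF V(1) assms(4)] anc_parent [OF V(2) assms(5)] assms(6) by auto
qed

text \<open>
  This is the balancing condition at \<open>v\<close>: the edges to the children and the rays attached at \<open>v\<close>
  point in the directions that partition \<open>below v\<close>.
\<close>

lemma child_count:
  assumes "v \<in> internal_verts T"
  shows "(\<Sum>c | c \<in> nodes \<and> parent c = v. if i \<in> below c then 1 else 0) + (if parent (pleaf i) = v then 1 else 0)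
    = (if i \<in> below v then 1 else 0 :: int)"
proof -
  let ?C = "{c. c \<in> nodes \<and> parent c = v}"
  have fin: "finite ?C" by simp
  show ?thesis
  proof (cases "i \<in> below v")
    case False
    have "parent (pleaf i) \<noteq> v"
      using False parent_in_anc [of "pleaf i"] by (auto simp: below_def)
    moreover have "i \<notin> below c" if "c \<in> ?C" for c using that False child_below by blast
    ultimately show ?thesis using False by simp
  next
    case True
    then have va: "v \<in> anc (pleaf i)" by (simp add: below_def)
    moreover have "v \<noteq> pleaf i" using assms by (auto simp: internal_verts_def)
    ultimately obtain y where y: "y \<in> anc (pleaf i)" "y \<noteq> z" "parent y = v"
      using anc_child [of "pleaf i" v] by auto
    show ?thesis
    proof (cases "y = pleaf i")
      case yl: True
      have "i \<notin> below c" if c: "c \<in> ?C" for c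
      proof
        assume "i \<in> below c"
        then have "c = y" using child_unique [of "pleaf i" c y] c y nodesD by (auto simp: below_def)
        then show False using yl c by simp
      qed
      then show ?thesis using True y yl by simp
    next
      case False
      then have yn: "y \<in> nodes"
        using anc_internal [of "pleaf i" y] y by (auto simp: nodes_def)
      have "i \<in> below c \<longleftrightarrow> c = y" if c: "c \<in> ?C" for c
        using child_unique [of "pleaf i" c y] c y nodesD(2) by (auto simp: below_def)
      then have "(\<Sum>c\<in>?C. if i \<in> below c then 1 else 0 :: int) = (\<Sum>c\<in>?C. if c = y then 1 else 0)"
        by (intro sum.cong) auto
      also have "\<dots> = 1" using fin yn y by simp
      finally have "(\<Sum>c\<in>?C. if i \<in> below c then 1 else 0 :: int) = 1" .
      moreover have "parent (pleaf i) \<noteq> v"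
      proof
        assume "parent (pleaf i) = v"
        then have "pleaf i = y" using child_unique [of "pleaf i" "pleaf i" y] y by simp
        then show False using False by simp
      qed
      ultimately show ?thesis using True by simp
    qed
  qed
qed

lemma below_proper: "v \<in> nodes \<Longrightarrow> below v \<noteq> {} \<and> below v \<noteq> UNIV"
  using colors [of v] by (auto simp: below_def)

lemma below_root: "below z = UNIV"
  by (auto simp: below_def)

lemma finite_internal: "finite (internal_verts T)" "finite (internal_edges T)"
  using finite_verts internal_verts_subset finite_subset apply blast
  by (simp add: internal_edges_eq)

lemma internal_edge_pair:
  assumes "e \<in> internal_edges T"
  shows "\<exists>a b. e = {a, b} \<and> a \<noteq> b \<and> a \<in> internal_verts T \<and> b \<in> internal_verts T"
proof -
  obtain v where "v \<in> nodes" "e = {parent v, v}" using assms internal_edges_eq by auto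
  then show ?thesis using parent_internal [of v] parent_neq [of v] nodesD [of v] by blast
qed

lemma internal_edge_cases:
  assumes "{a, b} \<in> internal_edges T"
  shows "b \<in> nodes \<and> a = parent b \<or> a \<in> nodes \<and> b = parent a"
  using assms unfolding internal_edges_eq by (auto simp: doubleton_eq_iff)

lemma neighbours:
  assumes "v \<in> internal_verts T"
  shows "{b. {v, b} \<in> internal_edges T} =
    {c. c \<in> nodes \<and> parent c = v} \<union> (if v = z then {} else {parent v})"
proof (intro set_eqI iffI)
  fix b assume "b \<in> {b. {v, b} \<in> internal_edges T}"
  then have "b \<in> nodes \<and> v = parent b \<or> v \<in> nodes \<and> b = parent v"
    using internal_edge_cases by blast
  then show "b \<in> {c. c \<in> nodes \<and> parent c = v} \<union> (if v = z then {} else {parent v})"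
    using nodesD(2) by auto
next
  fix b assume "b \<in> {c. c \<in> nodes \<and> parent c = v} \<union> (if v = z then {} else {parent v})"
  then consider "b \<in> nodes" "parent b = v" | "v \<noteq> z" "b = parent v" by (auto split: if_splits)
  then show "b \<in> {b. {v, b} \<in> internal_edges T}"
  proof cases
    case 1
    then show ?thesis using node_edge by auto
  next
    case 2
    then have "v \<in> nodes" using assms by (simp add: nodes_def)
    then show ?thesis using node_edge 2 by (simp add: insert_commute)
  qed
qed

text \<open>Without internal edges the hull has no directions and both sums vanish. Otherwise every
  internal vertex has an internal edge, as \<open>sum_directions_vertex\<close> demands; at the root
  it is the first edge towards any node.\<close>

lemma vertex_sum:
  fixes P :: "(real^('n::{finite,linorder})) set" and \<phi> :: "'v \<Rightarrow> real^('n::{finite,linorder})"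
  assumes D: "directed_embedding P (internal_verts T) (internal_edges T) \<phi> S len"
    and v: "v \<in> internal_verts T"
  shows "(\<Sum>u\<in>directions P (\<phi> v). u) =
    (\<Sum>c | c \<in> nodes \<and> parent c = v. ichi (S v c)) + (if v = z then 0 else ichi (S v (parent v)))"
proof -
  interpret directed_embedding P "internal_verts T" "internal_edges T" \<phi> S len by (rule D)
  let ?C = "{c. c \<in> nodes \<and> parent c = v}"
  have "(\<Sum>u\<in>directions P (\<phi> v). u) = (\<Sum>b | {v, b} \<in> internal_edges T. ichi (S v b))"
  proof (cases "nodes = {}")
    case True
    then have "internal_edges T = {}" by (simp add: internal_edges_eq)
    then show ?thesis unfolding directions_eq by simp
  next
    case False
    have "\<exists>b. {v, b} \<in> internal_edges T"
    proof (cases "v = z")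
      case True
      obtain x where x: "x \<in> nodes" using False by auto
      then have X: "x \<in> verts T" "x \<noteq> z" "x \<in> internal_verts T" using nodesD by auto
      obtain y where y: "y \<in> anc x" "y \<noteq> z" "parent y = z" using anc_child [of x z] X by auto
      have "y \<in> nodes" using anc_internal [OF X(1) y(1)] X y by (cases "y = x") (auto simp: nodes_def)
      then show ?thesis using node_edge y True by metis
    next
      case False
      then show ?thesis using neighbours [OF v] by auto
    qed
    then show ?thesis by (rule sum_directions_vertex [OF v])
  qed
  also have "\<dots> = (\<Sum>c\<in>?C. ichi (S v c)) + (if v = z then 0 else ichi (S v (parent v)))"
  proof (cases "v = z")
    case False
    have "v \<in> verts T" using v by simp
    have "parent v \<notin> ?C"
    proof
      assume "parent v \<in> ?C"
      then have "v \<in> anc (parent v)" using parent_in_anc [of "parent v"] nodesD by auto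
      then show False using anc_parent(2) \<open>v \<in> verts T\<close> False by blast
    qed
    then show ?thesis unfolding neighbours [OF v] using False by (simp add: add.commute)
  qed (use neighbours [OF v] in simp)
  finally show ?thesis .
qed

lemma axis_sum_nth: "(\<Sum>j | parent (pleaf j) = v. axis j 1) $ i = (if parent (pleaf i) = v then 1 else 0 :: int)"
  by (simp add: sum_component axis_def)

lemma segment_pt:
  fixes X :: "real^('n::{finite,linorder})"
  assumes v: "v \<in> nodes"
  shows "y \<in> edge_segment (\<lambda>v. X + pos v) {parent v, v} \<longleftrightarrow>
    (\<exists>t. ht (parent v) \<le> t \<and> t \<le> ht v \<and> y \<sim>\<^sub>1 X + pt v t)"
proof -
  have w: "w v > 0" "ht v = ht (parent v) + w v" using w_pos ht_parent v by auto
  have eq: "(X + pos (parent v)) + s *\<^sub>R ((X + pos v) - (X + pos (parent v))) = X + pt v (ht (parent v) + s * w v)"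
    if "0 \<le> s" "s \<le> 1" for s
  proof -
    have "s * w v \<le> 1 * w v" using that w by (intro mult_right_mono) auto
    then show ?thesis
      using pt_edge [OF v, of "s * w v"] that w by (simp add: pos_edge [OF v])
  qed
  show ?thesis unfolding edge_segment_iff
  proof
    assume "\<exists>s. 0 \<le> s \<and> s \<le> 1 \<and> y \<sim>\<^sub>1 (X + pos (parent v)) + s *\<^sub>R ((X + pos v) - (X + pos (parent v)))"
    then obtain s where s: "0 \<le> s" "s \<le> 1" "y \<sim>\<^sub>1 X + pt v (ht (parent v) + s * w v)"
      using eq by metis
    have "s * w v \<le> 1 * w v" using s w by (intro mult_right_mono) auto
    then show "\<exists>t. ht (parent v) \<le> t \<and> t \<le> ht v \<and> y \<sim>\<^sub>1 X + pt v t"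
      using s w by (intro exI [of _ "ht (parent v) + s * w v"]) auto
  next
    assume "\<exists>t. ht (parent v) \<le> t \<and> t \<le> ht v \<and> y \<sim>\<^sub>1 X + pt v t"
    then obtain t where t: "ht (parent v) \<le> t" "t \<le> ht v" "y \<sim>\<^sub>1 X + pt v t" by blast
    define s where "s = (t - ht (parent v)) / w v"
    have s: "0 \<le> s" "s \<le> 1" "ht (parent v) + s * w v = t" using t w by (auto simp: s_def field_simps)
    have "y \<sim>\<^sub>1 (X + pos (parent v)) + s *\<^sub>R ((X + pos v) - (X + pos (parent v)))"
      using t(3) unfolding eq [OF s(1,2)] s(3) .
    with s show "\<exists>s. 0 \<le> s \<and> s \<le> 1 \<and> y \<sim>\<^sub>1 (X + pos (parent v)) + s *\<^sub>R ((X + pos v) - (X + pos (parent v)))"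
      by blast
  qed
qed

lemma shift_tequiv: "X + x \<sim>\<^sub>1 X + y \<longleftrightarrow> x \<sim>\<^sub>1 y" for X :: "real^('n::{finite,linorder})"
  by (simp add: tequiv_coords_iff algebra_simps)

text \<open>A common point of the two edges lies on the shared part of the root paths. As
  \<open>v1\<close> is not on the path to \<open>v2\<close>, that part stops at
  \<open>parent v1\<close> at the latest, which makes the point \<open>parent v1\<close>. If
  \<open>v2\<close> is above \<open>v1\<close>, this vertex is \<open>v2\<close>; otherwise the same
  argument for \<open>v2\<close> makes the two parents ancestors of each other.\<close>

lemma edge_not_above:
  assumes v: "v1 \<in> nodes" "v2 \<in> nodes" "v1 \<noteq> v2" "v1 \<notin> anc v2"
    and t: "ht (parent v1) \<le> t" "t \<le> ht v1" "ht (parent v2) \<le> t" "t \<le> ht v2" "t \<le> pr v1 v2"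
  shows "t = ht (parent v1)" "parent v1 \<in> {parent v2, v2}"
proof -
  have V: "v1 \<in> verts T" "v1 \<noteq> z" "v2 \<in> verts T" "v2 \<noteq> z" using nodesD v by auto
  have pV: "parent v1 \<in> internal_verts T" "parent v2 \<in> internal_verts T" using parent_internal V by auto
  have p1: "pr v1 v2 = pr (parent v1) v2" using pr_not_below v by blast
  then have eq: "t = ht (parent v1)" "pr (parent v1) v2 = ht (parent v1)"
    using t pr_le_ht(1) [of "parent v1" v2] by auto
  show "t = ht (parent v1)" by (rule eq)
  have a1: "parent v1 \<in> anc v2" using ht_strict pV eq V by blast
  show "parent v1 \<in> {parent v2, v2}"
  proof (cases "v2 \<in> anc v1")
    case True
    then have "v2 \<in> anc (parent v1)" using anc_parent(1) [OF V(1,2)] v by auto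
    then have "parent v1 = v2" using anc_antisym a1 V pV internal_vert by blast
    then show ?thesis by simp
  next
    case False
    have "pr v2 v1 = pr (parent v2) v1" using pr_not_below v False by blast
    then have "pr (parent v2) v1 = ht (parent v2)"
      using t pr_le_ht(1) [of "parent v2" v1] pr_commute [of v1 v2] by auto
    then have a2: "parent v2 \<in> anc v1" using ht_strict pV V by blast
    have "parent v1 \<noteq> v2" using False parent_in_anc V by blast
    then have b1: "parent v1 \<in> anc (parent v2)" using a1 anc_parent(1) [OF V(3,4)] by auto
    have "parent v2 \<noteq> v1" using v(4) parent_in_anc V by blast
    then have b2: "parent v2 \<in> anc (parent v1)" using a2 anc_parent(1) [OF V(1,2)] by auto
    show ?thesis using anc_antisym b1 b2 pV internal_vert by blast
  qed
qed

text \<open>Away from the root an edge raises \<open>below b\<close>. Towards the root it lowers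
  \<open>below a\<close>, which modulo (1,...,1) raises the complement.\<close>

definition side :: "'v \<Rightarrow> 'v \<Rightarrow> 'n set" where
  "side a b = (if b \<in> nodes \<and> a = parent b then below b else - below a)"

lemma pos_embedding:
  fixes X :: "real^('n::{finite,linorder})" and A :: "real^('n::{finite,linorder})^('n::{finite,linorder})"
  assumes A: "\<And>i j. A $ i $ j = M i j + X $ i + X $ j"
  shows "directed_embedding (trop_hull A) (internal_verts T) (internal_edges T) (\<lambda>v. X + pos v) side len"
proof
  let ?\<phi> = "\<lambda>v. X + pos v"
  show "finite (internal_verts T)" "finite (internal_edges T)" by (rule finite_internal)+
  show "\<exists>a b. e = {a, b} \<and> a \<noteq> b \<and> a \<in> internal_verts T \<and> b \<in> internal_verts T"
    if "e \<in> internal_edges T" for e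
    using that by (rule internal_edge_pair)
  show inj: "u = v" if "u \<in> internal_verts T" "v \<in> internal_verts T" "?\<phi> u \<sim>\<^sub>1 ?\<phi> v" for u v
  proof -
    have "pt u (ht u) \<sim>\<^sub>1 pt v (ht v)" using that by (simp add: shift_tequiv pos_def)
    then have "ht u = ht v" "ht u \<le> pr u v" using pt_tequivD that ht_nonneg by blast+
    then have "pr u v = ht u" "pr v u = ht v"
      using pr_le_ht(1) [of u v] pr_commute [of u v] by auto
    then show ?thesis using ht_strict that anc_antisym internal_vert by blast
  qed
  have pt0: "pt v (ht (parent v)) = pos (parent v)" if "v \<in> nodes" for v
    using pt_edge [OF that, of 0] w_nonneg that by simp
  show "trop_hull A = saturate (?\<phi> ` internal_verts T) \<union> (\<Union>e\<in>internal_edges T. edge_segment ?\<phi> e)"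
  proof (intro set_eqI iffI)
    fix x assume "x \<in> trop_hull A"
    then obtain v t where vt: "v \<in> internal_verts T" "0 \<le> t" "t \<le> ht v" "x \<sim>\<^sub>1 X + pt v t"
      unfolding trop_hull_eq [OF A] saturate_iff by blast
    from pt_on_edge [OF vt(1-3)] show "x \<in> saturate (?\<phi> ` internal_verts T) \<union> (\<Union>e\<in>internal_edges T. edge_segment ?\<phi> e)"
    proof
      assume "pt v t = pos z"
      then show ?thesis using vt root_internal by (auto simp: saturate_iff)
    next
      assume "\<exists>u\<in>nodes. \<exists>s. 0 \<le> s \<and> s \<le> w u \<and> pt v t = pos (parent u) + s *\<^sub>R chi (below u)"
      then obtain u s where u: "u \<in> nodes" "0 \<le> s" "s \<le> w u" "pt v t = pos (parent u) + s *\<^sub>R chi (below u)"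
        by blast
      then have "pt v t = pt u (ht (parent u) + s)" using pt_edge by simp
      then have "x \<in> edge_segment ?\<phi> {parent u, u}"
        unfolding segment_pt [OF u(1)] using u vt(4) ht_parent [OF u(1)]
        by (intro exI [of _ "ht (parent u) + s"]) simp
      then show ?thesis using node_edge [OF u(1)] by blast
    qed
  next
    fix x assume "x \<in> saturate (?\<phi> ` internal_verts T) \<union> (\<Union>e\<in>internal_edges T. edge_segment ?\<phi> e)"
    then consider v where "v \<in> internal_verts T" "x \<sim>\<^sub>1 X + pos v"
      | v where "v \<in> nodes" "x \<in> edge_segment ?\<phi> {parent v, v}"
      unfolding internal_edges_eq by (auto simp: saturate_iff)
    then show "x \<in> trop_hull A"
    proof cases
      case (1 v)
      then show ?thesis unfolding trop_hull_eq [OF A] saturate_iff pos_def using ht_nonneg by blast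
    next
      case (2 v)
      then obtain t where "ht (parent v) \<le> t" "t \<le> ht v" "x \<sim>\<^sub>1 X + pt v t"
        using segment_pt by blast
      moreover have "0 \<le> t" using calculation(1) ht_nonneg [of "parent v"] by simp
      ultimately show ?thesis unfolding trop_hull_eq [OF A] saturate_iff using 2(1) nodesD(3) by blast
    qed
  qed
  show "edge_segment ?\<phi> e \<inter> edge_segment ?\<phi> e' = saturate (?\<phi> ` (e \<inter> e'))"
    if e: "e \<in> internal_edges T" "e' \<in> internal_edges T" "e \<noteq> e'" for e e'
  proof
    show "saturate (?\<phi> ` (e \<inter> e')) \<subseteq> edge_segment ?\<phi> e \<inter> edge_segment ?\<phi> e'"
    proof
      fix x assume "x \<in> saturate (?\<phi> ` (e \<inter> e'))"
      then obtain a where a: "a \<in> e" "a \<in> e'" "x \<sim>\<^sub>1 ?\<phi> a" by (auto simp: saturate_iff)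
      then have "?\<phi> a \<in> convex hull (?\<phi> ` e)" "?\<phi> a \<in> convex hull (?\<phi> ` e')"
        by (auto intro: hull_inc)
      then show "x \<in> edge_segment ?\<phi> e \<inter> edge_segment ?\<phi> e'"
        unfolding edge_segment_def using a(3) by (auto simp: saturate_iff)
    qed
    show "edge_segment ?\<phi> e \<inter> edge_segment ?\<phi> e' \<subseteq> saturate (?\<phi> ` (e \<inter> e'))"
    proof
      fix x assume x: "x \<in> edge_segment ?\<phi> e \<inter> edge_segment ?\<phi> e'"
      obtain v1 v2 where v: "v1 \<in> nodes" "v2 \<in> nodes" "e = {parent v1, v1}" "e' = {parent v2, v2}"
        using e internal_edges_eq by auto
      then have ne: "v1 \<noteq> v2" using e by auto
      obtain t1 where t1: "ht (parent v1) \<le> t1" "t1 \<le> ht v1" "x \<sim>\<^sub>1 X + pt v1 t1"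
        using x v segment_pt by blast
      obtain t2 where t2: "ht (parent v2) \<le> t2" "t2 \<le> ht v2" "x \<sim>\<^sub>1 X + pt v2 t2"
        using x v segment_pt by blast
      have "X + pt v1 t1 \<sim>\<^sub>1 X + pt v2 t2" using t1 t2 tequiv_sym tequiv_trans by blast
      then have "pt v1 t1 \<sim>\<^sub>1 pt v2 t2" by (simp add: shift_tequiv)
      moreover have "0 \<le> t1" "0 \<le> t2" using t1(1) t2(1) ht_nonneg [of "parent v1"] ht_nonneg [of "parent v2"] by auto
      ultimately have eq: "t1 = t2" "t1 \<le> pr v1 v2"
        using pt_tequivD [of v1 v2 t1 t2] v nodesD t1 t2 by auto
      \<comment> \<open>Whichever of the two is not an ancestor of the other takes the first place
        in \<open>edge_not_above\<close>.\<close>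
      consider "v1 \<notin> anc v2" | "v2 \<notin> anc v1" using anc_antisym nodesD v ne by blast
      then show "x \<in> saturate (?\<phi> ` (e \<inter> e'))"
      proof cases
        case 1
        then have "t1 = ht (parent v1)" "parent v1 \<in> {parent v2, v2}"
          using edge_not_above [of v1 v2 t1] v ne t1 t2 eq by auto
        then have "x \<sim>\<^sub>1 ?\<phi> (parent v1)" "parent v1 \<in> e \<inter> e'" using t1 pt0 v by auto
        then show ?thesis unfolding saturate_iff by blast
      next
        case 2
        then have "t1 = ht (parent v2)" "parent v2 \<in> {parent v1, v1}"
          using edge_not_above [of v2 v1 t1] v ne t1 t2 eq pr_commute [of v1 v2] by auto
        then have "x \<sim>\<^sub>1 ?\<phi> (parent v2)" "parent v2 \<in> e \<inter> e'" using t2 eq pt0 v by auto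
        then show ?thesis unfolding saturate_iff by blast
      qed
    qed
  qed
  have par: "\<not> (b \<in> nodes \<and> a = parent b)" if "a \<in> nodes" "b = parent a" for a b
  proof
    assume b: "b \<in> nodes \<and> a = parent b"
    have "a \<in> anc b" using b parent_in_anc [of b] nodesD [of b] by auto
    moreover have "b \<in> anc a" using parent_in_anc [of a] nodesD [of a] that by auto
    ultimately have "a = b" using anc_antisym nodesD b that by blast
    then show False using parent_neq nodesD that by metis
  qed
  show "?\<phi> b \<sim>\<^sub>1 ?\<phi> a + len {a, b} *\<^sub>R chi (side a b)" if "{a, b} \<in> internal_edges T" for a b
    using internal_edge_cases [OF that]
  proof
    assume "b \<in> nodes \<and> a = parent b"
    then show ?thesis using pos_edge [of b] by (simp add: side_def w_def add.assoc)
  next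
    assume a: "a \<in> nodes \<and> b = parent a"
    then have "side a b = - below a" using par [of a b] by (auto simp: side_def)
    moreover have "len {a, b} = w a" using a by (simp add: w_def insert_commute)
    moreover have "?\<phi> a = ?\<phi> b + w a *\<^sub>R chi (below a)" using pos_edge a by (simp add: add.assoc)
    ultimately show ?thesis unfolding tequiv_iff by (intro exI [of _ "- w a"]) simp
  qed
  show "len e > 0" if "e \<in> internal_edges T" for e
    using that metric by (simp add: symbic_metric_def)
  show "side a b \<noteq> {} \<and> side a b \<noteq> UNIV" if "{a, b} \<in> internal_edges T" for a b
    using internal_edge_cases [OF that] below_proper [of a] below_proper [of b] par [of a b]
    by (auto simp: side_def)
qed

lemma tree_of_matrix:
  fixes X :: "real^('n::{finite,linorder})" and A :: "real^('n::{finite,linorder})^('n::{finite,linorder})"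
  assumes A: "\<And>i j. A $ i $ j = M i j + X $ i + X $ j"
  shows "is_tree_of_matrix A T len"
proof -
  define \<phi> where "\<phi> = (\<lambda>v. X + pos v)"
  define ray where "ray j = \<phi> (parent (pleaf j))" for j
  have D: "directed_embedding (trop_hull A) (internal_verts T) (internal_edges T) \<phi> side len"
    unfolding \<phi>_def by (rule pos_embedding [OF A])
  interpret directed_embedding "trop_hull A" "internal_verts T" "internal_edges T" \<phi> side len by (rule D)
  have bal: "balanced_rays A ray" unfolding balanced_rays_def
  proof (intro conjI allI ballI)
    show "ray j \<in> trop_hull A" for j
    proof -
      have "ray j \<in> saturate (\<phi> ` internal_verts T)"
        unfolding saturate_iff ray_def
        by (intro bexI [of _ "\<phi> (parent (pleaf j))"] imageI leaf_parent_verts tequiv_refl)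
      then show ?thesis unfolding P_eq by blast
    qed
    fix x assume x: "x \<in> trop_hull A"
    show "\<exists>c. (\<Sum>u\<in>directions (trop_hull A) x. u) + (\<Sum>j | ray j \<sim>\<^sub>1 x. axis j 1) = vec c"
    proof (cases "\<exists>v\<in>internal_verts T. x \<sim>\<^sub>1 \<phi> v")
      case True
      then obtain v where v: "v \<in> internal_verts T" "x \<sim>\<^sub>1 \<phi> v" by blast
      have "ray j \<sim>\<^sub>1 x \<longleftrightarrow> parent (pleaf j) = v" for j
        unfolding ray_def using inj v leaf_parent_verts tequiv_sym tequiv_trans by metis
      then have r: "(\<Sum>j | ray j \<sim>\<^sub>1 x. axis j 1) = (\<Sum>j | parent (pleaf j) = v. axis j (1::int))" by simp
      have "(\<Sum>u\<in>directions (trop_hull A) x. u) =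
        (\<Sum>c | c \<in> nodes \<and> parent c = v. ichi (side v c)) + (if v = z then 0 else ichi (side v (parent v)))"
        unfolding directions_cong [OF v(2)] by (rule vertex_sum [OF D v(1)])
      also have "(\<Sum>c | c \<in> nodes \<and> parent c = v. ichi (side v c)) = (\<Sum>c | c \<in> nodes \<and> parent c = v. ichi (below c))"
        by (intro sum.cong) (auto simp: side_def)
      \<comment> \<open>Since \<open>below z = UNIV\<close>, the missing parent edge of the root
        fits the same formula with the zero vector.\<close>
      also have "(if v = z then 0 else ichi (side v (parent v))) = ichi (- below v)"
      proof (cases "v = z")
        case False
        then have "v \<in> nodes" using v by (simp add: nodes_def)
        then have "\<not> (parent v \<in> nodes \<and> v = parent (parent v))"
          using anc_parent(2) [of v] parent_in_anc [of "parent v"] nodesD by metis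
        then show ?thesis using False by (auto simp: side_def)
      qed (simp add: below_root vec_eq_iff)
      finally have s: "(\<Sum>u\<in>directions (trop_hull A) x. u) =
        (\<Sum>c | c \<in> nodes \<and> parent c = v. ichi (below c)) + ichi (- below v)" .
      \<comment> \<open>Children and rays at \<open>v\<close> partition \<open>below v\<close>, and
        the edge to the parent contributes the complement.\<close>
      have "(\<Sum>u\<in>directions (trop_hull A) x. u) + (\<Sum>j | ray j \<sim>\<^sub>1 x. axis j 1) = vec 1"
        unfolding s r vec_eq_iff
      proof
        fix i
        show "((\<Sum>c | c \<in> nodes \<and> parent c = v. ichi (below c)) + ichi (- below v) + (\<Sum>j | parent (pleaf j) = v. axis j 1)) $ i = vec 1 $ i"
          using child_count [OF v(1), of i] axis_sum_nth [of v i]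
          by (simp add: sum_component split: if_splits)
      qed
      then show ?thesis by blast
    next
      case False
      have "\<not> ray j \<sim>\<^sub>1 x" for j
        unfolding ray_def using False leaf_parent_verts tequiv_sym by blast
      then show ?thesis using sum_directions_inner [OF x] False by (intro exI [of _ 1]) auto
    qed
  qed
  have lens: "len {u, v} = trop_dist (\<phi> u) (\<phi> v)" if "{u, v} \<in> internal_edges T" for u v
    using trop_dist_chi [OF dir [OF that]] len_pos [OF that] proper [OF that] by simp
  have cols: "\<phi> v \<sim>\<^sub>1 column i A" if "{uleaf i, v} \<in> edges T" for i v
  proof -
    have v: "v = parent (uleaf i)" using leaf_edge that by blast
    have "\<phi> v $ k = column i A $ k + (- X $ i)" for k
      using A [of k i] M_sym [of k i] unfolding \<phi>_def v
      by (simp add: column_def pos_parent_leaf M_def)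
    then show ?thesis unfolding tequiv_iff by blast
  qed
  have rays: "\<phi> v \<sim>\<^sub>1 ray j" if "{pleaf j, v} \<in> edges T" for j v
    using leaf_edge [OF that] by (simp add: ray_def)
  show ?thesis unfolding is_tree_of_matrix_def
  proof (intro exI conjI)
    show "balanced_rays A ray" by (rule bal)
    show "\<forall>u\<in>internal_verts T. \<forall>v\<in>internal_verts T. \<phi> u \<sim>\<^sub>1 \<phi> v \<longrightarrow> u = v" using inj by blast
    show "trop_hull A = saturate (\<phi> ` internal_verts T) \<union> (\<Union>e\<in>internal_edges T. edge_segment \<phi> e)"
      by (rule P_eq)
    show "\<forall>e\<in>internal_edges T. \<forall>e'\<in>internal_edges T. e \<noteq> e' \<longrightarrow>
        edge_segment \<phi> e \<inter> edge_segment \<phi> e' = saturate (\<phi> ` (e \<inter> e'))"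
      by (intro ballI impI meet)
    show "\<forall>u v. {u, v} \<in> internal_edges T \<longrightarrow> len {u, v} = trop_dist (\<phi> u) (\<phi> v)"
      by (intro allI impI lens)
    show "\<forall>i v. {uleaf i, v} \<in> edges T \<longrightarrow> \<phi> v \<sim>\<^sub>1 column i A" by (intro allI impI cols)
    show "\<forall>j v. {pleaf j, v} \<in> edges T \<longrightarrow> \<phi> v \<sim>\<^sub>1 ray j" by (intro allI impI rays)
  qed
qed

section \<open>Rigidity: the combinatorial tree and its lengths determine the placement\<close>

lemma matrix_of_placement:
  fixes A :: "real^('n::{finite,linorder})^('n::{finite,linorder})"
    and \<phi> :: "'v \<Rightarrow> real^('n::{finite,linorder})"
  assumes sym: "transpose A = A" and bal: "balanced_rays A ray"
    and inj: "\<forall>u\<in>internal_verts T. \<forall>v\<in>internal_verts T. \<phi> u \<sim>\<^sub>1 \<phi> v \<longrightarrow> u = v"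
    and hull: "trop_hull A = saturate (\<phi> ` internal_verts T) \<union> (\<Union>e\<in>internal_edges T. edge_segment \<phi> e)"
    and meet: "\<forall>e\<in>internal_edges T. \<forall>e'\<in>internal_edges T. e \<noteq> e' \<longrightarrow>
           edge_segment \<phi> e \<inter> edge_segment \<phi> e' = saturate (\<phi> ` (e \<inter> e'))"
    and len: "\<forall>u v. {u, v} \<in> internal_edges T \<longrightarrow> len {u, v} = trop_dist (\<phi> u) (\<phi> v)"
    and lcol: "\<forall>i v. {uleaf i, v} \<in> edges T \<longrightarrow> \<phi> v \<sim>\<^sub>1 column i A"
    and lray: "\<forall>j v. {pleaf j, v} \<in> edges T \<longrightarrow> \<phi> v \<sim>\<^sub>1 ray j"
  shows "\<exists>X. \<forall>i j. A $ i $ j = M i j + X $ i + X $ j"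
proof -
  interpret E: embedding "trop_hull A" "internal_verts T" "internal_edges T" \<phi>
  proof
    show "finite (internal_verts T)" "finite (internal_edges T)" by (rule finite_internal)+
    show "u = v" if "u \<in> internal_verts T" "v \<in> internal_verts T" "\<phi> u \<sim>\<^sub>1 \<phi> v" for u v
      using inj that by simp
    show "edge_segment \<phi> e \<inter> edge_segment \<phi> e' = saturate (\<phi> ` (e \<inter> e'))"
      if "e \<in> internal_edges T" "e' \<in> internal_edges T" "e \<noteq> e'" for e e'
      using meet that by simp
  qed (rule internal_edge_pair hull; assumption?)+
  have "\<exists>S. S \<noteq> {} \<and> S \<noteq> UNIV \<and> \<phi> b \<sim>\<^sub>1 \<phi> a + len {a, b} *\<^sub>R chi S"
    if "{a, b} \<in> internal_edges T" for a b
    using E.edge_direction [OF trop_hull_min that] len that by auto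
  then obtain S where S: "\<And>a b. {a, b} \<in> internal_edges T \<Longrightarrow>
      S a b \<noteq> {} \<and> S a b \<noteq> UNIV \<and> \<phi> b \<sim>\<^sub>1 \<phi> a + len {a, b} *\<^sub>R chi (S a b)"
    by metis
  have D: "directed_embedding (trop_hull A) (internal_verts T) (internal_edges T) \<phi> S len"
    by unfold_locales (use S metric in \<open>auto simp: symbic_metric_def\<close>)
  interpret directed_embedding "trop_hull A" "internal_verts T" "internal_edges T" \<phi> S len by (rule D)
  have rays: "ray j \<sim>\<^sub>1 \<phi> v \<longleftrightarrow> parent (pleaf j) = v" if v: "v \<in> internal_verts T" for j v
  proof -
    have "\<phi> (parent (pleaf j)) \<sim>\<^sub>1 ray j" using lray edge_to_parent by blast
    then show ?thesis using E.inj v leaf_parent_verts tequiv_sym tequiv_trans by metis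
  qed
  \<comment> \<open>Induction from the leaves to the root: balancing at \<open>v\<close> determines the edge to the parent.\<close>
  have below: "S (parent v) v = below v" if "v \<in> nodes" for v
    using that
  proof (induction "card (verts T) - length (rpath v)" arbitrary: v rule: less_induct)
    case less
    then have V: "v \<in> verts T" "v \<noteq> z" "v \<in> internal_verts T" using nodesD by auto
    \<comment> \<open>A child is one step deeper, and depth is bounded by
      \<open>card (verts T)\<close>, so the natural-number difference really decreases.\<close>
    have IH: "S v c = below c" if c: "c \<in> nodes" "parent c = v" for c
    proof -
      have C: "c \<in> verts T" "c \<noteq> z" using nodesD c by auto
      have "length (rpath c) = card (anc c)"
        unfolding anc_def using distinct_rpath [OF C(1)] distinct_card by metis
      then have "length (rpath c) \<le> card (verts T)"
        using card_mono [OF finite_verts anc_verts [OF C(1)]] by simp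
      moreover have "length (rpath c) = Suc (length (rpath v))" using rpath_parent(1) [OF C] c by simp
      ultimately show ?thesis using less.hyps [of c] c by simp
    qed
    have "\<phi> v \<in> trop_hull A" unfolding hull using V by (auto simp: saturate_iff intro!: bexI [of _ v])
    then obtain c where c: "(\<Sum>u\<in>directions (trop_hull A) (\<phi> v). u) + (\<Sum>j | ray j \<sim>\<^sub>1 \<phi> v. axis j 1) = vec c"
      using bal unfolding balanced_rays_def by blast
    have "(\<Sum>u\<in>directions (trop_hull A) (\<phi> v). u) =
      (\<Sum>c | c \<in> nodes \<and> parent c = v. ichi (below c)) + ichi (S v (parent v))"
      using vertex_sum [OF D V(3)] V(2) IH by simp
    moreover have "S v (parent v) = - S (parent v) v" by (rule S_swap [OF node_edge [OF less.prems]])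
    ultimately have eq: "(\<Sum>c | c \<in> nodes \<and> parent c = v. ichi (below c)) + ichi (- S (parent v) v)
        + (\<Sum>j | parent (pleaf j) = v. axis j 1) = vec c"
      using c rays [OF V(3)] by simp
    have key: "(if i \<in> below v then 1 else 0) + (if i \<in> S (parent v) v then 0 else 1) = c" for i
    proof -
      have "((\<Sum>c | c \<in> nodes \<and> parent c = v. ichi (below c)) + ichi (- S (parent v) v)
        + (\<Sum>j | parent (pleaf j) = v. axis j 1)) $ i = c" unfolding eq by simp
      then show ?thesis using child_count [OF V(3), of i] axis_sum_nth [of v i]
        by (simp add: sum_component split: if_splits)
    qed
    have p: "S (parent v) v \<noteq> {}" "S (parent v) v \<noteq> UNIV" using S node_edge [OF less.prems] by auto
    note q = below_proper [OF less.prems]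
    obtain i where i: "i \<notin> S (parent v) v" using p by auto
    obtain i' where i': "i' \<in> S (parent v) v" using p by auto
    obtain j where j: "j \<in> below v" using q by auto
    obtain j' where j': "j' \<notin> below v" using q by auto
    \<comment> \<open>An index outside \<open>S (parent v) v\<close> gives \<open>c \<ge> 1\<close>,
      one inside gives \<open>c \<le> 1\<close>. With \<open>c = 1\<close>, \<open>key\<close> says
      that the two sets agree.\<close>
    have "c = 1" using key [of i] key [of i'] key [of j] key [of j'] i i' j j' by (auto split: if_splits)
    show ?case
    proof (rule set_eqI)
      fix k show "k \<in> S (parent v) v \<longleftrightarrow> k \<in> below v"
        using key [of k] \<open>c = 1\<close> by (auto split: if_splits)
    qed
  qed
  have place: "\<phi> v \<sim>\<^sub>1 \<phi> z + pos v" if "v \<in> internal_verts T" for v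
    using that
  proof (induction "length (rpath v)" arbitrary: v rule: less_induct)
    case less
    show ?case
    proof (cases "v = z")
      case True
      have "pos z = 0" by (simp add: vec_eq_iff pos_nth)
      then show ?thesis using True by simp
    next
      case False
      then have v: "v \<in> nodes" using less.prems by (simp add: nodes_def)
      have V: "v \<in> verts T" "v \<noteq> z" using nodesD v by auto
      have "\<phi> (parent v) \<sim>\<^sub>1 \<phi> z + pos (parent v)"
        using less.hyps [of "parent v"] rpath_parent(1) [OF V] parent_internal [OF V] by simp
      then have "\<phi> (parent v) + w v *\<^sub>R chi (below v) \<sim>\<^sub>1 (\<phi> z + pos (parent v)) + w v *\<^sub>R chi (below v)"
        by (rule tequiv_add) simp
      moreover have "\<phi> v \<sim>\<^sub>1 \<phi> (parent v) + w v *\<^sub>R chi (below v)"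
        using dir [OF node_edge [OF v]] below [OF v] by (simp add: w_def)
      ultimately have "\<phi> v \<sim>\<^sub>1 (\<phi> z + pos (parent v)) + w v *\<^sub>R chi (below v)"
        using tequiv_trans by blast
      then show ?thesis by (simp add: pos_edge [OF v] add.assoc)
    qed
  qed
  have "\<exists>y. \<forall>i. A $ i $ j = \<phi> z $ i + M i j + y" for j
  proof -
    have "\<phi> (parent (uleaf j)) \<sim>\<^sub>1 column j A" using lcol edge_to_parent by blast
    then have "column j A \<sim>\<^sub>1 \<phi> z + pos (parent (uleaf j))"
      using place [OF leaf_parent_verts] tequiv_sym tequiv_trans by blast
    then obtain y where "\<And>i. column j A $ i = \<phi> z $ i + pos (parent (uleaf j)) $ i + y"
      by (auto simp: tequiv_iff)
    moreover have "pos (parent (uleaf j)) $ i = M i j" for i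
      using M_sym [of i j] by (simp add: pos_parent_leaf M_def)
    ultimately show ?thesis by (auto simp: column_def)
  qed
  then obtain Y where Y: "\<And>i j. A $ i $ j = \<phi> z $ i + M i j + Y j" by metis
  have As: "A $ i $ j = A $ j $ i" for i j
    using arg_cong [OF sym, of "\<lambda>B. B $ j $ i"] by (simp add: transpose_def)
  \<comment> \<open>By symmetry of \<open>A\<close> and \<open>M\<close>, \<open>Y j\<close> exceeds
    \<open>\<phi> z $ j\<close> by the same amount for all \<open>j\<close>; half of it goes to the
    rows and half to the columns.\<close>
  define k where "k = Y undefined - \<phi> z $ undefined"
  have "Y j = \<phi> z $ j + k" for j
    using As [of j undefined] Y [of j undefined] Y [of undefined j] M_sym [of j undefined] by (simp add: k_def)
  then have "A $ i $ j = M i j + (\<phi> z + vec (k / 2)) $ i + (\<phi> z + vec (k / 2)) $ j" for i j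
    using Y [of i j] by simp
  then show ?thesis by blast
qed

lemma matrix_of_tree:
  fixes A :: "real^('n::{finite,linorder})^('n::{finite,linorder})"
  assumes "is_tree_of_matrix A T len" and sym: "transpose A = A"
  shows "\<exists>X. \<forall>i j. A $ i $ j = M i j + X $ i + X $ j"
  using assms(1) unfolding is_tree_of_matrix_def
  by (elim exE conjE) (rule matrix_of_placement [OF sym]; assumption)

end

section \<open>Polyhedrality\<close>

definition sq :: "real^'n \<Rightarrow> real^'n^'n" where "sq x = (\<chi> i j. x $ i + x $ j)"

lemma trop_squares_eq: "trop_squares = range sq"
  by (auto simp: trop_squares_def sq_def)

lemma linear_sq: "linear sq"
  by (rule linearI) (auto simp: sq_def vec_eq_iff algebra_simps)

lemma sq_sum_axis: "sq (x :: real^'n::finite) = (\<Sum>k\<in>UNIV. x $ k *\<^sub>R sq (axis k 1))"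
proof -
  have "x = (\<Sum>k\<in>UNIV. x $ k *\<^sub>R axis k 1)" by (metis basis_expansion scalar_mult_eq_scaleR)
  then have "sq x = sq (\<Sum>k\<in>UNIV. x $ k *\<^sub>R axis k 1)" by simp
  also have "\<dots> = (\<Sum>k\<in>UNIV. x $ k *\<^sub>R sq (axis k 1))"
    by (simp add: linear_sum [OF linear_sq] linear_cmul [OF linear_sq])
  finally show ?thesis .
qed

lemma convex_cone_sum_mem:
  assumes "convex_cone C" "\<And>j. j \<in> J \<Longrightarrow> f j \<in> C"
  shows "sum f J \<in> C"
  using assms(2) by (induction J rule: infinite_finite_induct) (use assms(1) in \<open>auto simp: convex_cone_iff\<close>)

text \<open>The closed cone \<open>K\<close> is finitely generated, hence a polyhedron. Its relative
  interior is the sum of the relative interiors of its rays and of the linear space, which is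
  exactly the set of combinations with strictly positive coefficients. A vanishing
  \<open>G i\<close> is covered too, its ray being the point 0.\<close>

lemma polyhedral_cone_open_combinations:
  fixes G :: "'i \<Rightarrow> real^('n::finite)^'n"
  assumes I: "finite I"
  shows "polyhedral_cone ({(\<Sum>i\<in>I. c i *\<^sub>R G i) | c. \<forall>i\<in>I. c i > 0} + trop_squares)"
proof -
  define ray where "ray i = (\<lambda>t. t *\<^sub>R G i) ` {0::real..}" for i
  define oray where "oray i = (\<lambda>t. t *\<^sub>R G i) ` {0::real<..}" for i
  define K where "K = sum ray I + range sq"
  have lin: "linear (\<lambda>t. t *\<^sub>R G i)" for i by (rule linearI) (auto simp: algebra_simps)
  have conv: "convex (ray i)" for i
    unfolding ray_def by (rule convex_linear_image [OF lin]) simp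
  have ri: "rel_interior (ray i) = oray i" for i
    unfolding ray_def oray_def
    using rel_interior_convex_linear_image [OF lin [of i], of "{0..}"]
    by (simp add: rel_interior_nonempty_interior)
  have sub: "subspace (range sq :: (real^'n^'n) set)" by (rule linear_subspace_image [OF linear_sq]) simp
  have C: "{(\<Sum>i\<in>I. c i *\<^sub>R G i) | c. \<forall>i\<in>I. c i > 0} = sum oray I"
  proof (intro set_eqI iffI)
    fix x assume "x \<in> {(\<Sum>i\<in>I. c i *\<^sub>R G i) | c. \<forall>i\<in>I. c i > 0}"
    then show "x \<in> sum oray I" unfolding set_sum_alt [OF I] oray_def by fastforce
  next
    fix x assume "x \<in> sum oray I"
    then obtain s where s: "x = sum s I" "\<forall>i\<in>I. s i \<in> oray i" unfolding set_sum_alt [OF I] by blast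
    then have "\<forall>i\<in>I. \<exists>t>0. s i = t *\<^sub>R G i" by (auto simp: oray_def)
    then obtain c where "\<forall>i\<in>I. c i > 0 \<and> s i = c i *\<^sub>R G i" by metis
    then show "x \<in> {(\<Sum>i\<in>I. c i *\<^sub>R G i) | c. \<forall>i\<in>I. c i > 0}" using s(1) by (auto intro!: exI [of _ c])
  qed
  have "rel_interior K = sum oray I + range sq"
  proof -
    have "rel_interior K = rel_interior (sum ray I) + rel_interior (range sq)"
      unfolding K_def
      by (intro rel_interior_sum convex_set_sum conv subspace_imp_convex sub)
    also have "rel_interior (sum ray I) = sum oray I"
      using rel_interior_sum_gen [of I ray] conv ri by simp
    also have "rel_interior (range sq :: (real^'n^'n) set) = range sq"
      by (intro rel_interior_affine subspace_imp_affine sub)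
    finally show ?thesis .
  qed
  moreover have cone_ray: "0 \<in> ray i" "x \<in> ray i \<Longrightarrow> y \<in> ray i \<Longrightarrow> x + y \<in> ray i"
    "x \<in> ray i \<Longrightarrow> c \<ge> 0 \<Longrightarrow> c *\<^sub>R x \<in> ray i" for i x y c
  proof -
    show "0 \<in> ray i" unfolding ray_def by (rule image_eqI [of _ _ 0]) auto
    show "x + y \<in> ray i" if xy: "x \<in> ray i" "y \<in> ray i"
    proof -
      obtain s t where "s \<ge> 0" "t \<ge> 0" "x = s *\<^sub>R G i" "y = t *\<^sub>R G i"
        using xy unfolding ray_def by auto
      then show ?thesis unfolding ray_def by (intro image_eqI [of _ _ "s + t"]) (auto simp: algebra_simps)
    qed
    show "c *\<^sub>R x \<in> ray i" if x: "x \<in> ray i" and c: "c \<ge> 0"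
    proof -
      obtain s where "s \<ge> 0" "x = s *\<^sub>R G i" using x by (auto simp: ray_def)
      then show ?thesis unfolding ray_def using c by (intro image_eqI [of _ _ "c * s"]) auto
    qed
  qed
  have K_iff: "x \<in> K \<longleftrightarrow> (\<exists>s y. (\<forall>i\<in>I. s i \<in> ray i) \<and> x = sum s I + sq y)" for x
    unfolding K_def set_plus_def set_sum_alt [OF I] by blast
  have cone: "convex_cone K"
    unfolding convex_cone_iff
  proof (intro conjI ballI allI impI)
    show "0 \<in> K" unfolding K_iff
      by (intro exI [of _ "\<lambda>_. 0"] exI [of _ 0]) (simp add: cone_ray linear_0 [OF linear_sq])
    show "x + y \<in> K" if xy: "x \<in> K" "y \<in> K" for x y
    proof -
      obtain s u t v where "\<forall>i\<in>I. s i \<in> ray i" "x = sum s I + sq u" "\<forall>i\<in>I. t i \<in> ray i" "y = sum t I + sq v"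
        using xy unfolding K_iff by blast
      then show ?thesis unfolding K_iff
        by (intro exI [of _ "\<lambda>i. s i + t i"] exI [of _ "u + v"])
          (simp add: cone_ray sum.distrib linear_add [OF linear_sq])
    qed
    show "c *\<^sub>R x \<in> K" if x: "x \<in> K" and c: "c \<ge> 0" for x c
    proof -
      obtain s u where "\<forall>i\<in>I. s i \<in> ray i" "x = sum s I + sq u" using x unfolding K_iff by blast
      then show ?thesis unfolding K_iff
        by (intro exI [of _ "\<lambda>i. c *\<^sub>R s i"] exI [of _ "c *\<^sub>R u"])
          (simp add: cone_ray c scaleR_sum_right scaleR_add_right linear_cmul [OF linear_sq])
    qed
  qed
  \<comment> \<open>A linear space is generated as a cone by a spanning set together with its
    negatives.\<close>
  define F where "F = G ` I \<union> range (\<lambda>k. sq (axis k 1)) \<union> range (\<lambda>k. - sq (axis k (1::real)))"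
  have "K = convex_cone hull F"
  proof
    show "convex_cone hull F \<subseteq> K"
    proof (rule hull_minimal)
      show "F \<subseteq> K"
      proof
        fix x assume "x \<in> F"
        moreover have "- sq y = sq (- y)" for y :: "real^'n"
          by (simp add: linear_neg [OF linear_sq])
        ultimately consider i where "i \<in> I" "x = G i" | y where "x = sq y"
          unfolding F_def by blast
        then show "x \<in> K"
        proof cases
          case (1 i)
          have "G i \<in> ray i" unfolding ray_def by (rule image_eqI [of _ _ 1]) auto
          then show ?thesis unfolding K_iff using 1 I
            by (intro exI [of _ "\<lambda>j. if j = i then G i else 0"] exI [of _ 0])
              (auto simp: cone_ray linear_0 [OF linear_sq])
        next
          case (2 y)
          then show ?thesis unfolding K_iff by (intro exI [of _ "\<lambda>_. 0"] exI [of _ y]) (simp add: cone_ray)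
        qed
      qed
    qed (rule cone)
    have H: "convex_cone (convex_cone hull F)" by (rule convex_cone_convex_cone_hull)
    have Hadd: "x \<in> convex_cone hull F \<Longrightarrow> y \<in> convex_cone hull F \<Longrightarrow> x + y \<in> convex_cone hull F"
      and Hsc: "x \<in> convex_cone hull F \<Longrightarrow> c \<ge> 0 \<Longrightarrow> c *\<^sub>R x \<in> convex_cone hull F" for x y c
      using H unfolding convex_cone_iff by blast+
    have FH: "x \<in> convex_cone hull F" if "x \<in> F" for x using that by (rule hull_inc)
    show "K \<subseteq> convex_cone hull F"
    proof
      fix x assume "x \<in> K"
      then obtain s y where sy: "\<forall>i\<in>I. s i \<in> ray i" "x = sum s I + sq y" unfolding K_iff by blast
      have "s i \<in> convex_cone hull F" if i: "i \<in> I" for i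
      proof -
        obtain t where "t \<ge> 0" "s i = t *\<^sub>R G i" using sy i by (auto simp: ray_def)
        moreover have "G i \<in> convex_cone hull F" using i by (intro FH) (auto simp: F_def)
        ultimately show ?thesis using Hsc by simp
      qed
      then have 1: "sum s I \<in> convex_cone hull F"
        by (rule convex_cone_sum_mem [OF H])
      have "y $ k *\<^sub>R sq (axis k 1) \<in> convex_cone hull F" for k
      proof (cases "y $ k \<ge> 0")
        case True
        have "sq (axis k 1) \<in> convex_cone hull F" by (intro FH) (auto simp: F_def)
        then show ?thesis using Hsc True by blast
      next
        case False
        have "- sq (axis k 1) \<in> convex_cone hull F" by (intro FH) (auto simp: F_def)
        then have "(- (y $ k)) *\<^sub>R (- sq (axis k 1)) \<in> convex_cone hull F"
          by (rule Hsc) (use False in simp)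
        then show ?thesis by simp
      qed
      then have "sq y \<in> convex_cone hull F" unfolding sq_sum_axis [of y] by (intro convex_cone_sum_mem [OF H])
      then show "x \<in> convex_cone hull F" using 1 Hadd sy(2) by blast
    qed
  qed
  moreover have "finite F" using I by (simp add: F_def)
  ultimately have "polyhedron K" by (simp add: polyhedron_convex_cone_hull)
  then show ?thesis unfolding polyhedral_cone_def C trop_squares_eq
    using cone \<open>rel_interior K = sum oray I + range sq\<close> by metis
qed

section \<open>Symmetric length functions and orbits of edges\<close>

locale finite_symbic_tree = symbic_tree T z \<sigma>
  for T :: "('v, 'n::{finite,linorder}) ltree" and z :: 'v and \<sigma> :: "'v \<Rightarrow> 'v"
begin

lemma involution_image_internal:
  assumes "e \<in> internal_edges T"
  shows "\<sigma> ` e \<in> internal_edges T" "\<sigma> ` \<sigma> ` e = e"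
proof -
  obtain v where v: "v \<in> nodes" "e = {parent v, v}" using assms internal_edges_eq by auto
  then have V: "v \<in> verts T" "v \<noteq> z" "parent v \<in> verts T" using nodesD rpath_parent by auto
  have "\<sigma> v \<in> nodes" using involution_nodes v by blast
  moreover have "\<sigma> ` e = {parent (\<sigma> v), \<sigma> v}" using v parent_involution V by simp
  ultimately show "\<sigma> ` e \<in> internal_edges T" unfolding internal_edges_eq by blast
  show "\<sigma> ` \<sigma> ` e = e" using v V involution_idem by simp
qed

lemma finite_internal_edges: "finite (internal_edges T)"
  by (simp add: internal_edges_eq)

lemma involution_image_unique:
  assumes "color_involution T \<tau>" "e \<in> internal_edges T"
  shows "\<tau> ` e = \<sigma> ` e"
proof -
  have "e \<subseteq> verts T" using assms(2) edge_subset by (auto simp: internal_edges_def)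
  then show ?thesis using involution_unique [OF assms(1)] by (intro image_cong) auto
qed

lemma A_matrix_scale: "A_matrix T (\<lambda>e. c * len e) z = c *\<^sub>R A_matrix T len z"
  by (simp add: A_matrix_def internal_length_def vec_eq_iff sum_distrib_left)

lemma symbic_metric_scale: "symbic_metric T len \<Longrightarrow> c > 0 \<Longrightarrow> symbic_metric T (\<lambda>e. c * len e)"
  by (auto simp: symbic_metric_def)

lemma A_matrix_add: "A_matrix T (\<lambda>e. f e + g e) z = A_matrix T f z + A_matrix T g z"
  by (simp add: A_matrix_def internal_length_def vec_eq_iff sum.distrib)

lemma A_matrix_cong:
  assumes "\<And>e. e \<in> internal_edges T \<Longrightarrow> f e = g e"
  shows "A_matrix T f z = A_matrix T g z"
  unfolding A_matrix_def internal_length_def using assms by (auto simp: vec_eq_iff intro!: sum.cong)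

lemma A_matrix_lincomb:
  assumes "finite J"
  shows "A_matrix T (\<lambda>e. \<Sum>k\<in>J. c k * f k e) z = (\<Sum>k\<in>J. c k *\<^sub>R A_matrix T (f k) z)"
  using assms
proof induction
  case empty
  then show ?case by (simp add: A_matrix_def internal_length_def vec_eq_iff)
next
  case (insert k J)
  then show ?case by (simp add: A_matrix_add A_matrix_scale)
qed

definition orbit_len :: "'v set \<Rightarrow> 'v set \<Rightarrow> real" where
  "orbit_len d e = of_bool (e = d) + of_bool (e = \<sigma> ` d)"

lemma orbit_len_sum:
  assumes "e \<in> internal_edges T"
  shows "(\<Sum>d\<in>internal_edges T. c d * orbit_len d e) = c e + c (\<sigma> ` e)"
proof -
  have "e = \<sigma> ` d \<longleftrightarrow> d = \<sigma> ` e" if "d \<in> internal_edges T" for d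
    using involution_image_internal(2) assms that by metis
  then have "(\<Sum>d\<in>internal_edges T. c d * orbit_len d e) =
      (\<Sum>d\<in>internal_edges T. (if d = e then c d else 0) + (if d = \<sigma> ` e then c d else 0))"
    by (intro sum.cong) (auto simp: orbit_len_def)
  also have "\<dots> = c e + c (\<sigma> ` e)"
    using finite_internal_edges assms involution_image_internal(1) by (simp add: sum.distrib)
  finally show ?thesis .
qed

lemma A_matrices_eq_open_combinations:
  "{A_matrix T len z | len. symbic_metric T len} =
    {(\<Sum>d\<in>internal_edges T. c d *\<^sub>R A_matrix T (orbit_len d) z) | c. \<forall>d\<in>internal_edges T. c d > 0}"
proof (intro set_eqI iffI)
  fix B assume "B \<in> {A_matrix T len z | len. symbic_metric T len}"
  then obtain len where len: "symbic_metric T len" "B = A_matrix T len z" by blast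
  \<comment> \<open>Each edge receives the coefficients of itself and of its image, which have equal
    length; a fixed edge receives its own twice.\<close>
  define c where "c e = len e / 2" for e
  have "len e = (\<Sum>d\<in>internal_edges T. c d * orbit_len d e)" if "e \<in> internal_edges T" for e
  proof -
    have "len (\<sigma> ` e) = len e" using len(1) that involution by (simp add: symbic_metric_def)
    then have "len e = c e + c (\<sigma> ` e)" by (simp add: c_def)
    then show ?thesis using orbit_len_sum [OF that, of c] by simp
  qed
  then have "B = A_matrix T (\<lambda>e. \<Sum>d\<in>internal_edges T. c d * orbit_len d e) z"
    unfolding len(2) by (intro A_matrix_cong)
  also have "\<dots> = (\<Sum>d\<in>internal_edges T. c d *\<^sub>R A_matrix T (orbit_len d) z)"
    by (rule A_matrix_lincomb [OF finite_internal_edges])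
  finally show "B \<in> {(\<Sum>d\<in>internal_edges T. c d *\<^sub>R A_matrix T (orbit_len d) z) | c. \<forall>d\<in>internal_edges T. c d > 0}"
    using len(1) by (auto simp: c_def symbic_metric_def intro!: exI [of _ c])
next
  fix B assume "B \<in> {(\<Sum>d\<in>internal_edges T. c d *\<^sub>R A_matrix T (orbit_len d) z) | c. \<forall>d\<in>internal_edges T. c d > 0}"
  then obtain c where c: "\<forall>d\<in>internal_edges T. c d > 0" "B = (\<Sum>d\<in>internal_edges T. c d *\<^sub>R A_matrix T (orbit_len d) z)"
    by blast
  define len where "len e = (\<Sum>d\<in>internal_edges T. c d * orbit_len d e)" for e
  have le: "len e = c e + c (\<sigma> ` e)" if "e \<in> internal_edges T" for e
    unfolding len_def using orbit_len_sum that by blast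
  have "symbic_metric T len" unfolding symbic_metric_def
  proof (intro conjI ballI allI impI)
    show "len e > 0" if "e \<in> internal_edges T" for e
      using le [OF that] c(1) that involution_image_internal(1) [OF that] by (simp add: add_pos_pos)
    \<comment> \<open>All colour involutions act on the internal edges as \<open>\<sigma>\<close>
      does, so symmetry of the sum under \<open>\<sigma>\<close> is enough.\<close>
    show "len (\<tau> ` e) = len e" if "color_involution T \<tau>" "e \<in> internal_edges T" for \<tau> e
      using involution_image_unique [OF that] le [OF that(2)] le [OF involution_image_internal(1) [OF that(2)]]
        involution_image_internal(2) [OF that(2)] by simp
  qed
  moreover have "B = A_matrix T len z"
    unfolding c(2) len_def by (rule A_matrix_lincomb [OF finite_internal_edges, symmetric])
  ultimately show "B \<in> {A_matrix T len z | len. symbic_metric T len}" by blast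
qed

end

theorem proposition3p2:
  fixes T :: "('v, 'n::{finite,linorder}) ltree"
    and \<sigma> :: "'v \<Rightarrow> 'v" and z :: 'v
  assumes "combinatorial_symbic_tree T"
    and "color_involution T \<sigma>" and "z \<in> verts T" and "\<sigma> z = z"
  shows "polyhedral_cone (matrices_of_type T) \<and>
    matrices_of_type T = {A_matrix T len z | len. symbic_metric T len} + trop_squares \<and>
    matrices_of_type T = {- B_matrix T len | len. symbic_metric T len} + trop_squares"
proof -
  interpret finite_symbic_tree T z \<sigma>
  proof
    show "is_tree T" using assms(1) by (simp add: combinatorial_symbic_tree_def)
  qed (rule assms)+
  have loc: "metric_symbic_tree T z \<sigma> len" if "symbic_metric T len" for len
    by unfold_locales (rule that)
  have type: "matrices_of_type T = {A_matrix T len z | len. symbic_metric T len} + trop_squares"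
  proof (intro set_eqI iffI)
    fix A assume "A \<in> matrices_of_type T"
    then obtain len where A: "transpose A = A" "symbic_metric T len" "is_tree_of_matrix A T len"
      unfolding matrices_of_type_def by blast
    interpret metric_symbic_tree T z \<sigma> len by (rule loc [OF A(2)])
    obtain X where "\<forall>i j. A $ i $ j = M i j + X $ i + X $ j" using matrix_of_tree A by blast
    then have "A = A_matrix T len z + sq X"
      by (simp add: vec_eq_iff A_matrix_eq sq_def)
    then show "A \<in> {A_matrix T len z | len. symbic_metric T len} + trop_squares"
      unfolding trop_squares_eq set_plus_def using A(2) by blast
  next
    fix A assume "A \<in> {A_matrix T len z | len. symbic_metric T len} + trop_squares"
    then obtain len X where A: "symbic_metric T len" "A = A_matrix T len z + sq X"
      unfolding trop_squares_eq set_plus_def by blast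
    interpret metric_symbic_tree T z \<sigma> len by (rule loc [OF A(1)])
    have eq: "A $ i $ j = M i j + X $ i + X $ j" for i j
      using A(2) by (simp add: A_matrix_eq sq_def)
    moreover have "transpose A = A" using eq M_sym by (simp add: vec_eq_iff transpose_def)
    ultimately show "A \<in> matrices_of_type T"
      unfolding matrices_of_type_def using rank_2 [OF eq] tree_of_matrix [OF eq] A(1) by blast
  qed
  have B: "\<exists>X. - B_matrix T len = 2 *\<^sub>R A_matrix T len z + sq X" if "symbic_metric T len" for len
  proof -
    interpret metric_symbic_tree T z \<sigma> len by (rule loc [OF that])
    have "- B_matrix T len = 2 *\<^sub>R A_matrix T len z + sq (\<chi> i. - ht (uleaf i))"
      by (simp add: vec_eq_iff A_matrix_eq B_matrix_eq sq_def)
    then show ?thesis by blast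
  qed
  have "{A_matrix T len z | len. symbic_metric T len} + trop_squares =
    {- B_matrix T len | len. symbic_metric T len} + trop_squares"
  proof (intro set_eqI iffI)
    fix A assume "A \<in> {A_matrix T len z | len. symbic_metric T len} + trop_squares"
    then obtain len X where A: "symbic_metric T len" "A = A_matrix T len z + sq X"
      unfolding trop_squares_eq set_plus_def by blast
    define l where "l e = (1/2) * len e" for e
    have l: "symbic_metric T l" unfolding l_def by (rule symbic_metric_scale [OF A(1)]) simp
    then obtain Y where Y: "- B_matrix T l = 2 *\<^sub>R A_matrix T l z + sq Y" using B by blast
    have "2 *\<^sub>R A_matrix T l z = A_matrix T len z" unfolding l_def A_matrix_scale by simp
    then have "A = - B_matrix T l + sq (X - Y)"
      using A(2) Y by (simp add: linear_diff [OF linear_sq])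
    then show "A \<in> {- B_matrix T len | len. symbic_metric T len} + trop_squares"
      unfolding trop_squares_eq set_plus_def using l by blast
  next
    fix A assume "A \<in> {- B_matrix T len | len. symbic_metric T len} + trop_squares"
    then obtain len X where A: "symbic_metric T len" "A = - B_matrix T len + sq X"
      unfolding trop_squares_eq set_plus_def by blast
    define l where "l e = 2 * len e" for e
    have l: "symbic_metric T l" unfolding l_def by (rule symbic_metric_scale [OF A(1)]) simp
    obtain Y where "- B_matrix T len = 2 *\<^sub>R A_matrix T len z + sq Y" using B A by blast
    then have "A = A_matrix T l z + sq (Y + X)"
      using A(2) unfolding l_def A_matrix_scale by (simp add: linear_add [OF linear_sq])
    then show "A \<in> {A_matrix T len z | len. symbic_metric T len} + trop_squares"
      unfolding trop_squares_eq set_plus_def using l by blast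
  qed
  moreover have "polyhedral_cone (matrices_of_type T)"
    unfolding type A_matrices_eq_open_combinations
    by (rule polyhedral_cone_open_combinations [OF finite_internal_edges])
  ultimately show ?thesis using type by simp
qed

end
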